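(* Let $p:F\to B$ and $\zeta:C\to B$ be smooth fibred manifolds and let $(C,\zeta,\epsilon)$ be a smooth system of smooth connections of $p:F\to B$, with evaluation map regarded as $\epsilon: C\times_B(F\times_B TB)\to TF$. Let $F^\uparrow:=C\times_B F$, $p^\uparrow:F^\uparrow\to C$, and let $\epsilon^\uparrow: F^\uparrow\times_C TC\to TF^\uparrow$ be the associated smooth (reducible) connection of $p^\uparrow:F^\uparrow\to C$. Then the following hold. 1) All connections of the system are pullbacks of $\epsilon^\uparrow$: for each local smooth section $\gamma$ of $\zeta:C\to B$, $$\breve\gamma=\gamma^*(\epsilon^\uparrow).$$ 2) The curvature tensors of all connections of the system are pullbacks of the curvature tensor $R[\epsilon^\uparrow]:F^\uparrow\times_C\Lambda^2TC\to V_CF^\uparrow$: for each local smooth section $\gamma$ of $\zeta:C\to B$, $$R[\breve\gamma]=\gamma^*\big(R[\epsilon^\uparrow]\big).$$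
   Context: A smooth fibred manifold is a surjective submersion. A smooth connection of $p:F\to B$ is a smooth fibred morphism $c:F\times_B TB\to TF$ over $F$ and over $TB$ (i.e. $c(f,v)\in T_fF$ and $Tp(c(f,v))=v$), linear in $TB$; equivalently a tangent valued form $c:F\to T^*B\otimes TF$ projecting on the identity section $\mathbf 1_B:B\to T^*B\otimes TB$. In a fibred chart $(x^\lambda,y^i)$, $c=d^\lambda\otimes(\partial_\lambda+c_\lambda{}^i\,\partial_i)$. A smooth system of smooth connections of $p:F\to B$ is a triple $(C,\zeta,\epsilon)$ where $\zeta:C\to B$ is a smooth fibred manifold and $\epsilon:C\times_BF\to T^*B\otimes TF$ is a smooth fibred morphism over $\mathrm{id}_F$ and over $\mathbf 1_B$; equivalently a smooth map $\epsilon:C\times_B(F\times_BTB)\to TF$, linear in $TB$, such that $\epsilon(k,f,v)\in T_fF$ and $Tp(\epsilon(k,f,v))=v$. For a smooth section $\gamma:U\to C$ of $\zeta$ over an open $U\subset B$, the associated connection of the system, defined over $p^{-1}(U)$, is $\breve\gamma(f)=\epsilon(\gamma(b),f)$ for $f\in F_b$, $b\in U$. We have $TF^\uparrow=TC\times_{TB}TF$, and $\epsilon^\uparrow$ is defined by $\epsilon^\uparrow(f^\uparrow,X):=\big(X,\ \epsilon(f^\uparrow)(T\zeta(X))\big)$ for $f^\uparrow\in F^\uparrow$ over $k\in C$ and $X\in T_kC$. The composition of $\epsilon^\uparrow$ with the projection $TF^\uparrow\to TF$ factorises through $\mathrm{id}_{F^\uparrow}\times T\zeta: F^\uparrow\times_CTC\to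 F^\uparrow\times_BTB=C\times_B(F\times_BTB)$, the factor map being $\epsilon$. Let $\gamma_F:F\to F^\uparrow$, $\gamma_F(f):=(\gamma(b),f)$ for $f\in F_b$ (over the domain of $\gamma$). The pullback $\gamma^*(\epsilon^\uparrow)$ is the connection of $F\to B$ (over the domain of $\gamma$) defined as the composition $$F\times_BTB\xrightarrow{\ \gamma_F\times\mathrm{id}\ }F^\uparrow\times_BTB\xrightarrow{\ \epsilon\ }TF .$$ The curvature of a connection $c$ of a fibred manifold $E\to M$ with fibred chart $(x^\alpha,y^i)$ is the vertical valued 2-form $R[c]:E\times_M\Lambda^2TM\to V_ME$ with coordinate expression $R[c]=-2\,(\partial_\alpha c_\beta{}^i+c_\alpha{}^j\,\partial_jc_\beta{}^i)\,d^\alpha\wedge d^\beta\otimes\partial_i$. The pullback $\gamma^*(R[\epsilon^\uparrow]):F\times_B\Lambda^2TB\to VF$ is the composition of $\gamma_F\times\Lambda^2T\gamma:F\times_B\Lambda^2TB\to F^\uparrow\times_C\Lambda^2TC$, of $R[\epsilon^\uparrow]$, and of the natural projection $V_CF^\uparrow=C\times_BVF\to VF$. *)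

theory Defs
  imports "HOL-Analysis.Analysis"
begin

section \<open>Model spaces and smooth functions\<close>

text \<open>
  The axioms of \<^class>\<open>euclidean_space\<close> without the requirement that the basis be nonempty:
  the types of this class are the copies of $R^n$ for all $n \geq 0$. Dimension 0 is needed,
  for instance, for a system that consists of a single connection (fibre of \<open>C\<close> a point).
\<close>

class coordinate_space = real_inner +
  assumes ex_orthonormal_basis:
    "\<exists>S. finite S \<and> (\<forall>u\<in>S. \<forall>v\<in>S. inner u v = (if u = v then 1 else 0)) \<and>
         (\<forall>x. (\<forall>u\<in>S. inner x u = 0) \<longleftrightarrow> x = 0)"

instance euclidean_space \<subseteq> coordinate_space
proof
  show "\<exists>S::'a set. finite S \<and> (\<forall>u\<in>S. \<forall>v\<in>S. inner u v = (if u = v then 1 else 0)) \<and>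
         (\<forall>x. (\<forall>u\<in>S. inner x u = 0) \<longleftrightarrow> x = 0)"
    by (rule exI[of _ Basis]) (simp add: inner_Basis euclidean_all_zero_iff)
qed

instance prod :: (coordinate_space, coordinate_space) coordinate_space
proof
  obtain S :: "'a set" where S: "finite S" "\<forall>u\<in>S. \<forall>v\<in>S. inner u v = (if u = v then 1 else 0)"
      "\<forall>x. (\<forall>u\<in>S. inner x u = 0) \<longleftrightarrow> x = 0"
    using ex_orthonormal_basis[where 'a = 'a] by auto
  obtain T :: "'b set" where T: "finite T" "\<forall>u\<in>T. \<forall>v\<in>T. inner u v = (if u = v then 1 else 0)"
      "\<forall>x. (\<forall>u\<in>T. inner x u = 0) \<longleftrightarrow> x = 0"
    using ex_orthonormal_basis[where 'a = 'b] by auto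
  have n: "0 \<notin> S" "0 \<notin> T" using S(2) T(2) by (metis inner_zero_left zero_neq_one)+
  let ?R = "(\<lambda>u. (u, 0::'b)) ` S \<union> (\<lambda>v. (0::'a, v)) ` T"
  have "finite ?R" using S T by simp
  moreover have "\<forall>u\<in>?R. \<forall>v\<in>?R. inner u v = (if u = v then 1 else 0)"
    using S(2) T(2) n by (fastforce split: if_splits)
  moreover have "(\<forall>u\<in>?R. inner x u = 0) \<longleftrightarrow> x = 0" for x
  proof (cases x)
    case (Pair a b)
    then show ?thesis
      using S(3)[rule_format, of a] T(3)[rule_format, of b]
      by (simp add: ball_Un zero_prod_def)
  qed
  ultimately show "\<exists>S::('a \<times> 'b) set. finite S \<and>
      (\<forall>u\<in>S. \<forall>v\<in>S. inner u v = (if u = v then 1 else 0)) \<and>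
      (\<forall>x. (\<forall>u\<in>S. inner x u = 0) \<longleftrightarrow> x = 0)"
    by blast
qed

text \<open>Both are meant for open \<open>S\<close>; the domain being finite-dimensional, \<open>Ck_on n\<close> is class $C^n$.\<close>

primrec Ck_on :: "nat \<Rightarrow> ('a::real_normed_vector \<Rightarrow> 'b::real_normed_vector) \<Rightarrow> 'a set \<Rightarrow> bool" where
  "Ck_on 0 f S \<longleftrightarrow> continuous_on S f"
| "Ck_on (Suc n) f S \<longleftrightarrow>
     (\<forall>x\<in>S. f differentiable (at x)) \<and> (\<forall>v. Ck_on n (\<lambda>x. frechet_derivative f (at x) v) S)"

definition smooth_on :: "('a::real_normed_vector \<Rightarrow> 'b::real_normed_vector) \<Rightarrow> 'a set \<Rightarrow> bool" where
  "smooth_on f S \<longleftrightarrow> (\<forall>n. Ck_on n f S)"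


section \<open>Smooth manifolds\<close>

text \<open>
  A chart is a domain together with a coordinate map whose values outside the domain are
  irrelevant. A manifold is given by an atlas, which determines both the set of points and
  the topology.
\<close>

type_synonym ('p, 'e) chart = "'p set \<times> ('p \<Rightarrow> 'e)"
type_synonym ('p, 'e) manifold = "('p, 'e) chart set"

abbreviation dom_of :: "('p, 'e) chart \<Rightarrow> 'p set" where "dom_of \<equiv> fst"
abbreviation coord :: "('p, 'e) chart \<Rightarrow> 'p \<Rightarrow> 'e" where "coord \<equiv> snd"

definition coord_inv :: "('p, 'e) chart \<Rightarrow> 'e \<Rightarrow> 'p" where
  "coord_inv c = inv_into (dom_of c) (coord c)"

definition is_chart :: "('p, 'e::coordinate_space) chart \<Rightarrow> bool" where
  "is_chart c \<longleftrightarrow> inj_on (coord c) (dom_of c) \<and> open (coord c ` dom_of c)"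

definition compatible :: "('p, 'e::coordinate_space) chart \<Rightarrow> ('p, 'e) chart \<Rightarrow> bool" where
  "compatible c d \<longleftrightarrow>
     open (coord c ` (dom_of c \<inter> dom_of d)) \<and> open (coord d ` (dom_of c \<inter> dom_of d)) \<and>
     smooth_on (\<lambda>x. coord d (coord_inv c x)) (coord c ` (dom_of c \<inter> dom_of d)) \<and>
     smooth_on (\<lambda>x. coord c (coord_inv d x)) (coord d ` (dom_of c \<inter> dom_of d))"

definition points :: "('p, 'e) manifold \<Rightarrow> 'p set" where
  "points M = \<Union> (dom_of ` M)"

definition smooth_atlas :: "('p, 'e::coordinate_space) manifold \<Rightarrow> bool" where
  "smooth_atlas M \<longleftrightarrow> (\<forall>c\<in>M. is_chart c) \<and> (\<forall>c\<in>M. \<forall>d\<in>M. compatible c d)"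

text \<open>The maximal atlas.\<close>

definition charts :: "('p, 'e::coordinate_space) manifold \<Rightarrow> ('p, 'e) chart set" where
  "charts M = {c. is_chart c \<and> dom_of c \<subseteq> points M \<and> (\<forall>d\<in>M. compatible c d)}"

definition charts_at :: "('p, 'e::coordinate_space) manifold \<Rightarrow> 'p \<Rightarrow> ('p, 'e) chart set" where
  "charts_at M x = {c \<in> charts M. x \<in> dom_of c}"

definition manifold_topology :: "('p, 'e::coordinate_space) manifold \<Rightarrow> 'p topology" where
  "manifold_topology M =
     topology (\<lambda>W. W \<subseteq> points M \<and> (\<forall>c\<in>M. open (coord c ` (dom_of c \<inter> W))))"

lemma openin_manifold_topology:
  assumes "smooth_atlas M"
  shows "openin (manifold_topology M) W \<longleftrightarrow>
    W \<subseteq> points M \<and> (\<forall>c\<in>M. open (coord c ` (dom_of c \<inter> W)))"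
proof -
  have int: "coord c ` (dom_of c \<inter> (W1 \<inter> W2)) =
      coord c ` (dom_of c \<inter> W1) \<inter> coord c ` (dom_of c \<inter> W2)" if "c \<in> M" for c W1 W2
    using assms that unfolding smooth_atlas_def is_chart_def inj_on_def by blast
  have un: "coord c ` (dom_of c \<inter> \<Union> \<W>) = (\<Union>W\<in>\<W>. coord c ` (dom_of c \<inter> W))"
    for c :: "('a, 'b) chart" and \<W> by blast
  have "istopology (\<lambda>W. W \<subseteq> points M \<and> (\<forall>c\<in>M. open (coord c ` (dom_of c \<inter> W))))"
    unfolding istopology_def by (auto simp: int un intro!: open_Int open_UN)
  then show ?thesis
    unfolding manifold_topology_def by (simp add: topology_inverse')
qed

definition smooth_manifold :: "('p, 'e::coordinate_space) manifold \<Rightarrow> bool" where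
  "smooth_manifold M \<longleftrightarrow> smooth_atlas M \<and>
     Hausdorff_space (manifold_topology M) \<and> second_countable (manifold_topology M)"

text \<open>Smoothness of \<open>f\<close> on an open set \<open>W\<close> of points of \<open>M\<close>.\<close>

definition smooth_map_on ::
  "('p, 'e::coordinate_space) manifold \<Rightarrow> 'p set \<Rightarrow> ('q, 'g::coordinate_space) manifold \<Rightarrow>
   ('p \<Rightarrow> 'q) \<Rightarrow> bool" where
  "smooth_map_on M W N f \<longleftrightarrow>
     (\<forall>x\<in>W. \<exists>c\<in>charts_at M x. \<exists>d\<in>charts N. dom_of c \<subseteq> W \<and> f ` dom_of c \<subseteq> dom_of d \<and>
        smooth_on (\<lambda>z. coord d (f (coord_inv c z))) (coord c ` dom_of c))"


section \<open>Tangent vectors\<close>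

text \<open>
  A tangent vector at \<open>x\<close> is a pair \<open>(x, \<xi>)\<close> where \<open>\<xi>\<close> assigns to every chart around \<open>x\<close> the
  components of the vector in that chart, subject to the usual transformation law.
  Outside the charts around \<open>x\<close>, \<open>\<xi>\<close> is normalised to 0.
\<close>

type_synonym ('p, 'e) tvec = "'p \<times> (('p, 'e) chart \<Rightarrow> 'e)"

abbreviation comp :: "('p, 'e) tvec \<Rightarrow> ('p, 'e) chart \<Rightarrow> 'e" where "comp \<equiv> snd"

definition tangent_space :: "('p, 'e::coordinate_space) manifold \<Rightarrow> 'p \<Rightarrow> ('p, 'e) tvec set" where
  "tangent_space M x =
     {(x, \<xi>) | \<xi>.
        (\<forall>c\<in>charts_at M x. \<forall>d\<in>charts_at M x.
           \<xi> d = frechet_derivative (\<lambda>z. coord d (coord_inv c z)) (at (coord c x)) (\<xi> c)) \<and>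
        (\<forall>c. c \<notin> charts_at M x \<longrightarrow> \<xi> c = 0)}"

definition tangent_add :: "('p, 'e::coordinate_space) tvec \<Rightarrow> ('p, 'e) tvec \<Rightarrow> ('p, 'e) tvec" where
  "tangent_add u v = (fst u, \<lambda>c. comp u c + comp v c)"

definition tangent_scale :: "real \<Rightarrow> ('p, 'e::coordinate_space) tvec \<Rightarrow> ('p, 'e) tvec" where
  "tangent_scale a u = (fst u, \<lambda>c. a *\<^sub>R comp u c)"

text \<open>The tangent vector at \<open>x\<close> whose components in the chart \<open>c\<close> are \<open>w\<close>.\<close>

definition tangent_of_comp ::
  "('p, 'e::coordinate_space) manifold \<Rightarrow> 'p \<Rightarrow> ('p, 'e) chart \<Rightarrow> 'e \<Rightarrow> ('p, 'e) tvec" where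
  "tangent_of_comp M x c w =
     (x, \<lambda>d. if d \<in> charts_at M x
             then frechet_derivative (\<lambda>z. coord d (coord_inv c z)) (at (coord c x)) w else 0)"

text \<open>
  The tangent map \<open>Tf\<close>. It depends only on the germ of \<open>f\<close> at the base point, so it applies
  to locally defined maps as well; by the chain rule the choice of \<open>c\<close> does not matter.
\<close>

definition tangent_map ::
  "('p, 'e::coordinate_space) manifold \<Rightarrow> ('q, 'g::coordinate_space) manifold \<Rightarrow> ('p \<Rightarrow> 'q) \<Rightarrow>
   ('p, 'e) tvec \<Rightarrow> ('q, 'g) tvec" where
  "tangent_map M N f v =
     (let x = fst v; c = (SOME c. c \<in> charts_at M x) in
      (f x, \<lambda>d. if d \<in> charts_at N (f x)
                then frechet_derivative (\<lambda>z. coord d (f (coord_inv c z))) (at (coord c x)) (comp v c)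
                else 0))"

definition tangent_bundle ::
  "('p, 'e::coordinate_space) manifold \<Rightarrow> (('p, 'e) tvec, 'e \<times> 'e) manifold" where
  "tangent_bundle M =
     {({v. fst v \<in> dom_of c \<and> v \<in> tangent_space M (fst v)}, \<lambda>v. (coord c (fst v), comp v c)) | c.
        c \<in> charts M}"


section \<open>Fibred manifolds\<close>

text \<open>
  The total space is modelled on a product whose first factor is the model of the base; this
  is only a statement about dimensions. Nothing is assumed about charts being adapted to \<open>p\<close>.
\<close>

definition smooth_fibred_manifold ::
  "('f, 'x::coordinate_space \<times> 'y::coordinate_space) manifold \<Rightarrow> ('f \<Rightarrow> 'b) \<Rightarrow>
   ('b, 'x) manifold \<Rightarrow> bool" where
  "smooth_fibred_manifold E p M \<longleftrightarrow>
     smooth_manifold E \<and> smooth_manifold M \<and>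
     smooth_map_on E (points E) M p \<and> p ` points E = points M \<and>
     (\<forall>e\<in>points E. tangent_map E M p ` tangent_space E e = tangent_space M (p e))"

text \<open>
  A fibred chart $(x^\lambda, y^i)$: the base part of the coordinates is the pullback of the
  base chart \<open>c\<close>.
\<close>

definition fibred_charts ::
  "('f, 'x::coordinate_space \<times> 'y::coordinate_space) manifold \<Rightarrow> ('f \<Rightarrow> 'b) \<Rightarrow>
   ('b, 'x) manifold \<Rightarrow> (('b, 'x) chart \<times> ('f, 'x \<times> 'y) chart) set" where
  "fibred_charts E p M =
     {(c, d). c \<in> charts M \<and> d \<in> charts E \<and>
        (\<forall>e\<in>dom_of d. p e \<in> dom_of c \<and> fst (coord d e) = coord c (p e))}"

definition vertical_space ::
  "('f, 'x::coordinate_space \<times> 'y::coordinate_space) manifold \<Rightarrow> ('f \<Rightarrow> 'b) \<Rightarrow>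
   ('b, 'x) manifold \<Rightarrow> 'f \<Rightarrow> ('f, 'x \<times> 'y) tvec set" where
  "vertical_space E p M e = {w \<in> tangent_space E e. tangent_map E M p w = (p e, \<lambda>_. 0)}"

text \<open>
  The pullback $N \times_M E$ of a fibred manifold \<open>p: E \<rightarrow> M\<close> along a smooth map \<open>g: N \<rightarrow> M\<close>,
  with the charts $(u, y^i)$ given by charts \<open>u\<close> of \<open>N\<close> and fibred charts $(x^\lambda, y^i)$ of \<open>E\<close>.
  As a set of points it is \<open>{(n, e). g n = p e}\<close>; it is fibred over \<open>N\<close> by \<^const>\<open>fst\<close>.
\<close>

definition fibre_product ::
  "('n, 'u::coordinate_space) manifold \<Rightarrow> ('n \<Rightarrow> 'b) \<Rightarrow> ('b, 'x::coordinate_space) manifold \<Rightarrow>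
   ('f, 'x \<times> 'y::coordinate_space) manifold \<Rightarrow> ('f \<Rightarrow> 'b) \<Rightarrow> ('n \<times> 'f, 'u \<times> 'y) manifold" where
  "fibre_product N g M E p =
     {({(n, e). n \<in> dom_of a \<and> e \<in> dom_of d \<and> g n = p e}, \<lambda>(n, e). (coord a n, snd (coord d e)))
        | a c d. a \<in> charts N \<and> (c, d) \<in> fibred_charts E p M}"


section \<open>Curvature of a connection\<close>

text \<open>
  A connection of \<open>p: E \<rightarrow> M\<close> is a map \<open>C e v\<close>, defined for \<open>e\<close> in (an open subset of) \<open>E\<close> and
  \<open>v\<close> tangent to \<open>M\<close> at \<open>p e\<close>. In a fibred chart, \<open>conn_coeff\<close> at the coordinates \<open>z = (x, y)\<close>
  is the linear map $w \mapsto (c_\lambda{}^i(z) w^\lambda)_i$.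
\<close>

definition conn_coeff ::
  "('f, 'x::coordinate_space \<times> 'y::coordinate_space) manifold \<Rightarrow> ('f \<Rightarrow> 'b) \<Rightarrow> ('b, 'x) manifold \<Rightarrow>
   ('f \<Rightarrow> ('b, 'x) tvec \<Rightarrow> ('f, 'x \<times> 'y) tvec) \<Rightarrow>
   ('b, 'x) chart \<Rightarrow> ('f, 'x \<times> 'y) chart \<Rightarrow> 'x \<times> 'y \<Rightarrow> 'x \<Rightarrow> 'y" where
  "conn_coeff E p M C c d z w =
     (let e = coord_inv d z in snd (comp (C e (tangent_of_comp M (p e) c w)) d))"

text \<open>
  $u^\alpha v^\beta (\partial_\alpha c_\beta{}^i + c_\alpha{}^j \partial_j c_\beta{}^i)$ at \<open>z\<close>: since
  $u^\alpha(\partial_\alpha + c_\alpha{}^j \partial_j)$ is the directional derivative along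
  \<open>(u, c u)\<close>, this is the derivative of $z \mapsto c_\beta{}^i(z) v^\beta$ in that direction.
\<close>

definition curv_term ::
  "('f, 'x::coordinate_space \<times> 'y::coordinate_space) manifold \<Rightarrow> ('f \<Rightarrow> 'b) \<Rightarrow> ('b, 'x) manifold \<Rightarrow>
   ('f \<Rightarrow> ('b, 'x) tvec \<Rightarrow> ('f, 'x \<times> 'y) tvec) \<Rightarrow>
   ('b, 'x) chart \<Rightarrow> ('f, 'x \<times> 'y) chart \<Rightarrow> 'x \<times> 'y \<Rightarrow> 'x \<Rightarrow> 'x \<Rightarrow> 'y" where
  "curv_term E p M C c d z u v =
     frechet_derivative (\<lambda>z'. conn_coeff E p M C c d z' v) (at z) (u, conn_coeff E p M C c d z u)"

text \<open>
  The curvature is the vertical valued 2-form with the coordinate expression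
  $-2 (\partial_\alpha c_\beta{}^i + c_\alpha{}^j \partial_j c_\beta{}^i)
    d^\alpha \wedge d^\beta \otimes \partial_i$
  in every fibred chart. A 2-form is regarded as an alternating function of two vectors, with
  $(d^\alpha \wedge d^\beta)(u, v) = u^\alpha v^\beta - u^\beta v^\alpha$.
\<close>

definition curvature ::
  "('f, 'x::coordinate_space \<times> 'y::coordinate_space) manifold \<Rightarrow> ('f \<Rightarrow> 'b) \<Rightarrow> ('b, 'x) manifold \<Rightarrow>
   ('f \<Rightarrow> ('b, 'x) tvec \<Rightarrow> ('f, 'x \<times> 'y) tvec) \<Rightarrow>
   'f \<Rightarrow> ('b, 'x) tvec \<Rightarrow> ('b, 'x) tvec \<Rightarrow> ('f, 'x \<times> 'y) tvec" where
  "curvature E p M C e u v =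
     (THE w. w \<in> vertical_space E p M e \<and>
        (\<forall>(c, d) \<in> fibred_charts E p M. e \<in> dom_of d \<longrightarrow>
           snd (comp w d) =
             (- 2) *\<^sub>R (curv_term E p M C c d (coord d e) (comp u c) (comp v c)
                      - curv_term E p M C c d (coord d e) (comp v c) (comp u c))))"


section \<open>Systems of connections\<close>

text \<open>\<open>F_up\<close> is $F^\uparrow = C \times_B F$, fibred over \<open>C\<close> by \<^const>\<open>fst\<close>.\<close>

definition F_up ::
  "('c, 'x \<times> 'z) manifold \<Rightarrow> ('c \<Rightarrow> 'b) \<Rightarrow> ('f, 'x \<times> 'y) manifold \<Rightarrow> ('f \<Rightarrow> 'b) \<Rightarrow> ('b, 'x) manifold \<Rightarrow>
   ('c \<times> 'f, ('x::coordinate_space \<times> 'z::coordinate_space) \<times> 'y::coordinate_space) manifold" where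
  "F_up C \<zeta> F p B = fibre_product C \<zeta> B F p"

text \<open>
  The domain $C \times_B (F \times_B TB)$ of the evaluation map is realised as
  $F^\uparrow \times_B TB$, with points \<open>((k, f), v)\<close>.
\<close>

definition smooth_connection_system ::
  "('c, 'x::coordinate_space \<times> 'z::coordinate_space) manifold \<Rightarrow> ('c \<Rightarrow> 'b) \<Rightarrow>
   ('f, 'x \<times> 'y::coordinate_space) manifold \<Rightarrow> ('f \<Rightarrow> 'b) \<Rightarrow> ('b, 'x) manifold \<Rightarrow>
   ('c \<Rightarrow> 'f \<Rightarrow> ('b, 'x) tvec \<Rightarrow> ('f, 'x \<times> 'y) tvec) \<Rightarrow> bool" where
  "smooth_connection_system C \<zeta> F p B \<epsilon> \<longleftrightarrow>
     smooth_fibred_manifold F p B \<and>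
     smooth_fibred_manifold C \<zeta> B \<and>
     smooth_map_on
       (fibre_product (F_up C \<zeta> F p B) (\<lambda>(k, f). \<zeta> k) B (tangent_bundle B) fst)
       {((k, f), v). k \<in> points C \<and> f \<in> points F \<and> \<zeta> k = p f \<and> v \<in> tangent_space B (p f)}
       (tangent_bundle F) (\<lambda>((k, f), v). \<epsilon> k f v) \<and>
     (\<forall>k\<in>points C. \<forall>f\<in>points F. \<zeta> k = p f \<longrightarrow>
        (\<forall>v\<in>tangent_space B (p f).
           \<epsilon> k f v \<in> tangent_space F f \<and> tangent_map F B p (\<epsilon> k f v) = v) \<and>
        (\<forall>u\<in>tangent_space B (p f). \<forall>v\<in>tangent_space B (p f).
           \<epsilon> k f (tangent_add u v) = tangent_add (\<epsilon> k f u) (\<epsilon> k f v)) \<and>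
        (\<forall>a. \<forall>v\<in>tangent_space B (p f).
           \<epsilon> k f (tangent_scale a v) = tangent_scale a (\<epsilon> k f v)))"

definition smooth_local_section ::
  "('c, 'x::coordinate_space \<times> 'z::coordinate_space) manifold \<Rightarrow> ('c \<Rightarrow> 'b) \<Rightarrow>
   ('b, 'x) manifold \<Rightarrow> 'b set \<Rightarrow> ('b \<Rightarrow> 'c) \<Rightarrow> bool" where
  "smooth_local_section C \<zeta> B U \<gamma> \<longleftrightarrow>
     openin (manifold_topology B) U \<and>
     smooth_map_on B U C \<gamma> \<and>
     (\<forall>b\<in>U. \<gamma> b \<in> points C \<and> \<zeta> (\<gamma> b) = b)"

text \<open>The connection $\breve\gamma$ of the system, defined over the domain of \<open>\<gamma>\<close>.\<close>

definition system_connection ::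
  "('f \<Rightarrow> 'b) \<Rightarrow> ('c \<Rightarrow> 'f \<Rightarrow> ('b, 'x) tvec \<Rightarrow> ('f, 'e) tvec) \<Rightarrow> ('b \<Rightarrow> 'c) \<Rightarrow>
   'f \<Rightarrow> ('b, 'x) tvec \<Rightarrow> ('f, 'e) tvec" where
  "system_connection p \<epsilon> \<gamma> f v = \<epsilon> (\<gamma> (p f)) f v"

text \<open>
  The connection $\epsilon^\uparrow$ of $F^\uparrow \to C$. The pair $(X, \epsilon(f^\uparrow)(T\zeta(X)))$
  in $TC \times_{TB} TF$ is read as the corresponding element of $TF^\uparrow$, that is, the
  tangent vector of $F^\uparrow$ whose projections to \<open>TC\<close> and \<open>TF\<close> are its two components.
\<close>

definition eps_up ::
  "('c, 'x::coordinate_space \<times> 'z::coordinate_space) manifold \<Rightarrow> ('c \<Rightarrow> 'b) \<Rightarrow>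
   ('f, 'x \<times> 'y::coordinate_space) manifold \<Rightarrow> ('f \<Rightarrow> 'b) \<Rightarrow> ('b, 'x) manifold \<Rightarrow>
   ('c \<Rightarrow> 'f \<Rightarrow> ('b, 'x) tvec \<Rightarrow> ('f, 'x \<times> 'y) tvec) \<Rightarrow>
   'c \<times> 'f \<Rightarrow> ('c, 'x \<times> 'z) tvec \<Rightarrow> ('c \<times> 'f, ('x \<times> 'z) \<times> 'y) tvec" where
  "eps_up C \<zeta> F p B \<epsilon> = (\<lambda>(k, f) X.
     THE W. W \<in> tangent_space (F_up C \<zeta> F p B) (k, f) \<and>
       tangent_map (F_up C \<zeta> F p B) C fst W = X \<and>
       tangent_map (F_up C \<zeta> F p B) F snd W = \<epsilon> k f (tangent_map C B \<zeta> X))"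

text \<open>
  For a reducible connection \<open>K\<close> of $F^\uparrow \to C$: the map $F^\uparrow \times_B TB \to TF$
  through which the composition $F^\uparrow \times_C TC \to TF^\uparrow \to TF$ factorises along
  $\mathrm{id} \times T\zeta$. It is unique because $T\zeta$ is surjective; for
  $K = \epsilon^\uparrow$ it is \<open>\<epsilon>\<close>.
\<close>

definition reducing_factor ::
  "('c, 'x::coordinate_space \<times> 'z::coordinate_space) manifold \<Rightarrow> ('c \<Rightarrow> 'b) \<Rightarrow>
   ('f, 'x \<times> 'y::coordinate_space) manifold \<Rightarrow> ('f \<Rightarrow> 'b) \<Rightarrow> ('b, 'x) manifold \<Rightarrow>
   ('c \<times> 'f \<Rightarrow> ('c, 'x \<times> 'z) tvec \<Rightarrow> ('c \<times> 'f, ('x \<times> 'z) \<times> 'y) tvec) \<Rightarrow>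
   'c \<times> 'f \<Rightarrow> ('b, 'x) tvec \<Rightarrow> ('f, 'x \<times> 'y) tvec" where
  "reducing_factor C \<zeta> F p B K = (\<lambda>(k, f) v.
     THE w. \<forall>X \<in> tangent_space C k.
       tangent_map C B \<zeta> X = v \<longrightarrow> tangent_map (F_up C \<zeta> F p B) F snd (K (k, f) X) = w)"

definition gamma_F :: "('f \<Rightarrow> 'b) \<Rightarrow> ('b \<Rightarrow> 'c) \<Rightarrow> 'f \<Rightarrow> 'c \<times> 'f" where
  "gamma_F p \<gamma> f = (\<gamma> (p f), f)"

definition pullback_connection ::
  "('c, 'x::coordinate_space \<times> 'z::coordinate_space) manifold \<Rightarrow> ('c \<Rightarrow> 'b) \<Rightarrow>
   ('f, 'x \<times> 'y::coordinate_space) manifold \<Rightarrow> ('f \<Rightarrow> 'b) \<Rightarrow> ('b, 'x) manifold \<Rightarrow>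
   ('b \<Rightarrow> 'c) \<Rightarrow>
   ('c \<times> 'f \<Rightarrow> ('c, 'x \<times> 'z) tvec \<Rightarrow> ('c \<times> 'f, ('x \<times> 'z) \<times> 'y) tvec) \<Rightarrow>
   'f \<Rightarrow> ('b, 'x) tvec \<Rightarrow> ('f, 'x \<times> 'y) tvec" where
  "pullback_connection C \<zeta> F p B \<gamma> K f v = reducing_factor C \<zeta> F p B K (gamma_F p \<gamma> f) v"

text \<open>
  $\Lambda^2 T\gamma$ acts on a 2-form, regarded as a function of two vectors, by \<open>T\<gamma>\<close> in each
  argument; the projection $V_C F^\uparrow = C \times_B VF \to VF$ is the restriction of the
  tangent map of $F^\uparrow \to F$.
\<close>

definition pullback_curvature ::
  "('c, 'x::coordinate_space \<times> 'z::coordinate_space) manifold \<Rightarrow> ('c \<Rightarrow> 'b) \<Rightarrow>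
   ('f, 'x \<times> 'y::coordinate_space) manifold \<Rightarrow> ('f \<Rightarrow> 'b) \<Rightarrow> ('b, 'x) manifold \<Rightarrow>
   ('b \<Rightarrow> 'c) \<Rightarrow>
   ('c \<times> 'f \<Rightarrow> ('c, 'x \<times> 'z) tvec \<Rightarrow> ('c, 'x \<times> 'z) tvec \<Rightarrow>
     ('c \<times> 'f, ('x \<times> 'z) \<times> 'y) tvec) \<Rightarrow>
   'f \<Rightarrow> ('b, 'x) tvec \<Rightarrow> ('b, 'x) tvec \<Rightarrow>
   ('f, 'x \<times> 'y) tvec" where
  "pullback_curvature C \<zeta> F p B \<gamma> R f u v =
     tangent_map (F_up C \<zeta> F p B) F snd
       (R (gamma_F p \<gamma> f) (tangent_map B C \<gamma> u) (tangent_map B C \<gamma> v))"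

end

theory Submission
  imports Defs
begin

text \<open>
  The first claim holds because \<open>T\<zeta>\<close> is surjective: the map through which the projection of
  \<open>\<epsilon>\<^sup>\<up>\<close> to \<open>TF\<close> factorises is unique, and \<open>\<epsilon>\<close> is such a map (\<open>reducing_factor_eps_up\<close>).

  The second claim is a computation in suitable charts. Take a chart \<open>x\<close> of \<open>B\<close> and fibred charts
  \<open>(x, y)\<close> of \<open>F\<close> and \<open>(x, z)\<close> of \<open>C\<close> over it. Then \<open>((x, z), y)\<close> is a fibred chart of \<open>F\<^sup>\<up>\<close> over
  \<open>C\<close>. The coefficients of \<open>\<epsilon>\<^sup>\<up>\<close> in it are those of \<open>\<epsilon>\<close>, and they depend only on the \<open>x\<close>-components
  of a vector of \<open>C\<close> (\<open>conn_coeff_eps_up\<close>). The coefficients of the connection given by \<open>\<gamma>\<close> are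
  obtained from those of \<open>\<epsilon>\<close> by substituting \<open>\<gamma>\<close> for \<open>(x, z)\<close>. The curvature terms are derivatives of
  the coefficients along horizontal vectors, and \<open>\<gamma>\<^sub>F\<close> maps the horizontal vectors of the one
  connection to those of the other; so the chain rule gives the claim (\<open>curvature_pullback\<close>).

  For this to be a computation of the curvatures, the components in a single fibred chart must
  determine the curvature, which is specified by its components in all of them
  (\<open>curvature_in_chart\<close>). Under a change of fibred chart the curvature terms acquire second
  derivatives of the transition maps; these cancel by symmetry after antisymmetrisation
  (\<open>curvature_transformation\<close>), so that the components belong to one tangent vector. Moreover
  there must be fibred charts of the kind used above. They are provided by the submersion theorem
  \<open>ex_fibred_chart\<close>, a consequence of the smooth inverse function theorem \<open>local_inverse\<close>.

  The remaining lemmas express smoothness and tangent maps in charts. In particular, the charts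
  of \<open>TB\<close> and of fibre products are compatible, which allows the smoothness of \<open>\<epsilon>\<close> as a map
  between manifolds to be turned into smoothness of its coefficients (\<open>smooth_eps_coeff\<close>).
\<close>

section \<open>Calculus in coordinate spaces\<close>

subsection \<open>Orthonormal bases\<close>

definition onb :: "'a::coordinate_space set" where
  "onb = (SOME S. finite S \<and> (\<forall>u\<in>S. \<forall>v\<in>S. inner u v = (if u = v then 1 else 0)) \<and>
         (\<forall>x. (\<forall>u\<in>S. inner x u = 0) \<longleftrightarrow> x = 0))"

lemma
  shows finite_onb: "finite (onb::'a::coordinate_space set)"
    and inner_onb: "\<And>u v::'a. u \<in> onb \<Longrightarrow> v \<in> onb \<Longrightarrow> inner u v = (if u = v then 1 else 0)"
    and onb_eq_0_iff: "\<And>x::'a. (\<forall>u\<in>onb. inner x u = 0) \<longleftrightarrow> x = 0"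
  using someI_ex[OF ex_orthonormal_basis[where 'a = 'a], folded onb_def] by blast+

lemma onb_expansion: "(\<Sum>u\<in>onb. inner x u *\<^sub>R u) = (x::'a::coordinate_space)"
proof -
  have "inner (x - (\<Sum>u\<in>onb. inner x u *\<^sub>R u)) v = 0" if "v \<in> onb" for v
  proof -
    have "inner (\<Sum>u\<in>onb. inner x u *\<^sub>R u) v = (\<Sum>u\<in>onb. if u = v then inner x v else 0)"
      unfolding inner_sum_left by (rule sum.cong) (auto simp: inner_onb that)
    then show ?thesis using that by (simp add: inner_diff_left finite_onb)
  qed
  then have "x - (\<Sum>u\<in>onb. inner x u *\<^sub>R u) = 0" using onb_eq_0_iff by metis
  then show ?thesis by simp
qed

lemma linear_onb_expansion:
  fixes f :: "'a::coordinate_space \<Rightarrow> 'b::real_vector"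
  assumes "linear f"
  shows "f x = (\<Sum>u\<in>onb. inner x u *\<^sub>R f u)"
proof -
  have "f x = f (\<Sum>u\<in>onb. inner x u *\<^sub>R u)" by (simp add: onb_expansion)
  also have "\<dots> = (\<Sum>u\<in>onb. inner x u *\<^sub>R f u)"
    by (simp add: linear_sum[OF assms] linear_scale[OF assms])
  finally show ?thesis .
qed

lemma norm_onb: "u \<in> onb \<Longrightarrow> norm u = 1"
  unfolding norm_eq_1 by (simp add: inner_onb)

lemma linear_norm_bound:
  fixes f :: "'a::coordinate_space \<Rightarrow> 'b::real_normed_vector"
  assumes "linear f"
  shows "norm (f x) \<le> (\<Sum>u\<in>onb. norm (f u)) * norm x"
proof -
  have "norm (f x) \<le> (\<Sum>u\<in>onb. norm (inner x u *\<^sub>R f u))"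
    by (subst linear_onb_expansion[OF assms, of x]) (rule norm_sum)
  also have "\<dots> \<le> (\<Sum>u\<in>onb. norm (f u) * norm x)"
  proof (rule sum_mono)
    fix u :: 'a assume "u \<in> onb"
    then have "\<bar>inner x u\<bar> \<le> norm x" using Cauchy_Schwarz_ineq2[of x u] by (simp add: norm_onb)
    then show "norm (inner x u *\<^sub>R f u) \<le> norm (f u) * norm x"
      by (simp add: mult.commute[of "norm (f u)"] mult_right_mono)
  qed
  finally show ?thesis by (simp add: sum_distrib_right)
qed

lemma linear_imp_bounded_linear:
  fixes f :: "'a::coordinate_space \<Rightarrow> 'b::real_normed_vector"
  assumes "linear f"
  shows "bounded_linear f"
  by (rule bounded_linear_intro[where K = "\<Sum>u\<in>onb. norm (f u)"])
    (use linear_norm_bound[OF assms] in \<open>simp_all add: linear_add linear_scale assms mult.commute\<close>)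

lemma independent_orthonormal:
  fixes S :: "'a::real_inner set"
  assumes "finite S" and S: "\<And>u v. u \<in> S \<Longrightarrow> v \<in> S \<Longrightarrow> inner u v = (if u = v then 1 else 0)"
  shows "independent S"
proof
  assume "dependent S"
  then obtain c v where v: "v \<in> S" "c v \<noteq> 0" and 0: "(\<Sum>w\<in>S. c w *\<^sub>R w) = 0"
    unfolding real_vector.dependent_finite[OF assms(1)] by blast
  have "0 = inner (\<Sum>w\<in>S. c w *\<^sub>R w) v" by (simp add: 0)
  also have "\<dots> = (\<Sum>w\<in>S. if w = v then c v else 0)"
    unfolding inner_sum_left by (rule sum.cong) (auto simp: S v)
  finally show False using v assms(1) by simp
qed

lemma independent_onb: "independent (onb :: 'a::coordinate_space set)"
  by (rule independent_orthonormal) (simp_all add: finite_onb inner_onb)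

lemma span_onb: "span onb = (UNIV :: 'a::coordinate_space set)"
proof -
  have "x \<in> span onb" for x :: 'a
    by (subst onb_expansion[symmetric]) (intro span_sum span_scale span_base)
  then show ?thesis by auto
qed

lemma span_independent_eq_UNIV:
  fixes S :: "'a::coordinate_space set"
  assumes "independent S" "card S = card (onb :: 'a set)"
  shows "span S = UNIV"
proof (rule ccontr)
  assume "span S \<noteq> UNIV"
  then obtain v where v: "v \<notin> span S" by auto
  then have "independent (insert v S)" by (simp add: assms independent_insertI)
  then have "finite (insert v S) \<and> card (insert v S) \<le> card (onb :: 'a set)"
    by (intro independent_span_bound finite_onb) (simp_all add: span_onb)
  moreover have "v \<notin> S" using v span_base by blast
  ultimately show False using assms by auto
qed

lemma linear_injective_imp_surjective:
  fixes L :: "'a::coordinate_space \<Rightarrow> 'a"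
  assumes "linear L" "inj L"
  shows "surj L"
proof -
  have "independent (L ` onb)"
    by (rule linear_independent_injective_image[OF assms(1) independent_onb]) (use assms in \<open>auto intro: inj_on_subset\<close>)
  moreover have "card (L ` onb) = card (onb :: 'a set)"
    by (rule card_image) (use assms in \<open>auto intro: inj_on_subset\<close>)
  ultimately have "span (L ` onb) = UNIV" by (rule span_independent_eq_UNIV)
  then show ?thesis by (simp add: linear_span_image[OF assms(1)] span_onb)
qed

lemma complete_UNIV_coordinate_space: "complete (UNIV :: 'a::coordinate_space set)"
proof (rule completeI)
  fix X :: "nat \<Rightarrow> 'a" assume X: "Cauchy X"
  have "convergent (\<lambda>n. inner (X n) u)" for u
    by (intro Cauchy_convergent bounded_linear.Cauchy[OF bounded_linear_inner_left X])
  then have "(\<lambda>n. \<Sum>u\<in>onb. inner (X n) u *\<^sub>R u) \<longlonglongrightarrow> (\<Sum>u\<in>onb. lim (\<lambda>n. inner (X n) u) *\<^sub>R u)"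
    by (intro tendsto_sum tendsto_scaleR tendsto_const) (simp add: convergent_LIMSEQ_iff)
  then show "\<exists>l\<in>UNIV. X \<longlonglongrightarrow> l" by (auto simp: onb_expansion)
qed

subsection \<open>Functions of class $C^n$\<close>

lemma Ck_on_cong:
  assumes "open S" "\<And>x. x \<in> S \<Longrightarrow> f x = g x"
  shows "Ck_on n f S \<longleftrightarrow> Ck_on n g S"
  using assms(2)
proof (induction n arbitrary: f g)
  case 0
  then show ?case by (simp cong: continuous_on_cong)
next
  case (Suc n)
  have d: "(f has_derivative f') (at x) \<longleftrightarrow> (g has_derivative f') (at x)" if "x \<in> S" for x f'
    using has_derivative_transform_within_open[OF _ assms(1) that, of f f' UNIV g]
      has_derivative_transform_within_open[OF _ assms(1) that, of g f' UNIV f] Suc.prems by auto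
  have "frechet_derivative f (at x) = frechet_derivative g (at x)" if "x \<in> S" for x
    unfolding frechet_derivative_def using d[OF that] by simp
  then have "Ck_on n (\<lambda>x. frechet_derivative f (at x) v) S \<longleftrightarrow>
      Ck_on n (\<lambda>x. frechet_derivative g (at x) v) S" for v
    by (intro Suc.IH) simp
  then show ?case using d by (simp add: differentiable_def)
qed

lemma Ck_on_subset: "Ck_on n f T \<Longrightarrow> S \<subseteq> T \<Longrightarrow> Ck_on n f S"
  by (induction n arbitrary: f) (auto intro: continuous_on_subset)

lemma Ck_on_SucI:
  assumes "open S" "\<And>x. x \<in> S \<Longrightarrow> (f has_derivative f' x) (at x)"
    and "\<And>v. Ck_on n (\<lambda>x. f' x v) S"
  shows "Ck_on (Suc n) f S"
proof -
  have "frechet_derivative f (at x) = f' x" if "x \<in> S" for x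
    using frechet_derivative_at[OF assms(2)[OF that]] by simp
  then have "Ck_on n (\<lambda>x. frechet_derivative f (at x) v) S" for v
    using Ck_on_cong[OF assms(1), of "\<lambda>x. frechet_derivative f (at x) v" "\<lambda>x. f' x v" n] assms(3)
    by simp
  then show ?thesis using assms(2) by (auto simp: differentiable_def)
qed

lemma Ck_on_SucD:
  assumes "Ck_on (Suc n) f S"
  shows "x \<in> S \<Longrightarrow> (f has_derivative frechet_derivative f (at x)) (at x)"
    and "Ck_on n (\<lambda>x. frechet_derivative f (at x) v) S"
  using assms frechet_derivative_works by auto

lemma Ck_on_lower: "Ck_on (Suc n) f S \<Longrightarrow> Ck_on n f S"
proof (induction n arbitrary: f)
  case 0
  then show ?case
    by (auto intro!: differentiable_imp_continuous_within continuous_at_imp_continuous_on)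
next
  case (Suc n)
  then show ?case by (metis Ck_on.simps(2))
qed

lemma Ck_on_local:
  assumes "\<And>x. x \<in> S \<Longrightarrow> \<exists>T. open T \<and> x \<in> T \<and> Ck_on n f T"
  shows "Ck_on n f S"
  using assms
proof (induction n arbitrary: f)
  case 0
  then have "continuous (at x) f" if "x \<in> S" for x
    using that by (metis Ck_on.simps(1) continuous_on_eq_continuous_at)
  then show ?case by (simp add: continuous_at_imp_continuous_on)
next
  case (Suc n)
  then show ?case by (subst Ck_on.simps) (metis Ck_on.simps(2))
qed

lemma Ck_on_const: "open S \<Longrightarrow> Ck_on n (\<lambda>_. a) S"
proof (induction n arbitrary: a)
  case (Suc n)
  show ?case by (rule Ck_on_SucI[where f' = "\<lambda>_ _. 0"]) (auto intro: Suc)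
qed simp

lemma Ck_on_linear:
  assumes "open S" "bounded_linear L"
  shows "Ck_on n L S"
proof (cases n)
  case 0
  then show ?thesis by (simp add: assms(2) linear_continuous_on)
next
  case (Suc m)
  then show ?thesis
    by (auto intro!: Ck_on_SucI[where f' = "\<lambda>_. L"] Ck_on_const assms
      bounded_linear_imp_has_derivative simp del: Ck_on.simps)
qed

lemma Ck_on_add:
  assumes "open S" "Ck_on n f S" "Ck_on n g S"
  shows "Ck_on n (\<lambda>x. f x + g x) S"
  using assms(2,3)
proof (induction n arbitrary: f g)
  case 0
  then show ?case by (auto intro: continuous_intros)
next
  case (Suc n)
  show ?case
    by (rule Ck_on_SucI[where f' = "\<lambda>x v. frechet_derivative f (at x) v + frechet_derivative g (at x) v"])
      (intro assms has_derivative_add Suc.IH Ck_on_SucD[OF Suc.prems(1)] Ck_on_SucD[OF Suc.prems(2)]; assumption)+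
qed

lemma Ck_on_sum:
  assumes "open S" "\<And>i. i \<in> I \<Longrightarrow> Ck_on n (f i) S"
  shows "Ck_on n (\<lambda>x. \<Sum>i\<in>I. f i x) S"
  using assms(2)
  by (induction I rule: infinite_finite_induct) (simp_all add: Ck_on_const Ck_on_add assms(1))

lemma Ck_on_bilinear:
  assumes "open S" "bounded_bilinear h" "Ck_on n f S" "Ck_on n g S"
  shows "Ck_on n (\<lambda>x. h (f x) (g x)) S"
  using assms(3,4)
proof (induction n arbitrary: f g)
  case 0
  then show ?case using bounded_bilinear.continuous_on[OF assms(2)] by auto
next
  case (Suc n)
  show ?case
  proof (rule Ck_on_SucI[where f' = "\<lambda>x v. h (f x) (frechet_derivative g (at x) v) + h (frechet_derivative f (at x) v) (g x)"])
    fix v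
    show "Ck_on n (\<lambda>x. h (f x) (frechet_derivative g (at x) v) + h (frechet_derivative f (at x) v) (g x)) S"
      by (intro Ck_on_add assms Suc.IH Ck_on_SucD[OF Suc.prems(1)] Ck_on_SucD[OF Suc.prems(2)]
        Ck_on_lower[OF Suc.prems(1)] Ck_on_lower[OF Suc.prems(2)])
  qed (intro assms bounded_bilinear.FDERIV Ck_on_SucD[OF Suc.prems(1)] Ck_on_SucD[OF Suc.prems(2)]; assumption)+
qed

lemma Ck_on_bounded_linear_image:
  assumes "open S" "bounded_linear L" "Ck_on n f S"
  shows "Ck_on n (\<lambda>x. L (f x)) S"
  using assms(3)
proof (induction n arbitrary: f)
  case 0
  then show ?case using bounded_linear.continuous_on[OF assms(2)] by auto
next
  case (Suc n)
  show ?case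
    by (rule Ck_on_SucI[where f' = "\<lambda>x v. L (frechet_derivative f (at x) v)"])
      (intro assms bounded_linear.has_derivative[OF assms(2)] Suc.IH Ck_on_SucD[OF Suc.prems(1)]; assumption)+
qed

text \<open>
  Let \<open>A x\<close> be linear. That \<open>A x b\<close> is of class $C^n$ in \<open>x\<close> for each fixed \<open>b\<close> suffices for
  \<open>A x (w x)\<close> to be so, because \<open>w x\<close> can be expanded in a finite basis. This is what makes the
  definition of \<^const>\<open>Ck_on\<close> by directional derivatives work in the chain rule.
\<close>

lemma Ck_on_linear_family:
  fixes A :: "'a::real_normed_vector \<Rightarrow> 'b::coordinate_space \<Rightarrow> 'c::real_normed_vector"
  assumes "open S" "\<And>x. x \<in> S \<Longrightarrow> linear (A x)" "\<And>b. Ck_on n (\<lambda>x. A x b) S" "Ck_on n w S"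
  shows "Ck_on n (\<lambda>x. A x (w x)) S"
proof -
  have "Ck_on n (\<lambda>x. \<Sum>u\<in>onb. inner (w x) u *\<^sub>R A x u) S"
    by (intro Ck_on_sum assms Ck_on_bilinear[OF _ bounded_bilinear_scaleR]
      Ck_on_bounded_linear_image[OF _ bounded_linear_inner_left])
  then show ?thesis
    using Ck_on_cong[OF assms(1), of "\<lambda>x. A x (w x)" "\<lambda>x. \<Sum>u\<in>onb. inner (w x) u *\<^sub>R A x u"]
      linear_onb_expansion[OF assms(2)] by simp
qed

lemma Ck_on_compose:
  fixes g :: "'a::real_normed_vector \<Rightarrow> 'b::coordinate_space"
  assumes "open S" "open T" "Ck_on n f T" "Ck_on n g S" "g ` S \<subseteq> T"
  shows "Ck_on n (\<lambda>x. f (g x)) S"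
  using assms(3,4)
proof (induction n arbitrary: f)
  case 0
  then show ?case using continuous_on_compose2 assms(5) by auto
next
  case (Suc n)
  show ?case
  proof (rule Ck_on_SucI[where f' = "\<lambda>x v. frechet_derivative f (at (g x)) (frechet_derivative g (at x) v)"])
    fix x assume x: "x \<in> S"
    then have "g x \<in> T" using assms(5) by auto
    show "((\<lambda>x. f (g x)) has_derivative
        (\<lambda>v. frechet_derivative f (at (g x)) (frechet_derivative g (at x) v))) (at x)"
      by (rule has_derivative_compose[OF Ck_on_SucD(1)[OF Suc.prems(2) x] Ck_on_SucD(1)[OF Suc.prems(1) \<open>g x \<in> T\<close>]])
  next
    fix v
    show "Ck_on n (\<lambda>x. frechet_derivative f (at (g x)) (frechet_derivative g (at x) v)) S"
    proof (rule Ck_on_linear_family)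
      show "linear (frechet_derivative f (at (g x)))" if "x \<in> S" for x
        using Ck_on_SucD(1)[OF Suc.prems(1)] that assms(5) has_derivative_linear by blast
      show "Ck_on n (\<lambda>x. frechet_derivative f (at (g x)) b) S" for b
        by (rule Suc.IH[OF Ck_on_SucD(2)[OF Suc.prems(1)] Ck_on_lower[OF Suc.prems(2)]])
    qed (intro assms Ck_on_SucD[OF Suc.prems(2)])+
  qed (rule assms)
qed

lemma Ck_on_Pair:
  assumes "open S" "Ck_on n f S" "Ck_on n g S"
  shows "Ck_on n (\<lambda>x. (f x, g x)) S"
  using assms(2,3)
proof (induction n arbitrary: f g)
  case 0
  then show ?case by (auto intro: continuous_intros)
next
  case (Suc n)
  show ?case
    by (rule Ck_on_SucI[where f' = "\<lambda>x v. (frechet_derivative f (at x) v, frechet_derivative g (at x) v)"])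
      (intro assms has_derivative_Pair Suc.IH Ck_on_SucD[OF Suc.prems(1)] Ck_on_SucD[OF Suc.prems(2)]; assumption)+
qed

subsection \<open>Complements of a surjective linear map\<close>

text \<open>
  Let \<open>R\<close> be a right inverse of \<open>L\<close>. The independent set \<open>R ` onb\<close> extends to a basis by vectors of
  the kernel of \<open>L\<close>, and counting shows that as many are added as there are basis vectors of the
  second factor. The map \<open>q\<close> sends the added vectors to those basis vectors and \<open>R ` onb\<close> to 0.
\<close>

lemma surjective_complement:
  fixes L :: "'x::coordinate_space \<times> 'y::coordinate_space \<Rightarrow> 'x"
  assumes L: "linear L" "surj L"
  shows "\<exists>q :: 'x \<times> 'y \<Rightarrow> 'y. linear q \<and> bij (\<lambda>z. (L z, q z))"
proof -
  obtain R where R: "linear R" "L \<circ> R = id" using linear_surjective_right_inverse[OF L] by blast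
  have LR: "L (R x) = x" for x using R(2) by (metis comp_apply id_apply)
  have "inj R" by (metis LR injI)
  define P :: "('x \<times> 'y) set" where "P = (\<lambda>u. (u, 0)) ` onb \<union> (\<lambda>v. (0, v)) ` onb"
  have "0 \<notin> (onb :: 'x set)" "0 \<notin> (onb :: 'y set)" using norm_onb by force+
  then have P: "independent P" "finite P" "card P = card (onb :: 'x set) + card (onb :: 'y set)"
  proof -
    assume n: "0 \<notin> (onb :: 'x set)" "0 \<notin> (onb :: 'y set)"
    show f: "finite P" by (simp add: P_def finite_onb)
    show "independent P"
      by (rule independent_orthonormal[OF f]) (use n in \<open>auto simp: P_def inner_onb split: if_splits\<close>)
    have "card P = card ((\<lambda>u::'x. (u, 0::'y)) ` onb) + card ((\<lambda>v::'y. (0::'x, v)) ` onb)"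
      unfolding P_def by (rule card_Un_disjoint) (use n in \<open>auto simp: finite_onb\<close>)
    also have "card ((\<lambda>u::'x. (u, 0::'y)) ` onb) = card (onb :: 'x set)"
      by (rule card_image) (simp add: inj_on_def)
    also have "card ((\<lambda>v::'y. (0::'x, v)) ` onb) = card (onb :: 'y set)"
      by (rule card_image) (simp add: inj_on_def)
    finally show "card P = card (onb :: 'x set) + card (onb :: 'y set)" .
  qed
  have spP: "span P = UNIV"
  proof -
    have "(x, 0) \<in> span P" for x :: 'x
    proof -
      have "(x, 0::'y) = (\<Sum>u\<in>onb. inner x u *\<^sub>R (u, 0))"
        by (simp add: sum_prod prod_eq_iff fst_sum snd_sum onb_expansion)
      also have "\<dots> \<in> span P"
        by (intro span_sum span_scale span_base) (auto simp: P_def)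
      finally show ?thesis .
    qed
    moreover have "(0, y) \<in> span P" for y :: 'y
    proof -
      have "(0::'x, y) = (\<Sum>u\<in>onb. inner y u *\<^sub>R (0, u))"
        by (simp add: prod_eq_iff fst_sum snd_sum onb_expansion)
      also have "\<dots> \<in> span P"
        by (intro span_sum span_scale span_base) (auto simp: P_def)
      finally show ?thesis .
    qed
    ultimately have "(x, 0) + (0, y) \<in> span P" for x y by (metis span_add)
    then show ?thesis by auto
  qed
  have "independent (R ` onb)"
    by (rule linear_independent_injective_image[OF R(1) independent_onb])
      (use \<open>inj R\<close> in \<open>auto intro: inj_on_subset\<close>)
  then obtain K where K: "R ` onb \<subseteq> K" "K \<subseteq> R ` onb \<union> {z. L z = 0}" "independent K"
      "R ` onb \<union> {z. L z = 0} \<subseteq> span K"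
    using maximal_independent_subset_extend[of "R ` onb" "R ` onb \<union> {z. L z = 0}"] by blast
  have spK: "span K = UNIV"
  proof -
    have "z \<in> span K" for z
    proof -
      have "R (L z) = (\<Sum>u\<in>onb. inner (L z) u *\<^sub>R R u)" by (rule linear_onb_expansion[OF R(1)])
      also have "\<dots> \<in> span K" using K(4) by (intro span_sum span_scale) auto
      finally have "R (L z) \<in> span K" .
      moreover have "L (z - R (L z)) = 0" by (simp add: linear_diff L LR)
      then have "z - R (L z) \<in> span K" using K(4) by auto
      ultimately have "R (L z) + (z - R (L z)) \<in> span K" by (rule span_add)
      then show ?thesis by simp
    qed
    then show ?thesis by auto
  qed
  have "finite K" "card K \<le> card P"
    using independent_span_bound[OF P(2) K(3)] by (auto simp: spP)
  moreover have "card P \<le> card K"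
    using independent_span_bound[OF \<open>finite K\<close> P(1)] by (auto simp: spK)
  moreover have "card (R ` onb) = card (onb :: 'x set)"
    by (rule card_image) (use \<open>inj R\<close> in \<open>auto intro: inj_on_subset\<close>)
  ultimately have "card (K - R ` onb) = card (onb :: 'y set)"
    using P(3) by (simp add: card_Diff_subset finite_onb K(1))
  then obtain \<beta> where \<beta>: "bij_betw \<beta> (onb :: 'y set) (K - R ` onb)"
    by (metis finite_same_card_bij finite_onb \<open>finite K\<close> finite_Diff)
  obtain q :: "'x \<times> 'y \<Rightarrow> 'y" where q: "linear q"
      "\<And>z. z \<in> K \<Longrightarrow> q z = (if z \<in> R ` onb then 0 else inv_into onb \<beta> z)"
    using linear_independent_extend[OF K(3), of "\<lambda>z. if z \<in> R ` onb then 0 else inv_into onb \<beta> z"]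
    by blast
  have qR: "q (R x) = 0" for x
  proof -
    have "q (R x) = (\<Sum>u\<in>onb. inner x u *\<^sub>R q (R u))"
      using linear_onb_expansion[OF linear_compose[OF R(1) q(1)], of x] by simp
    also have "\<dots> = 0"
    proof (intro sum.neutral ballI)
      fix u :: 'x assume "u \<in> onb"
      then have "R u \<in> R ` onb" by (rule imageI)
      then have "q (R u) = 0" using q(2)[of "R u"] K(1) by auto
      then show "inner x u *\<^sub>R q (R u) = 0" by simp
    qed
    finally show ?thesis .
  qed
  have q\<beta>: "q (\<beta> u) = u" "L (\<beta> u) = 0" if "u \<in> onb" for u
  proof -
    have "\<beta> u \<in> K - R ` onb" using \<beta> that bij_betwE by blast
    moreover have "inv_into onb \<beta> (\<beta> u) = u" using \<beta> that by (simp add: bij_betw_def)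
    ultimately show "q (\<beta> u) = u" "L (\<beta> u) = 0" using q(2)[of "\<beta> u"] K(2) by auto
  qed
  define A where "A z = (L z, q z)" for z
  have A: "linear A"
    unfolding A_def by (intro linearI) (simp_all add: linear_add linear_scale L q)
  have "surj A"
  proof (rule surjI)
    fix xy :: "'x \<times> 'y"
    let ?z = "R (fst xy) + (\<Sum>u\<in>onb. inner (snd xy) u *\<^sub>R \<beta> u)"
    have "L ?z = fst xy + (\<Sum>u\<in>onb. inner (snd xy) u *\<^sub>R L (\<beta> u))"
      by (simp add: linear_add linear_sum linear_scale L LR)
    moreover have "(\<Sum>u\<in>onb. inner (snd xy) u *\<^sub>R L (\<beta> u)) = 0"
      by (rule sum.neutral) (simp add: q\<beta>)
    moreover have "q ?z = (\<Sum>u\<in>onb. inner (snd xy) u *\<^sub>R q (\<beta> u))"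
      by (simp add: linear_add linear_sum linear_scale q qR)
    moreover have "(\<Sum>u\<in>onb. inner (snd xy) u *\<^sub>R q (\<beta> u)) = (\<Sum>u\<in>onb. inner (snd xy) u *\<^sub>R u)"
      by (rule sum.cong) (simp_all add: q\<beta>)
    ultimately show "A ?z = xy" by (simp add: A_def onb_expansion)
  qed
  then obtain G where G: "linear G" "A \<circ> G = id" using linear_surjective_right_inverse[OF A] by blast
  then have "inj G" by (metis injI comp_apply id_apply)
  then have "surj G" using linear_injective_imp_surjective G by blast
  then have "inj A" using G(2) by (metis comp_apply id_apply injI surjD)
  then show ?thesis using \<open>surj A\<close> q(1) unfolding A_def bij_def by blast
qed

subsection \<open>Smoothness at a point\<close>

text \<open>
  Smoothness of germs. Conditions on domains become statements that hold eventually near a point,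
  so that composition requires no explicit open sets.
\<close>

definition smooth_at :: "('a::real_normed_vector \<Rightarrow> 'b::real_normed_vector) \<Rightarrow> 'a \<Rightarrow> bool" where
  "smooth_at f z \<longleftrightarrow> (\<exists>S. open S \<and> z \<in> S \<and> smooth_on f S)"

lemma smooth_on_smooth_at: "smooth_on f S \<Longrightarrow> open S \<Longrightarrow> z \<in> S \<Longrightarrow> smooth_at f z"
  unfolding smooth_at_def by blast

lemma smooth_on_smooth_atI: "(\<And>z. z \<in> S \<Longrightarrow> smooth_at f z) \<Longrightarrow> smooth_on f S"
  unfolding smooth_at_def smooth_on_def by (intro allI Ck_on_local) blast

lemma smooth_on_subset: "smooth_on f T \<Longrightarrow> S \<subseteq> T \<Longrightarrow> smooth_on f S"
  unfolding smooth_on_def by (auto intro: Ck_on_subset)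

lemma smooth_on_cong:
  "open S \<Longrightarrow> (\<And>x. x \<in> S \<Longrightarrow> f x = g x) \<Longrightarrow> smooth_on f S \<longleftrightarrow> smooth_on g S"
  unfolding smooth_on_def using Ck_on_cong[of S f g] by simp

lemma smooth_at_eventually: "smooth_at f z \<Longrightarrow> \<forall>\<^sub>F x in nhds z. smooth_at f x"
  unfolding smooth_at_def eventually_nhds by blast

lemma smooth_at_cong:
  assumes "\<forall>\<^sub>F x in nhds z. f x = g x"
  shows "smooth_at f z \<longleftrightarrow> smooth_at g z"
proof -
  have *: "smooth_at g z" if f: "smooth_at f z" and eq: "\<forall>\<^sub>F x in nhds z. f x = g x" for f g :: "'a \<Rightarrow> 'b"
  proof -
    obtain S where S: "open S" "z \<in> S" "smooth_on f S" using f unfolding smooth_at_def by auto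
    obtain T where T: "open T" "z \<in> T" "\<And>x. x \<in> T \<Longrightarrow> f x = g x"
      using eq unfolding eventually_nhds by blast
    have "smooth_on g (S \<inter> T)"
      using smooth_on_subset[OF S(3), of "S \<inter> T"] S T by (subst smooth_on_cong[of _ g f]) auto
    then show ?thesis using S T unfolding smooth_at_def by (intro exI[of _ "S \<inter> T"]) auto
  qed
  have "\<forall>\<^sub>F x in nhds z. g x = f x" using assms by eventually_elim simp
  then show ?thesis using *[of f g] *[of g f] assms by blast
qed

lemma smooth_at_isCont: "smooth_at f z \<Longrightarrow> isCont f z"
  unfolding smooth_at_def smooth_on_def
  by (metis Ck_on.simps(1) continuous_on_eq_continuous_at)

lemma smooth_at_eventually_compose:
  "smooth_at g z \<Longrightarrow> \<forall>\<^sub>F y in nhds (g z). P y \<Longrightarrow> \<forall>\<^sub>F x in nhds z. P (g x)"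
  using smooth_at_isCont[of g z] unfolding isCont_def tendsto_at_iff_tendsto_nhds
  by (rule eventually_compose_filterlim[rotated])

lemma smooth_at_has_derivative:
  "smooth_at f z \<Longrightarrow> (f has_derivative frechet_derivative f (at z)) (at z)"
  unfolding smooth_at_def smooth_on_def by (auto intro: Ck_on_SucD(1)[of 0 f])

lemma smooth_at_linear_derivative: "smooth_at f z \<Longrightarrow> linear (frechet_derivative f (at z))"
  by (rule has_derivative_linear[OF smooth_at_has_derivative])

lemma smooth_at_derivative: "smooth_at f z \<Longrightarrow> smooth_at (\<lambda>x. frechet_derivative f (at x) v) z"
  unfolding smooth_at_def smooth_on_def by (auto intro: Ck_on_SucD(2))

lemma smooth_at_const: "smooth_at (\<lambda>_. a) z"
  unfolding smooth_at_def smooth_on_def by (intro exI[of _ UNIV]) (simp add: Ck_on_const)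

lemma smooth_at_bounded_linear: "bounded_linear L \<Longrightarrow> smooth_at L z"
  unfolding smooth_at_def smooth_on_def by (intro exI[of _ UNIV]) (simp add: Ck_on_linear)

lemma smooth_at_binary:
  assumes "smooth_at f z" "smooth_at g z"
    and "\<And>S n. open S \<Longrightarrow> Ck_on n f S \<Longrightarrow> Ck_on n g S \<Longrightarrow> Ck_on n h S"
  shows "smooth_at h z"
proof -
  obtain S T where "open S" "z \<in> S" "smooth_on f S" "open T" "z \<in> T" "smooth_on g T"
    using assms unfolding smooth_at_def by blast
  then have "smooth_on h (S \<inter> T)"
    using assms(3)[of "S \<inter> T"] Ck_on_subset[of _ f S "S \<inter> T"] Ck_on_subset[of _ g T "S \<inter> T"]
    unfolding smooth_on_def by auto
  then show ?thesis unfolding smooth_at_def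
    using \<open>open S\<close> \<open>open T\<close> \<open>z \<in> S\<close> \<open>z \<in> T\<close> by (intro exI[of _ "S \<inter> T"]) auto
qed

lemma smooth_at_Pair: "smooth_at f z \<Longrightarrow> smooth_at g z \<Longrightarrow> smooth_at (\<lambda>x. (f x, g x)) z"
  by (erule (1) smooth_at_binary) (rule Ck_on_Pair)

lemma smooth_at_add: "smooth_at f z \<Longrightarrow> smooth_at g z \<Longrightarrow> smooth_at (\<lambda>x. f x + g x) z"
  by (erule (1) smooth_at_binary) (rule Ck_on_add)

lemma smooth_at_scaleR: "smooth_at f z \<Longrightarrow> smooth_at g z \<Longrightarrow> smooth_at (\<lambda>x. f x *\<^sub>R g x) z"
  by (erule (1) smooth_at_binary) (rule Ck_on_bilinear[OF _ bounded_bilinear_scaleR])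

lemma smooth_at_linear_image:
  assumes "smooth_at f z" "bounded_linear L"
  shows "smooth_at (\<lambda>x. L (f x)) z"
  by (rule smooth_at_binary[OF assms(1) assms(1)]) (rule Ck_on_bounded_linear_image[OF _ assms(2)])

lemma smooth_at_sum:
  "(\<And>i. i \<in> I \<Longrightarrow> smooth_at (f i) z) \<Longrightarrow> smooth_at (\<lambda>x. \<Sum>i\<in>I. f i x) z"
  by (induction I rule: infinite_finite_induct) (simp_all add: smooth_at_const smooth_at_add)

lemmas smooth_at_snd = smooth_at_linear_image[OF _ bounded_linear_snd]
lemmas smooth_at_ident = smooth_at_bounded_linear[OF bounded_linear_ident]

lemma smooth_at_compose:
  fixes g :: "'a::real_normed_vector \<Rightarrow> 'b::coordinate_space"
  assumes "smooth_at g z" "smooth_at f (g z)"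
  shows "smooth_at (\<lambda>x. f (g x)) z"
proof -
  obtain T where T: "open T" "g z \<in> T" "smooth_on f T" using assms unfolding smooth_at_def by blast
  obtain S where S: "open S" "z \<in> S" "smooth_on g S" using assms unfolding smooth_at_def by blast
  have "\<forall>\<^sub>F y in nhds (g z). y \<in> T" using T eventually_nhds_in_open by blast
  then obtain S' where S': "open S'" "z \<in> S'" "\<And>x. x \<in> S' \<Longrightarrow> g x \<in> T"
    using smooth_at_eventually_compose[OF assms(1), of "\<lambda>y. y \<in> T"]
    unfolding eventually_nhds by auto
  have "smooth_on (\<lambda>x. f (g x)) (S \<inter> S')"
    unfolding smooth_on_def
  proof
    fix n
    show "Ck_on n (\<lambda>x. f (g x)) (S \<inter> S')"
      by (rule Ck_on_compose[where T = T])
        (use S T S' Ck_on_subset[of n g S "S \<inter> S'"] in \<open>auto simp: smooth_on_def\<close>)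
  qed
  then show ?thesis unfolding smooth_at_def using S S' by (intro exI[of _ "S \<inter> S'"]) auto
qed

lemma smooth_at_linear_family:
  fixes A :: "'a::real_normed_vector \<Rightarrow> 'b::coordinate_space \<Rightarrow> 'c::real_normed_vector"
  assumes "\<forall>\<^sub>F x in nhds z. linear (A x)" "\<And>b. smooth_at (\<lambda>x. A x b) z" "smooth_at w z"
  shows "smooth_at (\<lambda>x. A x (w x)) z"
proof -
  have "smooth_at (\<lambda>x. \<Sum>u\<in>onb. inner (w x) u *\<^sub>R A x u) z"
    by (intro smooth_at_sum smooth_at_scaleR smooth_at_linear_image[OF _ bounded_linear_inner_left] assms)
  moreover have "\<forall>\<^sub>F x in nhds z. A x (w x) = (\<Sum>u\<in>onb. inner (w x) u *\<^sub>R A x u)"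
    using assms(1) by eventually_elim (rule linear_onb_expansion)
  ultimately show ?thesis by (simp add: smooth_at_cong)
qed

lemma frechet_derivative_cong:
  assumes "\<forall>\<^sub>F x in nhds z. f x = g x"
  shows "frechet_derivative f (at z) = frechet_derivative g (at z)"
proof -
  obtain T where T: "open T" "z \<in> T" "\<And>x. x \<in> T \<Longrightarrow> f x = g x"
    using assms unfolding eventually_nhds by blast
  have "(f has_derivative f') (at z) \<longleftrightarrow> (g has_derivative f') (at z)" for f'
    using has_derivative_transform_within_open[OF _ T(1,2), of f f' UNIV g]
      has_derivative_transform_within_open[OF _ T(1,2), of g f' UNIV f] T(3) by auto
  then show ?thesis unfolding frechet_derivative_def by simp
qed

lemma frechet_derivative_compose:
  assumes "smooth_at g z" "smooth_at f (g z)"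
  shows "frechet_derivative (\<lambda>x. f (g x)) (at z) v =
    frechet_derivative f (at (g z)) (frechet_derivative g (at z) v)"
  by (rule fun_cong[OF frechet_derivative_at[OF has_derivative_compose[OF
    smooth_at_has_derivative[OF assms(1)] smooth_at_has_derivative[OF assms(2)]]], symmetric])

subsection \<open>Symmetry of second derivatives\<close>

text \<open>
  The mean value theorem is applied in direction \<open>u\<close> to the function \<open>x \<mapsto> f (x + t v) - f x\<close>, and
  then in direction \<open>v\<close> to the derivative \<open>x \<mapsto> f' x u\<close>.
\<close>

lemma second_difference_mean_value:
  fixes f :: "'a::real_normed_vector \<Rightarrow> real"
  assumes t: "0 < t" and S: "\<And>r s. 0 \<le> r \<Longrightarrow> r \<le> t \<Longrightarrow> 0 \<le> s \<Longrightarrow> s \<le> t \<Longrightarrow> z + r *\<^sub>R u + s *\<^sub>R v \<in> S"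
    and f': "\<And>x. x \<in> S \<Longrightarrow> (f has_derivative f' x) (at x)"
    and f'': "\<And>x. x \<in> S \<Longrightarrow> ((\<lambda>x. f' x u) has_derivative f'' x) (at x)"
  shows "\<exists>r s. 0 < r \<and> r < t \<and> 0 < s \<and> s < t \<and>
    f (z + t *\<^sub>R u + t *\<^sub>R v) - f (z + t *\<^sub>R u) - f (z + t *\<^sub>R v) + f z = t * t * f'' (z + r *\<^sub>R u + s *\<^sub>R v) v"
proof -
  have 1: "((\<lambda>r. f (z + r *\<^sub>R u + s *\<^sub>R v)) has_real_derivative f' (z + r *\<^sub>R u + s *\<^sub>R v) u) (at r)"
    if "0 \<le> r" "r \<le> t" "0 \<le> s" "s \<le> t" for r s
  proof -
    have "((\<lambda>r. z + r *\<^sub>R u + s *\<^sub>R v) has_derivative (\<lambda>h. h *\<^sub>R u)) (at r)"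
      by (auto intro!: derivative_eq_intros)
    from has_derivative_compose[OF this f'[OF S[OF that]]]
    have "((\<lambda>r. f (z + r *\<^sub>R u + s *\<^sub>R v)) has_derivative (\<lambda>h. f' (z + r *\<^sub>R u + s *\<^sub>R v) (h *\<^sub>R u))) (at r)" .
    moreover have "f' (z + r *\<^sub>R u + s *\<^sub>R v) (h *\<^sub>R u) = f' (z + r *\<^sub>R u + s *\<^sub>R v) u * h" for h
      using linear_scale[OF has_derivative_linear[OF f'[OF S[OF that]]]] by simp
    ultimately show ?thesis by (simp add: has_field_derivative_def mult_commute_abs)
  qed
  have 2: "((\<lambda>s. f' (z + r *\<^sub>R u + s *\<^sub>R v) u) has_real_derivative f'' (z + r *\<^sub>R u + s *\<^sub>R v) v) (at s)"
    if "0 \<le> r" "r \<le> t" "0 \<le> s" "s \<le> t" for r s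
  proof -
    have "((\<lambda>s. z + r *\<^sub>R u + s *\<^sub>R v) has_derivative (\<lambda>h. h *\<^sub>R v)) (at s)"
      by (auto intro!: derivative_eq_intros)
    from has_derivative_compose[OF this f''[OF S[OF that]]]
    have "((\<lambda>s. f' (z + r *\<^sub>R u + s *\<^sub>R v) u) has_derivative (\<lambda>h. f'' (z + r *\<^sub>R u + s *\<^sub>R v) (h *\<^sub>R v))) (at s)" .
    moreover have "f'' (z + r *\<^sub>R u + s *\<^sub>R v) (h *\<^sub>R v) = f'' (z + r *\<^sub>R u + s *\<^sub>R v) v * h" for h
      using linear_scale[OF has_derivative_linear[OF f''[OF S[OF that]]]] by simp
    ultimately show ?thesis by (simp add: has_field_derivative_def mult_commute_abs)
  qed
  let ?\<phi> = "\<lambda>r. f (z + r *\<^sub>R u + t *\<^sub>R v) - f (z + r *\<^sub>R u + 0 *\<^sub>R v)"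
  have "\<exists>r>0. r < t \<and> ?\<phi> t - ?\<phi> 0 = (t - 0) * (f' (z + r *\<^sub>R u + t *\<^sub>R v) u - f' (z + r *\<^sub>R u + 0 *\<^sub>R v) u)"
    by (rule MVT2[OF t]) (intro DERIV_diff 1; use t in simp)
  then obtain r where r: "0 < r" "r < t"
      "?\<phi> t - ?\<phi> 0 = t * (f' (z + r *\<^sub>R u + t *\<^sub>R v) u - f' (z + r *\<^sub>R u + 0 *\<^sub>R v) u)" by auto
  have "\<exists>s>0. s < t \<and> f' (z + r *\<^sub>R u + t *\<^sub>R v) u - f' (z + r *\<^sub>R u + 0 *\<^sub>R v) u =
      (t - 0) * f'' (z + r *\<^sub>R u + s *\<^sub>R v) v"
    by (rule MVT2[OF t]) (intro 2; use r in simp)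
  then obtain s where "0 < s" "s < t"
      "f' (z + r *\<^sub>R u + t *\<^sub>R v) u - f' (z + r *\<^sub>R u + 0 *\<^sub>R v) u = t * f'' (z + r *\<^sub>R u + s *\<^sub>R v) v" by auto
  then show ?thesis using r by (intro exI[of _ r] exI[of _ s]) simp
qed

text \<open>
  The second difference over a parallelogram with sides \<open>t u\<close> and \<open>t v\<close> is symmetric in \<open>u\<close> and
  \<open>v\<close>; divided by \<open>t * t\<close> it tends to each of the two mixed derivatives.
\<close>

lemma second_derivative_symmetric_real:
  fixes f :: "'a::real_normed_vector \<Rightarrow> real"
  assumes "smooth_at f z"
  shows "frechet_derivative (\<lambda>x. frechet_derivative f (at x) v) (at z) u =
    frechet_derivative (\<lambda>x. frechet_derivative f (at x) u) (at z) v"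
proof -
  define D where "D u v x = frechet_derivative (\<lambda>x. frechet_derivative f (at x) u) (at x) v" for u v x
  define \<Delta> where "\<Delta> u v t = f (z + t *\<^sub>R u + t *\<^sub>R v) - f (z + t *\<^sub>R u) - f (z + t *\<^sub>R v) + f z" for u v t
  have lim: "((\<lambda>t. \<Delta> u v t / (t * t)) \<longlongrightarrow> D u v z) (at_right 0)" for u v
  proof (rule tendstoI)
    fix e :: real assume "0 < e"
    have "smooth_at (D u v) z"
      unfolding D_def by (intro smooth_at_derivative assms)
    then have "(D u v \<longlongrightarrow> D u v z) (nhds z)"
      using smooth_at_isCont unfolding isCont_def tendsto_at_iff_tendsto_nhds by blast
    then have "\<forall>\<^sub>F x in nhds z. dist (D u v x) (D u v z) < e" using \<open>0 < e\<close> by (rule tendstoD)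
    moreover have "\<forall>\<^sub>F x in nhds z. smooth_at f x" using assms by (rule smooth_at_eventually)
    ultimately have "\<forall>\<^sub>F x in nhds z. dist (D u v x) (D u v z) < e \<and> smooth_at f x"
      by eventually_elim simp
    then obtain d where d: "0 < d" "\<And>x. dist x z < d \<Longrightarrow> dist (D u v x) (D u v z) < e \<and> smooth_at f x"
      unfolding eventually_nhds_metric by blast
    \<comment> \<open>for \<open>t < k\<close> the parallelogram lies in the ball of radius \<open>d\<close>\<close>
    define k where "k = d / (norm u + norm v + 1)"
    have pos: "0 < norm u + norm v + 1" by (smt (verit) norm_ge_zero)
    then have k: "0 < k" "k * (norm u + norm v + 1) = d" using d(1) by (simp_all add: k_def)
    have "dist (\<Delta> u v t / (t * t)) (D u v z) < e" if t: "0 < t" "t < k" for t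
    proof -
      have b: "z + r *\<^sub>R u + s *\<^sub>R v \<in> ball z d" if "0 \<le> r" "r \<le> t" "0 \<le> s" "s \<le> t" for r s
      proof -
        have "norm (r *\<^sub>R u + s *\<^sub>R v) \<le> r * norm u + s * norm v"
          using that by (intro order_trans[OF norm_triangle_ineq]) simp
        also have "\<dots> \<le> t * norm u + t * norm v"
          using that by (intro add_mono mult_right_mono) auto
        also have "\<dots> < t * (norm u + norm v + 1)" using t by (simp add: algebra_simps)
        also have "\<dots> < d" using t pos k(2) by (metis mult_less_cancel_right_pos)
        finally have "norm (r *\<^sub>R u + s *\<^sub>R v) < d" .
        moreover have "dist z (z + r *\<^sub>R u + s *\<^sub>R v) = norm (r *\<^sub>R u + s *\<^sub>R v)"
          by (metis add.assoc add_diff_cancel_left' dist_commute dist_norm)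
        ultimately show ?thesis by simp
      qed
      have "\<exists>r s. 0 < r \<and> r < t \<and> 0 < s \<and> s < t \<and> \<Delta> u v t = t * t * D u v (z + r *\<^sub>R u + s *\<^sub>R v)"
        unfolding \<Delta>_def D_def
      proof (rule second_difference_mean_value[OF t(1) b])
        fix x assume "x \<in> ball z d"
        then have "smooth_at f x" using d(2) by (simp add: dist_commute)
        then show "(f has_derivative frechet_derivative f (at x)) (at x)"
          "((\<lambda>x. frechet_derivative f (at x) u) has_derivative
            frechet_derivative (\<lambda>x. frechet_derivative f (at x) u) (at x)) (at x)"
          by (auto intro: smooth_at_has_derivative smooth_at_derivative)
      qed
      then obtain r s where rs: "0 < r" "r < t" "0 < s" "s < t"
        "\<Delta> u v t = t * t * D u v (z + r *\<^sub>R u + s *\<^sub>R v)" by blast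
      have "dist (z + r *\<^sub>R u + s *\<^sub>R v) z < d" using b[of r s] rs by (simp add: dist_commute)
      then show ?thesis using d(2) t rs(5) by simp
    qed
    then show "\<forall>\<^sub>F t in at_right 0. dist (\<Delta> u v t / (t * t)) (D u v z) < e"
      unfolding eventually_at_right_field using k(1) by (intro exI[of _ k]) simp
  qed
  have "\<Delta> u v = \<Delta> v u" 
  proof
    fix t
    have e: "z + t *\<^sub>R u + t *\<^sub>R v = z + t *\<^sub>R v + t *\<^sub>R u" by (metis add.assoc add.commute)
    show "\<Delta> u v t = \<Delta> v u t" unfolding \<Delta>_def e by simp
  qed
  then have "((\<lambda>t. \<Delta> u v t / (t * t)) \<longlongrightarrow> D v u z) (at_right 0)" using lim[of v u] by simp
  then have "D u v z = D v u z" by (rule tendsto_unique[OF trivial_limit_at_right_real lim[of u v]])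
  then show ?thesis by (simp add: D_def)
qed

lemma second_derivative_symmetric:
  fixes f :: "'a::real_normed_vector \<Rightarrow> 'b::coordinate_space"
  assumes "smooth_at f z"
  shows "frechet_derivative (\<lambda>x. frechet_derivative f (at x) v) (at z) u =
    frechet_derivative (\<lambda>x. frechet_derivative f (at x) u) (at z) v"
proof -
  have D: "frechet_derivative (\<lambda>x. inner (g x) w) (at x) u = inner (frechet_derivative g (at x) u) w"
    if "smooth_at g x" for g :: "'a \<Rightarrow> 'b" and x u w
    by (rule fun_cong[OF frechet_derivative_at[OF bounded_linear.has_derivative[OF
      bounded_linear_inner_left smooth_at_has_derivative[OF that]]], symmetric])
  have D2: "frechet_derivative (\<lambda>x. frechet_derivative (\<lambda>x. inner (f x) w) (at x) v) (at z) u =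
      inner (frechet_derivative (\<lambda>x. frechet_derivative f (at x) v) (at z) u) w" for u v w
  proof -
    have "\<forall>\<^sub>F x in nhds z. frechet_derivative (\<lambda>x. inner (f x) w) (at x) v = inner (frechet_derivative f (at x) v) w"
      using smooth_at_eventually[OF assms] by eventually_elim (rule D)
    then show ?thesis
      by (simp add: frechet_derivative_cong D smooth_at_derivative assms)
  qed
  have s: "smooth_at (\<lambda>x. inner (f x) w) z" for w
    by (rule smooth_at_linear_image[OF assms bounded_linear_inner_left])
  then have "inner (frechet_derivative (\<lambda>x. frechet_derivative f (at x) v) (at z) u) w =
      inner (frechet_derivative (\<lambda>x. frechet_derivative f (at x) u) (at z) v) w" for w
    using second_derivative_symmetric_real[OF s, of w v u] by (simp only: D2)
  then show ?thesis by (subst vector_eq_rdot[symmetric]) simp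
qed

subsection \<open>The smooth inverse function theorem\<close>

lemma linear_inverse:
  assumes f: "linear f" and fg: "\<And>w. f (g w) = w" and gf: "\<And>w. g (f w) = w"
  shows "linear g"
proof (rule linearI)
  fix v w r
  have "f (g v + g w) = v + w" "f (r *\<^sub>R g w) = r *\<^sub>R w"
    by (simp_all add: linear_add[OF f] linear_scale[OF f] fg)
  then show "g (v + w) = g v + g w" "g (r *\<^sub>R w) = r *\<^sub>R g w" using gf by metis+
qed

lemma continuous_on_linear_family:
  fixes A :: "'a::topological_space \<Rightarrow> 'b::coordinate_space \<Rightarrow> 'c::real_normed_vector"
  assumes "\<And>x. x \<in> S \<Longrightarrow> linear (A x)" "\<And>b. continuous_on S (\<lambda>x. A x b)"
  shows "continuous_on (S \<times> UNIV) (\<lambda>(x, v). A x v)"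
proof -
  have "continuous_on (S \<times> UNIV) (\<lambda>p. \<Sum>u\<in>onb. inner (snd p) u *\<^sub>R A (fst p) u)"
    by (intro continuous_intros continuous_on_compose2[OF assms(2)]) auto
  then show ?thesis
    by (rule continuous_on_eq) (auto simp: linear_onb_expansion[OF assms(1), symmetric])
qed

text \<open>
  The estimate rests on \<open>B x w - B x0 w = B x0 ((A x0 - A x) (B x w))\<close>. It bounds \<open>norm (B x w)\<close> by
  \<open>2 * norm (B x0 w)\<close> as soon as \<open>A x\<close> is close to \<open>A x0\<close>, and then gives convergence.
\<close>

lemma continuous_on_inverse_family:
  fixes A :: "'a::topological_space \<Rightarrow> 'b::coordinate_space \<Rightarrow> 'c::coordinate_space"
  assumes lin: "\<And>x. x \<in> S \<Longrightarrow> linear (A x)" and cont: "\<And>w. continuous_on S (\<lambda>x. A x w)"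
    and inv: "\<And>x w. x \<in> S \<Longrightarrow> A x (B x w) = w" "\<And>x w. x \<in> S \<Longrightarrow> B x (A x w) = w"
    and linB: "\<And>x. x \<in> S \<Longrightarrow> linear (B x)"
  shows "continuous_on S (\<lambda>x. B x w)"
  unfolding continuous_on_def
proof
  fix x0 assume x0: "x0 \<in> S"
  define \<eta> where "\<eta> x = (\<Sum>u\<in>onb. norm (A x0 u - A x u))" for x
  define M where "M = (\<Sum>u\<in>onb. norm (B x0 u)) + 1"
  have "0 \<le> (\<Sum>u\<in>onb. norm (B x0 u))" by (simp add: sum_nonneg)
  then have M: "0 < M" by (simp add: M_def)
  have BM: "norm (B x0 v) \<le> M * norm v" for v
    using linear_norm_bound[OF linB[OF x0], of v] norm_ge_zero[of v]
    unfolding M_def distrib_right by linarith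
  have \<eta>: "(\<eta> \<longlongrightarrow> 0) (at x0 within S)"
  proof -
    have "(\<eta> \<longlongrightarrow> (\<Sum>u\<in>onb. norm (A x0 u - A x0 u))) (at x0 within S)"
      unfolding \<eta>_def using cont x0 by (intro tendsto_intros) (auto simp: continuous_on_def)
    then show ?thesis by simp
  qed
  have est: "norm (B x w - B x0 w) \<le> M * \<eta> x * norm (B x w)" if x: "x \<in> S" for x
  proof -
    have lin': "linear (\<lambda>v. A x0 v - A x v)" using lin[OF x0] lin[OF x] by (intro linear_compose_sub)
    have "B x w - B x0 w = B x0 (A x0 (B x w) - A x (B x w))"
      by (simp add: linear_diff[OF linB[OF x0]] inv x x0)
    then have "norm (B x w - B x0 w) \<le> M * norm (A x0 (B x w) - A x (B x w))" by (metis BM)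
    also have "\<dots> \<le> M * (\<eta> x * norm (B x w))"
      using M linear_norm_bound[OF lin', of "B x w"] by (simp add: \<eta>_def)
    finally show ?thesis by simp
  qed
  have "\<forall>\<^sub>F x in at x0 within S. \<eta> x < 1 / (2 * M)"
    using \<eta> M by (intro order_tendstoD) auto
  moreover have inS: "\<forall>\<^sub>F x in at x0 within S. x \<in> S" by (simp add: eventually_at_filter)
  ultimately have "\<forall>\<^sub>F x in at x0 within S. norm (B x w - B x0 w) \<le> M * \<eta> x * (2 * norm (B x0 w))"
  proof eventually_elim
    case (elim x)
    have "M * \<eta> x \<le> 1 / 2" using elim(1) M by (simp add: field_simps)
    then have "M * \<eta> x * norm (B x w) \<le> 1 / 2 * norm (B x w)" by (rule mult_right_mono) simp
    then have "norm (B x w - B x0 w) \<le> 1 / 2 * norm (B x w)" using est[OF elim(2)] by linarith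
    moreover have "norm (B x w) \<le> norm (B x w - B x0 w) + norm (B x0 w)"
      by (metis diff_add_cancel norm_triangle_ineq)
    ultimately have "norm (B x w) \<le> 2 * norm (B x0 w)" by linarith
    moreover have "0 \<le> M * \<eta> x" using M by (simp add: \<eta>_def sum_nonneg)
    ultimately show ?case using est[OF elim(2)] mult_left_mono order_trans by blast
  qed
  moreover have "((\<lambda>x. M * \<eta> x * (2 * norm (B x0 w))) \<longlongrightarrow> 0) (at x0 within S)"
    using tendsto_mult_left_zero[OF tendsto_mult_right_zero[OF \<eta>, of M]] by simp
  ultimately have "((\<lambda>x. B x w - B x0 w) \<longlongrightarrow> 0) (at x0 within S)"
    by (rule Lim_null_comparison)
  then show "((\<lambda>x. B x w) \<longlongrightarrow> B x0 w) (at x0 within S)" by (rule LIM_zero_cancel)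
qed

text \<open>
  Differentiating \<open>A x (B x w) = w\<close> expresses the derivative of \<open>B x w\<close> through \<open>B x\<close> itself and
  the derivative of \<open>A\<close>, so differentiability classes are inherited by induction. The derivative
  exists because \<open>(x, v) \<mapsto> (x, B x v)\<close> is a continuous inverse of the differentiable map
  \<open>(x, v) \<mapsto> (x, A x v)\<close>.
\<close>

lemma has_derivative_inverse_family:
  fixes A :: "'a::coordinate_space \<Rightarrow> 'b::coordinate_space \<Rightarrow> 'c::coordinate_space"
  assumes S: "open S" "x0 \<in> S" and lin: "\<And>x. x \<in> S \<Longrightarrow> linear (A x)"
    and A': "\<And>x w. x \<in> S \<Longrightarrow> ((\<lambda>x. A x w) has_derivative A' x w) (at x)"
    and inv: "\<And>x w. x \<in> S \<Longrightarrow> A x (B x w) = w" "\<And>x w. x \<in> S \<Longrightarrow> B x (A x w) = w"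
    and linB: "\<And>x. x \<in> S \<Longrightarrow> linear (B x)"
  shows "((\<lambda>x. B x w) has_derivative
    (\<lambda>h. B x0 (- (\<Sum>u\<in>onb. inner (B x0 w) u *\<^sub>R A' x0 u h)))) (at x0)"
proof -
  define \<Psi> where "\<Psi> = (\<lambda>p. (fst p, \<Sum>u\<in>onb. inner (snd p) u *\<^sub>R A (fst p) u))"
  define G where "G = (\<lambda>p. (fst p, B (fst p) (snd p)))"
  define y0 where "y0 = B x0 w"
  define s where "s h = (\<Sum>u\<in>onb. inner y0 u *\<^sub>R A' x0 u h)" for h
  have linA': "linear (A' x0 u)" for u using A'[OF S(2)] has_derivative_linear by blast
  then have s: "linear s" unfolding s_def
    by (intro linear_compose_sum linear_compose_scale_right ballI) (simp add: linear_compose_scale)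
  have \<Psi>: "\<Psi> (x, v) = (x, A x v)" if "x \<in> S" for x v
    using linear_onb_expansion[OF lin[OF that], of v] by (simp add: \<Psi>_def)
  have d\<Psi>: "(\<Psi> has_derivative (\<lambda>(h, k). (h, s h + A x0 k))) (at (x0, y0))"
  proof -
    have "((\<lambda>p. A (fst p) u) has_derivative (\<lambda>q. A' x0 u (fst q))) (at (x0, y0))" for u
      using has_derivative_compose[OF has_derivative_fst[OF has_derivative_ident], of "\<lambda>x. A x u" "A' x0 u" "(x0, y0)"]
        A'[OF S(2)] by simp
    then have "(\<Psi> has_derivative (\<lambda>q. (fst q, \<Sum>u\<in>onb. inner (snd (x0, y0)) u *\<^sub>R A' x0 u (fst q) +
        inner (snd q) u *\<^sub>R A (fst (x0, y0)) u))) (at (x0, y0))"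
      unfolding \<Psi>_def
      by (intro has_derivative_Pair has_derivative_sum has_derivative_scaleR
          has_derivative_inner_left has_derivative_fst has_derivative_snd has_derivative_ident)
    moreover have "(\<lambda>q. (fst q, \<Sum>u\<in>onb. inner (snd (x0, y0)) u *\<^sub>R A' x0 u (fst q) +
        inner (snd q) u *\<^sub>R A (fst (x0, y0)) u)) = (\<lambda>(h, k). (h, s h + A x0 k))"
      by (auto simp: fun_eq_iff sum.distrib s_def linear_onb_expansion[OF lin[OF S(2)], symmetric])
    ultimately show ?thesis by simp
  qed
  have "(G has_derivative (\<lambda>(h, k). (h, B x0 (k - s h)))) (at (x0, w))"
  proof (rule has_derivative_inverse_basic)
    show "(\<Psi> has_derivative (\<lambda>(h, k). (h, s h + A x0 k))) (at (G (x0, w)))"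
      using d\<Psi> by (simp add: G_def y0_def)
    have "linear (\<lambda>(h, k). (h, B x0 (k - s h)))"
    proof (rule linearI)
      fix p q :: "'a \<times> 'c" and r :: real
      have e: "snd p + snd q - s (fst p + fst q) = (snd p - s (fst p)) + (snd q - s (fst q))"
        by (simp add: linear_add[OF s])
      show "(case p + q of (h, k) \<Rightarrow> (h, B x0 (k - s h))) =
          (case p of (h, k) \<Rightarrow> (h, B x0 (k - s h))) + (case q of (h, k) \<Rightarrow> (h, B x0 (k - s h)))"
        by (simp add: case_prod_unfold e linear_add[OF linB[OF S(2)]] del: diff_conv_add_uminus)
      have "r *\<^sub>R snd p - s (r *\<^sub>R fst p) = r *\<^sub>R (snd p - s (fst p))"
        by (simp add: linear_scale[OF s] scaleR_diff_right)
      then show "(case r *\<^sub>R p of (h, k) \<Rightarrow> (h, B x0 (k - s h))) =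
          r *\<^sub>R (case p of (h, k) \<Rightarrow> (h, B x0 (k - s h)))"
        by (simp add: case_prod_unfold linear_scale[OF linB[OF S(2)]])
    qed
    then show "bounded_linear (\<lambda>(h, k). (h, B x0 (k - s h)))" by (rule linear_imp_bounded_linear)
    show "(\<lambda>(h, k). (h, B x0 (k - s h))) \<circ> (\<lambda>(h, k). (h, s h + A x0 k)) = id"
      by (auto simp: fun_eq_iff inv S(2))
    have "continuous_on S (\<lambda>x. A x w)" for w
      using A' by (meson continuous_at_imp_continuous_on has_derivative_continuous)
    then have "continuous_on S (\<lambda>x. B x w)" for w
      by (intro continuous_on_inverse_family[where A = A]) (auto simp: lin inv linB)
    then have "continuous_on (S \<times> UNIV) (\<lambda>(x, v). B x v)"
      by (intro continuous_on_linear_family) (auto simp: linB)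
    then have "continuous_on (S \<times> UNIV) G"
      unfolding G_def by (intro continuous_intros) (simp add: case_prod_unfold)
    then show "continuous (at (x0, w)) G"
      using S by (auto simp: continuous_on_eq_continuous_at open_Times)
    show "open (S \<times> (UNIV :: 'c set))" using S by (simp add: open_Times)
    show "(x0, w) \<in> S \<times> UNIV" using S by simp
    show "\<Psi> (G z) = z" if "z \<in> S \<times> UNIV" for z
      using that by (auto simp: G_def \<Psi> inv)
  qed
  from has_derivative_compose[OF has_derivative_Pair[OF has_derivative_ident has_derivative_const] has_derivative_snd[OF this]]
  show ?thesis by (simp add: G_def s_def y0_def)
qed

lemma Ck_on_inverse_family:
  fixes A :: "'a::coordinate_space \<Rightarrow> 'b::coordinate_space \<Rightarrow> 'c::coordinate_space"
  assumes "open S" and lin: "\<And>x. x \<in> S \<Longrightarrow> linear (A x)" and A: "\<And>w. Ck_on n (\<lambda>x. A x w) S"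
    and inv: "\<And>x w. x \<in> S \<Longrightarrow> A x (B x w) = w" "\<And>x w. x \<in> S \<Longrightarrow> B x (A x w) = w"
    and linB: "\<And>x. x \<in> S \<Longrightarrow> linear (B x)"
  shows "Ck_on n (\<lambda>x. B x w) S"
  using A
proof (induction n arbitrary: w)
  case 0
  then show ?case by (auto intro: continuous_on_inverse_family lin inv linB)
next
  case (Suc n)
  define A' where "A' x w = frechet_derivative (\<lambda>x. A x w) (at x)" for x w
  note IH = Suc.IH[OF Ck_on_lower[OF Suc.prems]]
  show ?case
  proof (rule Ck_on_SucI)
    fix x assume x: "x \<in> S"
    show "((\<lambda>x. B x w) has_derivative
        (\<lambda>h. B x (- (\<Sum>u\<in>onb. inner (B x w) u *\<^sub>R A' x u h)))) (at x)"
      by (rule has_derivative_inverse_family[where A = A, OF assms(1) x])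
        (auto simp: lin inv linB A'_def intro: Ck_on_SucD[OF Suc.prems])
  next
    fix h
    have "Ck_on n (\<lambda>x. - (\<Sum>u\<in>onb. inner (B x w) u *\<^sub>R A' x u h)) S"
      unfolding A'_def
      by (intro Ck_on_bounded_linear_image[OF _ bounded_linear_minus[OF bounded_linear_ident]] Ck_on_sum assms(1)
          Ck_on_bilinear[OF _ bounded_bilinear_scaleR] Ck_on_bounded_linear_image[OF _ bounded_linear_inner_left]
          IH Ck_on_SucD[OF Suc.prems])
    then show "Ck_on n (\<lambda>x. B x (- (\<Sum>u\<in>onb. inner (B x w) u *\<^sub>R A' x u h))) S"
      by (rule Ck_on_linear_family[OF assms(1), rotated 2]) (simp_all add: linB IH)
  qed (rule assms(1))
qed

text \<open>
  The simplified Newton map \<open>x \<mapsto> x - A (f x - y)\<close>, where \<open>A\<close> is the inverse of the derivative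
  at \<open>z\<close>, is a contraction near \<open>z\<close>, and its fixed points are the solutions of \<open>f x = y\<close>. This makes
  \<open>f\<close> injective and open there. The derivative of the inverse \<open>g\<close> at \<open>y\<close> is the inverse of the
  derivative of \<open>f\<close> at \<open>g y\<close>, a composite of \<open>g\<close> with a smooth family; hence \<open>g\<close> gains one
  class of differentiability after the other.
\<close>

theorem local_inverse:
  fixes f :: "'a::coordinate_space \<Rightarrow> 'a"
  assumes T: "open T" "z \<in> T" and f: "smooth_on f T" and bij: "bij (frechet_derivative f (at z))"
  obtains S where "open S" "z \<in> S" "S \<subseteq> T" "inj_on f S" "open (f ` S)" "smooth_on (inv_into S f) (f ` S)"
proof -
  define D where "D x = frechet_derivative f (at x)" for x
  have D: "(f has_derivative D x) (at x)" if "x \<in> T" for x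
    unfolding D_def using f that Ck_on_SucD(1) unfolding smooth_on_def by blast
  have CkD: "Ck_on n (\<lambda>x. D x v) T" for n v
    unfolding D_def using f Ck_on_SucD(2) unfolding smooth_on_def by blast
  have linD: "linear (D x)" if "x \<in> T" for x using D[OF that] has_derivative_linear by blast
  define A where "A = inv (D z)"
  have A: "A (D z w) = w" "D z (A w) = w" for w
    using bij unfolding A_def D_def by (simp_all add: bij_is_inj bij_is_surj surj_f_inv_f)
  have linA: "linear A"
    by (rule linear_inverse[OF linD[OF T(2)]]) (simp_all add: A)
  note blA = linear_imp_bounded_linear[OF linA]
  define h where "h x = x - A (f x)" for x
  define h' where "h' x w = w - A (D x w)" for x w
  have h': "(h has_derivative h' x) (at x)" if "x \<in> T" for x
    unfolding h_def h'_def
    by (intro has_derivative_diff has_derivative_ident bounded_linear.has_derivative[OF blA] D that)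
  have linh: "linear (h' x)" if "x \<in> T" for x using h'[OF that] has_derivative_linear by blast
  define \<sigma> where "\<sigma> x = (\<Sum>u\<in>onb. norm (h' x u))" for x
  have "continuous_on T \<sigma>"
    unfolding \<sigma>_def h'_def using CkD[of 0]
    by (intro continuous_intros bounded_linear.continuous_on[OF blA]) simp
  then have "isCont \<sigma> z"
    using T continuous_on_eq_continuous_at by blast
  then have "\<forall>\<^sub>F x in nhds z. \<sigma> x < 1 / 2"
    unfolding isCont_def tendsto_at_iff_tendsto_nhds
    by (rule order_tendstoD(2)) (simp add: \<sigma>_def h'_def A)
  then have "\<forall>\<^sub>F x in nhds z. \<sigma> x < 1 / 2 \<and> x \<in> T"
    using T by (simp add: eventually_conj_iff eventually_nhds_in_open)
  then obtain r where r: "0 < r" "\<And>x. x \<in> ball z r \<Longrightarrow> \<sigma> x < 1 / 2 \<and> x \<in> T"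
    unfolding eventually_nhds_metric by (auto simp: dist_commute)
  define S where "S = ball z r"
  have S: "open S" "z \<in> S" "S \<subseteq> T" "convex S" using r by (auto simp: S_def)
  have h'_bound: "norm (h' x w) \<le> 1 / 2 * norm w" if "x \<in> S" for x w
  proof -
    have "norm (h' x w) \<le> \<sigma> x * norm w"
      using linear_norm_bound[OF linh] that S by (auto simp: \<sigma>_def)
    also have "\<dots> \<le> 1 / 2 * norm w"
      using r(2)[of x] that by (intro mult_right_mono) (auto simp: S_def)
    finally show ?thesis .
  qed
  have h_lip: "dist (h x) (h y) \<le> 1 / 2 * dist x y" if "x \<in> S" "y \<in> S" for x y
    unfolding dist_norm
  proof (rule differentiable_bound[OF S(4) _ _ that])
    show "(h has_derivative h' x) (at x within S)" if "x \<in> S" for x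
      using h' that S has_derivative_at_withinI by blast
    show "onorm (h' x) \<le> 1 / 2" if "x \<in> S" for x
      by (rule onorm_bound) (use h'_bound[OF that] in auto)
  qed
  have inj: "inj_on f S"
  proof (rule inj_onI)
    fix x y assume xy: "x \<in> S" "y \<in> S" "f x = f y"
    then have "h x - h y = x - y" by (simp add: h_def)
    then show "x = y" using h_lip[OF xy(1,2)] by (simp add: dist_norm)
  qed
  have openmap: "open (f ` U)" if U: "open U" "U \<subseteq> S" for U
    unfolding open_dist
  proof clarify
    fix x1 assume x1: "x1 \<in> U"
    then obtain \<rho> where \<rho>: "0 < \<rho>" "cball x1 \<rho> \<subseteq> U" using U open_contains_cball by blast
    obtain K where K: "0 < K" "\<And>v. norm (A v) \<le> norm v * K"
      using bounded_linear.pos_bounded[OF blA] by blast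
    have "y \<in> f ` U" if y: "dist y (f x1) < \<rho> / (2 * K)" for y
    proof -
      have Ay: "norm (A (y - f x1)) \<le> \<rho> / 2"
        using K(2)[of "y - f x1"] y K(1) by (simp add: dist_norm field_simps)
      have "\<exists>!x\<in>cball x1 \<rho>. h x + A y = x"
      proof (rule Banach_fix[where c = "1 / 2"])
        show "complete (cball x1 \<rho>)"
          by (rule complete_closed_subset[OF closed_cball subset_UNIV complete_UNIV_coordinate_space])
        show "cball x1 \<rho> \<noteq> {}" using \<rho> by simp
        show "dist (h x + A y) (h x' + A y) \<le> 1 / 2 * dist x x'" if "x \<in> cball x1 \<rho>" "x' \<in> cball x1 \<rho>" for x x'
        proof -
          have "x \<in> S" "x' \<in> S" using that \<rho> U by blast+
          then show ?thesis using h_lip by (simp add: dist_norm)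
        qed
        show "(\<lambda>x. h x + A y) ` cball x1 \<rho> \<subseteq> cball x1 \<rho>"
        proof clarify
          fix x assume x: "x \<in> cball x1 \<rho>"
          have "h x + A y - x1 = (h x - h x1) + A (y - f x1)"
            by (simp add: h_def linear_diff[OF linA])
          then have "norm (h x + A y - x1) \<le> norm (h x - h x1) + norm (A (y - f x1))"
            by (metis norm_triangle_ineq)
          also have "\<dots> \<le> 1 / 2 * \<rho> + \<rho> / 2"
          proof (rule add_mono[OF _ Ay])
            have "norm (h x - h x1) \<le> 1 / 2 * dist x x1"
            proof -
              have "x \<in> S" "x1 \<in> S" using x x1 \<rho> U by blast+
              then show ?thesis using h_lip by (simp add: dist_norm)
            qed
            then show "norm (h x - h x1) \<le> 1 / 2 * \<rho>" using x by (simp add: dist_commute)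
          qed
          finally show "h x + A y \<in> cball x1 \<rho>" by (simp add: dist_norm norm_minus_commute)
        qed
      qed auto
      then obtain x where x: "x \<in> cball x1 \<rho>" "h x + A y = x" by blast
      then have "A y = A (f x)" by (simp add: h_def algebra_simps)
      then have "y = f x" by (metis A(2))
      then show ?thesis using x \<rho> by blast
    qed
    then show "\<exists>e>0. \<forall>y. dist y (f x1) < e \<longrightarrow> y \<in> f ` U"
      using \<rho>(1) K(1) by (intro exI[of _ "\<rho> / (2 * K)"]) auto
  qed
  define g where "g = inv_into S f"
  have gf: "g (f x) = x" if "x \<in> S" for x using inj that by (simp add: g_def inv_into_f_f)
  have ofS: "open (f ` S)" using openmap S(1) by blast
  have gS: "g y \<in> S" "f (g y) = y" if "y \<in> f ` S" for y
    using that by (auto simp: gf)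
  have contg: "continuous_on (f ` S) g"
    unfolding continuous_on_open_vimage[OF ofS]
  proof (intro allI impI)
    fix U :: "'a set" assume "open U"
    have "g -` U \<inter> f ` S = f ` (U \<inter> S)" by (auto simp: gf)
    then show "open (g -` U \<inter> f ` S)" using openmap[of "U \<inter> S"] \<open>open U\<close> S by auto
  qed
  have injD: "inj (D x)" if "x \<in> S" for x
  proof -
    have lin: "linear (D x)" using linD S that by auto
    have "w = 0" if "D x w = 0" for w
    proof -
      have "h' x w = w" using that by (simp add: h'_def linear_0[OF linA])
      then show ?thesis using h'_bound[OF \<open>x \<in> S\<close>, of w] by simp
    qed
    then show ?thesis using linear_injective_0[OF lin] by simp
  qed
  then have bijD: "bij (D x)" if "x \<in> S" for x
    using linear_injective_imp_surjective linD S that unfolding bij_def by blast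
  define E where "E x = inv (D x)" for x
  have E: "D x (E x w) = w" "E x (D x w) = w" if "x \<in> S" for x w
    using bijD[OF that] unfolding E_def by (simp_all add: bij_is_inj bij_is_surj surj_f_inv_f)
  have linE: "linear (E x)" if "x \<in> S" for x
    by (rule linear_inverse[of "D x"]) (use linD S that in \<open>auto simp: E\<close>)
  have CkE: "Ck_on n (\<lambda>x. E x v) S" for n v
  proof (rule Ck_on_inverse_family[where A = D])
    show "linear (D x)" if "x \<in> S" for x using linD S that by auto
    show "Ck_on n (\<lambda>x. D x w) S" for w using Ck_on_subset[OF CkD S(3)] .
  qed (auto simp: E linE S)
  have "Ck_on n g (f ` S)" for n
  proof (induction n)
    case 0
    then show ?case by (simp add: contg)
  next
    case (Suc n)
    show ?case
    proof (rule Ck_on_SucI[OF ofS])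
      fix y assume y: "y \<in> f ` S"
      show "(g has_derivative E (g y)) (at y)"
      proof (rule has_derivative_inverse_basic)
        show "(f has_derivative D (g y)) (at (g y))" using D gS[OF y] S by auto
        show "bounded_linear (E (g y))" using linE gS[OF y] linear_imp_bounded_linear by blast
        show "E (g y) \<circ> D (g y) = id" using E gS[OF y] by auto
        show "continuous (at y) g" using contg y unfolding continuous_on_eq_continuous_at[OF ofS] by blast
      qed (use ofS y gS in auto)
    next
      fix v
      show "Ck_on n (\<lambda>y. E (g y) v) (f ` S)"
        by (rule Ck_on_compose[OF ofS S(1) CkE Suc]) (use gS in auto)
    qed
  qed
  then have "smooth_on (inv_into S f) (f ` S)" by (simp add: smooth_on_def g_def)
  then show ?thesis using that S inj ofS by blast
qed

section \<open>Maps in charts\<close>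

text \<open>
  All arguments about charts are made at a point, so that the domains of chart expressions need
  not be determined. With \<open>f\<close> the identity this is one half of the compatibility of two charts.
\<close>

definition rep_smooth ::
  "('p, 'e::coordinate_space) chart \<Rightarrow> ('q, 'g::coordinate_space) chart \<Rightarrow> ('p \<Rightarrow> 'q) \<Rightarrow> 'p \<Rightarrow> bool" where
  "rep_smooth c d f x \<longleftrightarrow>
     (\<forall>\<^sub>F z in nhds (coord c x). f (coord_inv c z) \<in> dom_of d) \<and>
     smooth_at (\<lambda>z. coord d (f (coord_inv c z))) (coord c x)"

definition rep_deriv ::
  "('p, 'e::coordinate_space) chart \<Rightarrow> ('q, 'g::coordinate_space) chart \<Rightarrow> ('p \<Rightarrow> 'q) \<Rightarrow> 'p \<Rightarrow> 'e \<Rightarrow> 'g" where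
  "rep_deriv c d f x = frechet_derivative (\<lambda>z. coord d (f (coord_inv c z))) (at (coord c x))"

lemma coord_inv_coord: "is_chart c \<Longrightarrow> x \<in> dom_of c \<Longrightarrow> coord_inv c (coord c x) = x"
  unfolding is_chart_def coord_inv_def by simp

lemma coord_inv_in_dom: "z \<in> coord c ` dom_of c \<Longrightarrow> coord_inv c z \<in> dom_of c"
  unfolding coord_inv_def by (rule inv_into_into)

lemma coord_coord_inv: "z \<in> coord c ` dom_of c \<Longrightarrow> coord c (coord_inv c z) = z"
  unfolding coord_inv_def by (rule f_inv_into_f)

lemma eventually_in_chart:
  "is_chart c \<Longrightarrow> x \<in> dom_of c \<Longrightarrow> \<forall>\<^sub>F z in nhds (coord c x). z \<in> coord c ` dom_of c"
  unfolding is_chart_def by (intro eventually_nhds_in_open) auto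

lemma open_iff_eventually: "open S \<longleftrightarrow> (\<forall>x\<in>S. \<forall>\<^sub>F y in nhds x. y \<in> S)"
  unfolding eventually_nhds by (subst open_subopen) (simp add: subset_eq)

text \<open>
  A property of points near \<open>f x\<close>, stated in the chart \<open>d\<close>, pulls back along \<open>f\<close> by continuity.
\<close>

lemma rep_smooth_eventually:
  assumes "is_chart c" "x \<in> dom_of c" "is_chart d" "rep_smooth c d f x"
    and P: "\<forall>\<^sub>F y in nhds (coord d (f x)). P (coord_inv d y)"
  shows "\<forall>\<^sub>F z in nhds (coord c x). P (f (coord_inv c z))"
proof -
  have "\<forall>\<^sub>F y in nhds (coord d (f (coord_inv c (coord c x)))). P (coord_inv d y)"
    using P assms by (simp add: coord_inv_coord)
  moreover have "smooth_at (\<lambda>z. coord d (f (coord_inv c z))) (coord c x)"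
    using assms(4) by (simp add: rep_smooth_def)
  ultimately have "\<forall>\<^sub>F z in nhds (coord c x). P (coord_inv d (coord d (f (coord_inv c z))))"
    by (rule smooth_at_eventually_compose[where P = "\<lambda>y. P (coord_inv d y)", rotated])
  moreover have "\<forall>\<^sub>F z in nhds (coord c x). f (coord_inv c z) \<in> dom_of d"
    using assms(4) by (simp add: rep_smooth_def)
  ultimately show ?thesis by eventually_elim (simp add: coord_inv_coord assms(3))
qed

lemma
  assumes "is_chart c" "x \<in> dom_of c" "is_chart d" "rep_smooth c d f x" "rep_smooth d e g (f x)"
  shows rep_smooth_compose: "rep_smooth c e (\<lambda>x. g (f x)) x"
    and rep_deriv_compose:
      "rep_deriv c e (\<lambda>x. g (f x)) x v = rep_deriv d e g (f x) (rep_deriv c d f x v)"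
proof -
  define F where "F = (\<lambda>z. coord d (f (coord_inv c z)))"
  define G where "G = (\<lambda>y. coord e (g (coord_inv d y)))"
  have F: "smooth_at F (coord c x)" "F (coord c x) = coord d (f x)"
    using assms by (simp_all add: F_def rep_smooth_def coord_inv_coord)
  have G: "smooth_at G (F (coord c x))"
    using assms by (simp add: G_def rep_smooth_def F(2))
  have dom: "\<forall>\<^sub>F z in nhds (coord c x). f (coord_inv c z) \<in> dom_of d"
    using assms(4) by (simp add: rep_smooth_def)
  then have eq: "\<forall>\<^sub>F z in nhds (coord c x). coord e (g (f (coord_inv c z))) = G (F z)"
    by eventually_elim (simp add: G_def F_def coord_inv_coord assms(3))
  have "\<forall>\<^sub>F z in nhds (coord c x). g (f (coord_inv c z)) \<in> dom_of e"
    using rep_smooth_eventually[OF assms(1-4), of "\<lambda>y. g y \<in> dom_of e"] assms(5)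
    by (simp add: rep_smooth_def)
  moreover have "smooth_at (\<lambda>z. coord e (g (f (coord_inv c z)))) (coord c x)"
    using smooth_at_compose[OF F(1) G] smooth_at_cong[OF eq] by simp
  ultimately show "rep_smooth c e (\<lambda>x. g (f x)) x" by (simp add: rep_smooth_def)
  have "rep_deriv c e (\<lambda>x. g (f x)) x v = frechet_derivative (\<lambda>z. G (F z)) (at (coord c x)) v"
    by (simp add: rep_deriv_def frechet_derivative_cong[OF eq])
  also have "\<dots> = frechet_derivative G (at (coord d (f x))) (frechet_derivative F (at (coord c x)) v)"
    by (simp add: frechet_derivative_compose[OF F(1) G] F(2))
  finally show "rep_deriv c e (\<lambda>x. g (f x)) x v = rep_deriv d e g (f x) (rep_deriv c d f x v)"
    by (simp add: rep_deriv_def F_def G_def)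
qed

lemma linear_rep_deriv: "rep_smooth c d f x \<Longrightarrow> linear (rep_deriv c d f x)"
  unfolding rep_smooth_def rep_deriv_def by (simp add: smooth_at_linear_derivative)

text \<open>The expression of \<open>f\<close> is often known only near \<open>x\<close>, as an explicit function \<open>h\<close>.\<close>

lemma
  assumes "\<forall>\<^sub>F z in nhds (coord c x). f (coord_inv c z) \<in> dom_of d \<and> coord d (f (coord_inv c z)) = h z"
  shows rep_smooth_by_formula: "smooth_at h (coord c x) \<Longrightarrow> rep_smooth c d f x"
    and rep_deriv_by_formula: "rep_deriv c d f x = frechet_derivative h (at (coord c x))"
proof -
  have dom: "\<forall>\<^sub>F z in nhds (coord c x). f (coord_inv c z) \<in> dom_of d"
    and eq: "\<forall>\<^sub>F z in nhds (coord c x). coord d (f (coord_inv c z)) = h z"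
    using assms by (simp_all add: eventually_conj_iff)
  show "smooth_at h (coord c x) \<Longrightarrow> rep_smooth c d f x"
    using dom smooth_at_cong[OF eq] by (simp add: rep_smooth_def)
  show "rep_deriv c d f x = frechet_derivative h (at (coord c x))"
    using frechet_derivative_cong[OF eq] by (simp add: rep_deriv_def)
qed

lemma frechet_derivative_bounded_linear:
  "bounded_linear L \<Longrightarrow> frechet_derivative L (at z) = L"
  by (rule frechet_derivative_at[symmetric]) (rule bounded_linear_imp_has_derivative)

lemma
  assumes "is_chart c" "x \<in> dom_of c"
  shows rep_smooth_id: "rep_smooth c c (\<lambda>x. x) x"
    and rep_deriv_id: "rep_deriv c c (\<lambda>x. x) x v = v"
proof -
  have ev: "\<forall>\<^sub>F z in nhds (coord c x). coord_inv c z \<in> dom_of c \<and> coord c (coord_inv c z) = z"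
    using eventually_in_chart[OF assms]
    by eventually_elim (simp add: coord_inv_in_dom coord_coord_inv)
  show "rep_smooth c c (\<lambda>x. x) x"
    by (rule rep_smooth_by_formula[OF ev smooth_at_ident])
  show "rep_deriv c c (\<lambda>x. x) x v = v"
    using rep_deriv_by_formula[OF ev] frechet_derivative_bounded_linear[OF bounded_linear_ident] by simp
qed

text \<open>
  Openness of the coordinate images of an overlap is the same as the condition, at each of its
  points, that nearby coordinates stay in the overlap.
\<close>

lemma compatible_iff:
  assumes "is_chart c" "is_chart d"
  shows "compatible c d \<longleftrightarrow>
    (\<forall>x\<in>dom_of c \<inter> dom_of d. rep_smooth c d (\<lambda>x. x) x \<and> rep_smooth d c (\<lambda>x. x) x)"
proof -
  let ?O = "\<lambda>c d. coord c ` (dom_of c \<inter> dom_of d)"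
  have 1: "rep_smooth c d (\<lambda>x. x) x"
    if c: "is_chart c" "open (?O c d)" "smooth_on (\<lambda>x. coord d (coord_inv c x)) (?O c d)"
      and x: "x \<in> dom_of c \<inter> dom_of d" for c d :: "('a, 'b) chart" and x
  proof -
    have "\<forall>\<^sub>F z in nhds (coord c x). z \<in> ?O c d"
      by (rule eventually_nhds_in_open[OF c(2)]) (use x in blast)
    then have "\<forall>\<^sub>F z in nhds (coord c x). coord_inv c z \<in> dom_of d"
    proof eventually_elim
      case (elim z)
      then obtain y where "z = coord c y" "y \<in> dom_of c" "y \<in> dom_of d" by blast
      then show ?case by (simp add: coord_inv_coord c(1))
    qed
    moreover have "smooth_at (\<lambda>x. coord d (coord_inv c x)) (coord c x)"
      by (rule smooth_on_smooth_at[OF c(3,2)]) (use x in blast)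
    ultimately show ?thesis by (simp add: rep_smooth_def)
  qed
  have 2: "open (?O c d) \<and> smooth_on (\<lambda>x. coord d (coord_inv c x)) (?O c d)"
    if c: "is_chart c" and s: "\<And>x. x \<in> dom_of c \<inter> dom_of d \<Longrightarrow> rep_smooth c d (\<lambda>x. x) x"
    for c d :: "('a, 'b) chart"
  proof
    show "open (?O c d)"
      unfolding open_iff_eventually
    proof clarify
      fix x assume x: "x \<in> dom_of c" "x \<in> dom_of d"
      then have "\<forall>\<^sub>F z in nhds (coord c x). coord_inv c z \<in> dom_of d"
        using s by (simp add: rep_smooth_def)
      with eventually_in_chart[OF c x(1)] show "\<forall>\<^sub>F z in nhds (coord c x). z \<in> ?O c d"
      proof eventually_elim
        case (elim z)
        then have "coord_inv c z \<in> dom_of c \<inter> dom_of d" "z = coord c (coord_inv c z)"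
          by (auto simp: coord_inv_in_dom coord_coord_inv)
        then show ?case by blast
      qed
    qed
    show "smooth_on (\<lambda>x. coord d (coord_inv c x)) (?O c d)"
      by (rule smooth_on_smooth_atI) (use s in \<open>auto simp: rep_smooth_def\<close>)
  qed
  have sym: "?O d c = coord d ` (dom_of c \<inter> dom_of d)" by (simp add: Int_commute)
  show ?thesis
  proof
    assume "compatible c d"
    then show "\<forall>x\<in>dom_of c \<inter> dom_of d. rep_smooth c d (\<lambda>x. x) x \<and> rep_smooth d c (\<lambda>x. x) x"
      using 1[of c d] 1[of d c] assms unfolding compatible_def sym by auto
  next
    assume "\<forall>x\<in>dom_of c \<inter> dom_of d. rep_smooth c d (\<lambda>x. x) x \<and> rep_smooth d c (\<lambda>x. x) x"
    then show "compatible c d"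
      using 2[of c d] 2[of d c] assms unfolding compatible_def sym by auto
  qed
qed

lemma charts_is_chart: "c \<in> charts M \<Longrightarrow> is_chart c"
  unfolding charts_def by simp

lemma charts_dom: "c \<in> charts M \<Longrightarrow> dom_of c \<subseteq> points M"
  unfolding charts_def by simp

lemma charts_atD:
  assumes "c \<in> charts_at M x"
  shows "c \<in> charts M" "is_chart c" "x \<in> dom_of c" "x \<in> points M"
  using assms unfolding charts_at_def charts_def by auto

lemma charts_atI: "c \<in> charts M \<Longrightarrow> x \<in> dom_of c \<Longrightarrow> c \<in> charts_at M x"
  unfolding charts_at_def by simp

lemma atlas_subset_charts: "smooth_atlas M \<Longrightarrow> M \<subseteq> charts M"
  unfolding smooth_atlas_def charts_def points_def by auto

lemma ex_atlas_chart:
  assumes "smooth_atlas M" "x \<in> points M"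
  obtains c where "c \<in> M" "c \<in> charts_at M x"
proof -
  obtain c where c: "c \<in> M" "x \<in> dom_of c" using assms(2) unfolding points_def by blast
  then have "c \<in> charts_at M x" using atlas_subset_charts[OF assms(1)] by (auto intro: charts_atI)
  with c(1) show thesis by (rule that)
qed

lemma charts_rep_smooth:
  assumes M: "smooth_atlas M" and c: "c \<in> charts_at M x" and d: "d \<in> charts_at M x"
  shows "rep_smooth c d (\<lambda>x. x) x"
proof -
  obtain e where e: "e \<in> M" "e \<in> charts_at M x" using ex_atlas_chart[OF M] charts_atD(4)[OF c] .
  note D = charts_atD[OF c] charts_atD[OF d] charts_atD[OF e(2)]
  have "compatible c e" "compatible d e" using D(1,5) e(1) unfolding charts_def by auto
  then have "rep_smooth c e (\<lambda>x. x) x" "rep_smooth e d (\<lambda>x. x) x"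
    using D by (auto simp: compatible_iff)
  then show ?thesis by (rule rep_smooth_compose[OF D(2,3,10)])
qed

text \<open>
  One compatible chart around each point suffices: every chart of the atlas is compatible with it.
\<close>

lemma chartsI:
  assumes M: "smooth_atlas M" and d: "is_chart d"
    and c: "\<And>x. x \<in> dom_of d \<Longrightarrow> \<exists>c\<in>charts_at M x. rep_smooth c d (\<lambda>x. x) x \<and> rep_smooth d c (\<lambda>x. x) x"
  shows "d \<in> charts M"
proof -
  have "dom_of d \<subseteq> points M"
  proof
    fix x assume "x \<in> dom_of d"
    then obtain c where "c \<in> charts_at M x" using c by blast
    then show "x \<in> points M" by (rule charts_atD)
  qed
  moreover have "compatible d e" if e: "e \<in> M" for e
  proof -
    have e': "e \<in> charts M" using e atlas_subset_charts[OF M] by blast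
    have "rep_smooth d e (\<lambda>x. x) x \<and> rep_smooth e d (\<lambda>x. x) x" if x: "x \<in> dom_of d" "x \<in> dom_of e" for x
    proof -
      obtain c where c: "c \<in> charts_at M x" "rep_smooth c d (\<lambda>x. x) x" "rep_smooth d c (\<lambda>x. x) x"
        using c[OF x(1)] by blast
      have ex: "e \<in> charts_at M x" using e' x by (simp add: charts_at_def)
      show ?thesis
        using rep_smooth_compose[OF d x(1) charts_atD(2)[OF c(1)] c(3) charts_rep_smooth[OF M c(1) ex]]
          rep_smooth_compose[OF charts_is_chart[OF e'] x(2) charts_atD(2)[OF c(1)] charts_rep_smooth[OF M ex c(1)] c(2)]
        by simp
    qed
    then show ?thesis using charts_is_chart[OF e'] d by (simp add: compatible_iff)
  qed
  ultimately show ?thesis using d unfolding charts_def by simp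
qed

text \<open>
  By \<open>smooth_pt_rep\<close> below, the quantifiers over charts may be read as universal ones.
\<close>

definition smooth_pt ::
  "('p, 'e::coordinate_space) manifold \<Rightarrow> ('q, 'g::coordinate_space) manifold \<Rightarrow> ('p \<Rightarrow> 'q) \<Rightarrow> 'p \<Rightarrow> bool" where
  "smooth_pt M N f x \<longleftrightarrow> (\<exists>c\<in>charts_at M x. \<exists>d\<in>charts_at N (f x). rep_smooth c d f x)"

lemma smooth_ptI:
  "c \<in> charts_at M x \<Longrightarrow> d \<in> charts_at N (f x) \<Longrightarrow> rep_smooth c d f x \<Longrightarrow> smooth_pt M N f x"
  unfolding smooth_pt_def by blast

lemma smooth_pt_rep:
  assumes "smooth_atlas M" "smooth_atlas N" "smooth_pt M N f x"
    and c: "c \<in> charts_at M x" and d: "d \<in> charts_at N (f x)"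
  shows "rep_smooth c d f x"
proof -
  obtain c' d' where c': "c' \<in> charts_at M x" and d': "d' \<in> charts_at N (f x)" and f: "rep_smooth c' d' f x"
    using assms(3) unfolding smooth_pt_def by blast
  note 1 = charts_rep_smooth[OF assms(1) c c'] charts_rep_smooth[OF assms(2) d' d]
  have "rep_smooth c d' f x"
    using rep_smooth_compose[OF charts_atD(2,3)[OF c] charts_atD(2)[OF c'] 1(1) f] .
  from rep_smooth_compose[OF charts_atD(2,3)[OF c] charts_atD(2)[OF d'] this 1(2)]
  show ?thesis .
qed

lemma smooth_map_on_pt:
  assumes "smooth_map_on M W N f" "x \<in> W"
  shows "smooth_pt M N f x"
proof -
  obtain c d where c: "c \<in> charts_at M x" and d: "d \<in> charts N"
    and f: "f ` dom_of c \<subseteq> dom_of d" "smooth_on (\<lambda>z. coord d (f (coord_inv c z))) (coord c ` dom_of c)"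
    using bspec[OF assms(1)[unfolded smooth_map_on_def] assms(2)] by (elim bexE conjE)
  note C = charts_atD[OF c]
  have "\<forall>\<^sub>F z in nhds (coord c x). f (coord_inv c z) \<in> dom_of d"
    using eventually_in_chart[OF C(2,3)] 
  proof eventually_elim
    case (elim z)
    then show ?case using f(1) coord_inv_in_dom[OF elim] by (simp add: image_subset_iff)
  qed
  moreover have "smooth_at (\<lambda>z. coord d (f (coord_inv c z))) (coord c x)"
    by (rule smooth_on_smooth_at[OF f(2)]) (use C in \<open>auto simp: is_chart_def\<close>)
  ultimately have "rep_smooth c d f x" by (simp add: rep_smooth_def)
  moreover have "d \<in> charts_at N (f x)" using d f(1) C(3) by (auto simp: charts_at_def)
  ultimately show ?thesis using smooth_ptI[of c M x d N f] c by simp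
qed

lemma smooth_pt_compose:
  assumes "smooth_atlas N" "smooth_pt M N f x" "smooth_pt N P g (f x)"
  shows "smooth_pt M P (\<lambda>x. g (f x)) x"
proof -
  obtain c d where c: "c \<in> charts_at M x" and d: "d \<in> charts_at N (f x)" and f: "rep_smooth c d f x"
    using assms(2) unfolding smooth_pt_def by blast
  obtain d' e where d': "d' \<in> charts_at N (f x)" and e: "e \<in> charts_at P (g (f x))" and g: "rep_smooth d' e g (f x)"
    using assms(3) unfolding smooth_pt_def by blast
  have "rep_smooth d e g (f x)"
    using rep_smooth_compose[OF charts_atD(2,3)[OF d] charts_atD(2)[OF d'] charts_rep_smooth[OF assms(1) d d'] g] .
  then have "rep_smooth c e (\<lambda>x. g (f x)) x"
    by (rule rep_smooth_compose[OF charts_atD(2,3)[OF c] charts_atD(2)[OF d] f])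
  then show ?thesis using smooth_ptI[of c M x e P "\<lambda>x. g (f x)"] c e by simp
qed

section \<open>Tangent vectors and tangent maps in charts\<close>

lemma tangent_space_iff:
  "v \<in> tangent_space M x \<longleftrightarrow> fst v = x \<and>
     (\<forall>c\<in>charts_at M x. \<forall>d\<in>charts_at M x. comp v d = rep_deriv c d (\<lambda>x. x) x (comp v c)) \<and>
     (\<forall>c. c \<notin> charts_at M x \<longrightarrow> comp v c = 0)"
  unfolding tangent_space_def rep_deriv_def by (cases v) auto

lemma tangent_space_fst: "v \<in> tangent_space M x \<Longrightarrow> fst v = x"
  unfolding tangent_space_iff by (rule conjunct1)

lemma tangent_comp_change:
  assumes "v \<in> tangent_space M x" "c \<in> charts_at M x" "d \<in> charts_at M x"
  shows "comp v d = rep_deriv c d (\<lambda>x. x) x (comp v c)"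
  using bspec[OF bspec[OF conjunct1[OF conjunct2[OF assms(1)[unfolded tangent_space_iff]]] assms(2)] assms(3)] .

lemma tangent_comp_outside:
  assumes "v \<in> tangent_space M x" "c \<notin> charts_at M x"
  shows "comp v c = 0"
  using conjunct2[OF conjunct2[OF assms(1)[unfolded tangent_space_iff]]] assms(2) by blast

lemma tangent_eqI:
  assumes u: "u \<in> tangent_space M x" and v: "v \<in> tangent_space M x"
    and c: "c \<in> charts_at M x" and eq: "comp u c = comp v c"
  shows "u = v"
proof (rule prod_eqI)
  show "fst u = fst v" using u v by (simp add: tangent_space_fst)
  show "comp u = comp v"
  proof
    fix d show "comp u d = comp v d"
    proof (cases "d \<in> charts_at M x")
      case True
      then show ?thesis using tangent_comp_change[OF u c] tangent_comp_change[OF v c] eq by simp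
    next
      case False
      then show ?thesis using u v by (simp add: tangent_comp_outside)
    qed
  qed
qed

lemma fst_tangent_of_comp [simp]: "fst (tangent_of_comp M x c w) = x"
  by (simp add: tangent_of_comp_def)

lemma comp_tangent_of_comp_change:
  "d \<in> charts_at M x \<Longrightarrow> comp (tangent_of_comp M x c w) d = rep_deriv c d (\<lambda>x. x) x w"
  by (simp add: tangent_of_comp_def rep_deriv_def)

lemma comp_tangent_of_comp:
  "c \<in> charts_at M x \<Longrightarrow> comp (tangent_of_comp M x c w) c = w"
  by (simp add: comp_tangent_of_comp_change rep_deriv_id charts_atD)

lemma tangent_of_comp_in:
  assumes M: "smooth_atlas M" and c: "c \<in> charts_at M x"
  shows "tangent_of_comp M x c w \<in> tangent_space M x"
  unfolding tangent_space_iff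
proof (intro conjI ballI allI impI)
  fix d e assume d: "d \<in> charts_at M x" and e: "e \<in> charts_at M x"
  show "comp (tangent_of_comp M x c w) e =
      rep_deriv d e (\<lambda>x. x) x (comp (tangent_of_comp M x c w) d)"
    using rep_deriv_compose[OF charts_atD(2,3)[OF c] charts_atD(2)[OF d]
      charts_rep_smooth[OF M c d] charts_rep_smooth[OF M d e]]
    by (simp add: comp_tangent_of_comp_change d e)
qed (simp_all add: tangent_of_comp_def)

lemma tangent_of_comp_comp:
  assumes "smooth_atlas M" "c \<in> charts_at M x" "v \<in> tangent_space M x"
  shows "tangent_of_comp M x c (comp v c) = v"
  by (rule tangent_eqI[OF tangent_of_comp_in[OF assms(1,2)] assms(3,2)])
    (simp add: comp_tangent_of_comp assms(2))

lemma zero_in_tangent_space: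
  assumes "smooth_atlas M"
  shows "(x, \<lambda>_. 0) \<in> tangent_space M x"
  using linear_0[OF linear_rep_deriv[OF charts_rep_smooth[OF assms]]]
  by (auto simp: tangent_space_iff)

text \<open>
  By the chain rule the chart chosen in the definition of the tangent map is irrelevant.
\<close>

context
  fixes M :: "('p, 'e::coordinate_space) manifold" and N :: "('q, 'g::coordinate_space) manifold"
    and f :: "'p \<Rightarrow> 'q" and x :: 'p and v :: "('p, 'e) tvec"
  assumes M: "smooth_atlas M" and N: "smooth_atlas N" and f: "smooth_pt M N f x"
    and v: "v \<in> tangent_space M x"
begin

lemma comp_tangent_map:
  assumes c: "c \<in> charts_at M x" and d: "d \<in> charts_at N (f x)"
  shows "comp (tangent_map M N f v) d = rep_deriv c d f x (comp v c)"
proof -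
  define c' where "c' = (SOME c. c \<in> charts_at M x)"
  have c': "c' \<in> charts_at M x" unfolding c'_def by (rule someI[of "\<lambda>c. c \<in> charts_at M x", OF c])
  have "comp (tangent_map M N f v) d = rep_deriv c' d f x (comp v c')"
    using tangent_space_fst[OF v] d by (simp add: tangent_map_def rep_deriv_def c'_def Let_def)
  also have "\<dots> = rep_deriv c' d f x (rep_deriv c c' (\<lambda>x. x) x (comp v c))"
    using tangent_comp_change[OF v c c'] by simp
  also have "\<dots> = rep_deriv c d f x (comp v c)"
    using rep_deriv_compose[OF charts_atD(2,3)[OF c] charts_atD(2)[OF c']
      charts_rep_smooth[OF M c c'] smooth_pt_rep[OF M N f c' d]] by simp
  finally show ?thesis .
qed

lemma tangent_map_in: "tangent_map M N f v \<in> tangent_space N (f x)"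
  unfolding tangent_space_iff
proof (intro conjI ballI allI impI)
  show "fst (tangent_map M N f v) = f x"
    using tangent_space_fst[OF v] by (simp add: tangent_map_def Let_def)
  show "comp (tangent_map M N f v) d = 0" if "d \<notin> charts_at N (f x)" for d
    using tangent_space_fst[OF v] that by (simp add: tangent_map_def Let_def)
  fix d d' assume d: "d \<in> charts_at N (f x)" "d' \<in> charts_at N (f x)"
  obtain c where c: "c \<in> charts_at M x" using f unfolding smooth_pt_def by blast
  show "comp (tangent_map M N f v) d' = rep_deriv d d' (\<lambda>x. x) (f x) (comp (tangent_map M N f v) d)"
    using rep_deriv_compose[OF charts_atD(2,3)[OF c] charts_atD(2)[OF d(1)]
      smooth_pt_rep[OF M N f c d(1)] charts_rep_smooth[OF N d]]
    by (simp add: comp_tangent_map[OF c] d)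
qed

end

lemma tangent_of_comp_add:
  assumes "smooth_atlas M" "c \<in> charts_at M x"
  shows "tangent_of_comp M x c (w + w') =
    tangent_add (tangent_of_comp M x c w) (tangent_of_comp M x c w')"
  using linear_add[OF linear_rep_deriv[OF charts_rep_smooth[OF assms]]]
  by (auto simp: tangent_add_def tangent_of_comp_def rep_deriv_def fun_eq_iff)

lemma tangent_of_comp_scale:
  assumes "smooth_atlas M" "c \<in> charts_at M x"
  shows "tangent_of_comp M x c (a *\<^sub>R w) = tangent_scale a (tangent_of_comp M x c w)"
  using linear_scale[OF linear_rep_deriv[OF charts_rep_smooth[OF assms]]]
  by (auto simp: tangent_scale_def tangent_of_comp_def rep_deriv_def fun_eq_iff)

section \<open>Atlases of tangent bundles and of fibre products\<close>

lemma eventually_nhds_fst: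
  fixes p :: "'a::real_normed_vector \<times> 'b::real_normed_vector"
  shows "\<forall>\<^sub>F z in nhds (fst p). P z \<Longrightarrow> \<forall>\<^sub>F q in nhds p. P (fst q)"
  using smooth_at_eventually_compose[OF smooth_at_bounded_linear[OF bounded_linear_fst], of P p] by blast

definition tangent_chart :: "('p, 'e::coordinate_space) manifold \<Rightarrow> ('p, 'e) chart \<Rightarrow> (('p, 'e) tvec, 'e \<times> 'e) chart" where
  "tangent_chart M c =
     ({v. fst v \<in> dom_of c \<and> v \<in> tangent_space M (fst v)}, \<lambda>v. (coord c (fst v), comp v c))"

lemma tangent_bundle_eq: "tangent_bundle M = tangent_chart M ` charts M"
proof -
  have "tangent_bundle M = {tangent_chart M c | c. c \<in> charts M}"
    unfolding tangent_bundle_def tangent_chart_def ..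
  then show ?thesis by (simp only: Setcompr_eq_image)
qed

lemma dom_tangent_chart: "v \<in> dom_of (tangent_chart M c) \<longleftrightarrow> fst v \<in> dom_of c \<and> v \<in> tangent_space M (fst v)"
  by (simp add: tangent_chart_def)

lemma coord_tangent_chart: "coord (tangent_chart M c) v = (coord c (fst v), comp v c)"
  by (simp add: tangent_chart_def)

context
  fixes M :: "('p, 'e::coordinate_space) manifold"
  assumes M: "smooth_atlas M"
begin

lemma image_tangent_chart:
  assumes c: "c \<in> charts M"
  shows "coord (tangent_chart M c) ` dom_of (tangent_chart M c) = coord c ` dom_of c \<times> UNIV"
proof (intro equalityI subsetI)
  fix p assume "p \<in> coord c ` dom_of c \<times> (UNIV :: 'e set)"
  then obtain x where x: "x \<in> dom_of c" "fst p = coord c x" by auto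
  have cx: "c \<in> charts_at M x" using c x by (simp add: charts_atI)
  have "tangent_of_comp M x c (snd p) \<in> dom_of (tangent_chart M c)"
    by (simp add: dom_tangent_chart x tangent_of_comp_in[OF M cx])
  moreover have "coord (tangent_chart M c) (tangent_of_comp M x c (snd p)) = p"
    using x by (simp add: coord_tangent_chart comp_tangent_of_comp[OF cx] prod_eq_iff)
  ultimately show "p \<in> coord (tangent_chart M c) ` dom_of (tangent_chart M c)" by (metis image_eqI)
qed (auto simp: dom_tangent_chart coord_tangent_chart)

lemma is_chart_tangent_chart:
  assumes c: "c \<in> charts M"
  shows "is_chart (tangent_chart M c)"
  unfolding is_chart_def
proof
  show "inj_on (coord (tangent_chart M c)) (dom_of (tangent_chart M c))"
  proof (rule inj_onI)
    fix v w assume v: "v \<in> dom_of (tangent_chart M c)" and w: "w \<in> dom_of (tangent_chart M c)"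
      and eq: "coord (tangent_chart M c) v = coord (tangent_chart M c) w"
    have x: "fst v \<in> dom_of c" "fst w \<in> dom_of c" using v w by (simp_all add: dom_tangent_chart)
    have "fst v = fst w"
      using eq x coord_inv_coord[OF charts_is_chart[OF c]] by (metis coord_tangent_chart fst_conv)
    then show "v = w"
      using v w eq charts_atI[OF c x(1)]
      by (intro tangent_eqI[of v M "fst v" w c]) (simp_all add: dom_tangent_chart coord_tangent_chart)
  qed
  show "open (coord (tangent_chart M c) ` dom_of (tangent_chart M c))"
    unfolding image_tangent_chart[OF c] using charts_is_chart[OF c]
    by (simp add: is_chart_def open_Times)
qed

lemma coord_inv_tangent_chart:
  assumes c: "c \<in> charts M" and z: "fst p \<in> coord c ` dom_of c"
  shows "coord_inv (tangent_chart M c) p = tangent_of_comp M (coord_inv c (fst p)) c (snd p)"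
proof -
  let ?x = "coord_inv c (fst p)"
  have x: "?x \<in> dom_of c" "coord c ?x = fst p"
    using coord_inv_in_dom[OF z] coord_coord_inv[OF z] by simp_all
  have cx: "c \<in> charts_at M ?x" by (rule charts_atI[OF c x(1)])
  have "tangent_of_comp M ?x c (snd p) \<in> dom_of (tangent_chart M c)"
    by (simp add: dom_tangent_chart x tangent_of_comp_in[OF M cx])
  moreover have "coord (tangent_chart M c) (tangent_of_comp M ?x c (snd p)) = p"
    by (simp add: coord_tangent_chart x comp_tangent_of_comp[OF cx])
  ultimately show ?thesis using coord_inv_coord[OF is_chart_tangent_chart[OF c]] by metis
qed

text \<open>
  The change of coordinates is \<open>(z, w) \<mapsto> (\<phi> z, D\<phi>(z) w)\<close> with \<open>\<phi>\<close> the transition map of \<open>c\<close> and \<open>d\<close>.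
\<close>

lemma tangent_charts_rep_smooth:
  assumes c: "c \<in> charts M" and d: "d \<in> charts M"
    and v: "v \<in> dom_of (tangent_chart M c)" "v \<in> dom_of (tangent_chart M d)"
  shows "rep_smooth (tangent_chart M c) (tangent_chart M d) (\<lambda>v. v) v"
proof -
  let ?x = "fst v" and ?p = "coord (tangent_chart M c) v"
  let ?\<phi> = "\<lambda>z. coord d (coord_inv c z)"
  have x: "c \<in> charts_at M ?x" "d \<in> charts_at M ?x"
    using v c d by (simp_all add: dom_tangent_chart charts_atI)
  have \<phi>: "rep_smooth c d (\<lambda>x. x) ?x" by (rule charts_rep_smooth[OF M x])
  have fst_p: "fst ?p = coord c ?x" by (simp add: coord_tangent_chart)
  have sm: "smooth_at ?\<phi> (fst ?p)" using \<phi> by (simp add: rep_smooth_def fst_p)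
  have "\<forall>\<^sub>F z in nhds (fst ?p). z \<in> coord c ` dom_of c"
    unfolding fst_p by (rule eventually_in_chart[OF charts_atD(2,3)[OF x(1)]])
  moreover have "\<forall>\<^sub>F z in nhds (fst ?p). coord_inv c z \<in> dom_of d"
    using \<phi> unfolding fst_p rep_smooth_def by (rule conjunct1)
  ultimately have "\<forall>\<^sub>F z in nhds (fst ?p). z \<in> coord c ` dom_of c \<and> coord_inv c z \<in> dom_of d"
    by (rule eventually_conj)
  then have "\<forall>\<^sub>F q in nhds ?p. fst q \<in> coord c ` dom_of c \<and> coord_inv c (fst q) \<in> dom_of d"
    by (rule eventually_nhds_fst)
  then have "\<forall>\<^sub>F q in nhds ?p. coord_inv (tangent_chart M c) q \<in> dom_of (tangent_chart M d) \<and>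
      coord (tangent_chart M d) (coord_inv (tangent_chart M c) q) =
        (?\<phi> (fst q), frechet_derivative ?\<phi> (at (fst q)) (snd q))"
  proof eventually_elim
    case (elim q)
    let ?y = "coord_inv c (fst q)"
    have y: "?y \<in> dom_of c" "coord c ?y = fst q"
      using elim by (simp_all add: coord_inv_in_dom coord_coord_inv)
    have cy: "c \<in> charts_at M ?y" "d \<in> charts_at M ?y" using c d y elim by (simp_all add: charts_atI)
    show ?case
      using elim tangent_of_comp_in[OF M cy(1)]
      by (simp add: coord_inv_tangent_chart[OF c] dom_tangent_chart coord_tangent_chart
        comp_tangent_of_comp_change[OF cy(2)] rep_deriv_def y(2))
  qed
  then show ?thesis
  proof (rule rep_smooth_by_formula)
    have s: "smooth_at fst ?p" by (rule smooth_at_bounded_linear[OF bounded_linear_fst])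
    have "\<forall>\<^sub>F q in nhds ?p. smooth_at ?\<phi> (fst q)"
      by (rule eventually_nhds_fst[OF smooth_at_eventually[OF sm]])
    then have lin: "\<forall>\<^sub>F q in nhds ?p. linear (frechet_derivative ?\<phi> (at (fst q)))"
      by eventually_elim (rule smooth_at_linear_derivative)
    have "smooth_at (\<lambda>q. frechet_derivative ?\<phi> (at (fst q)) (snd q)) ?p"
      by (rule smooth_at_linear_family[OF lin smooth_at_compose[OF s smooth_at_derivative[OF sm]]
          smooth_at_bounded_linear[OF bounded_linear_snd]])
    then show "smooth_at (\<lambda>q. (?\<phi> (fst q), frechet_derivative ?\<phi> (at (fst q)) (snd q))) ?p"
      by (rule smooth_at_Pair[OF smooth_at_compose[OF s sm]])
  qed
qed

lemma smooth_atlas_tangent_bundle: "smooth_atlas (tangent_bundle M)"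
  unfolding smooth_atlas_def tangent_bundle_eq
  by (auto simp: is_chart_tangent_chart compatible_iff tangent_charts_rep_smooth
      simp del: split_paired_All split_paired_Ex)

lemma tangent_chart_in_charts: "c \<in> charts M \<Longrightarrow> tangent_chart M c \<in> charts (tangent_bundle M)"
  using atlas_subset_charts[OF smooth_atlas_tangent_bundle] unfolding tangent_bundle_eq by blast

lemma fibred_chart_tangent_bundle:
  "c \<in> charts M \<Longrightarrow> (c, tangent_chart M c) \<in> fibred_charts (tangent_bundle M) fst M"
  unfolding fibred_charts_def
  by (simp add: tangent_chart_in_charts dom_tangent_chart coord_tangent_chart)

end

lemma fibred_chartsD:
  assumes "(c, d) \<in> fibred_charts E p M"
  shows "c \<in> charts M" "d \<in> charts E"
    and "\<And>e. e \<in> dom_of d \<Longrightarrow> p e \<in> dom_of c"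
    and "\<And>e. e \<in> dom_of d \<Longrightarrow> fst (coord d e) = coord c (p e)"
  using assms unfolding fibred_charts_def by auto

lemma
  assumes cd: "(c, d) \<in> fibred_charts E p M" and e: "e \<in> dom_of d"
  shows fibred_chart_rep_smooth: "rep_smooth d c p e"
    and fibred_chart_rep_deriv: "rep_deriv d c p e w = fst w"
proof -
  note D = fibred_chartsD[OF cd]
  have ev: "\<forall>\<^sub>F z in nhds (coord d e). p (coord_inv d z) \<in> dom_of c \<and> coord c (p (coord_inv d z)) = fst z"
    using eventually_in_chart[OF charts_is_chart[OF D(2)] e]
  proof eventually_elim
    case (elim z)
    show ?case using D(3)[OF coord_inv_in_dom[OF elim]] D(4)[OF coord_inv_in_dom[OF elim]]
      by (simp add: coord_coord_inv[OF elim])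
  qed
  show "rep_smooth d c p e"
    by (rule rep_smooth_by_formula[OF ev smooth_at_bounded_linear[OF bounded_linear_fst]])
  show "rep_deriv d c p e w = fst w"
    by (simp add: rep_deriv_by_formula[OF ev] frechet_derivative_bounded_linear[OF bounded_linear_fst])
qed

definition product_chart ::
  "('n \<Rightarrow> 'b) \<Rightarrow> ('f \<Rightarrow> 'b) \<Rightarrow> ('n, 'u) chart \<Rightarrow> ('f, 'x \<times> 'y) chart \<Rightarrow> ('n \<times> 'f, 'u \<times> 'y) chart" where
  "product_chart g p a d =
     ({(n, e). n \<in> dom_of a \<and> e \<in> dom_of d \<and> g n = p e}, \<lambda>(n, e). (coord a n, snd (coord d e)))"

lemma dom_product_chart:
  "q \<in> dom_of (product_chart g p a d) \<longleftrightarrow> fst q \<in> dom_of a \<and> snd q \<in> dom_of d \<and> g (fst q) = p (snd q)"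
  by (auto simp: product_chart_def)

lemma coord_product_chart: "coord (product_chart g p a d) q = (coord a (fst q), snd (coord d (snd q)))"
  by (simp add: product_chart_def case_prod_unfold)

lemma fibre_product_eq:
  "fibre_product N g M E p = {product_chart g p a d | a c d. a \<in> charts N \<and> (c, d) \<in> fibred_charts E p M}"
  unfolding fibre_product_def product_chart_def ..

text \<open>
  The universal property of the fibre product: a map into it is smooth if its two components are.
\<close>

lemma rep_smooth_into_product_chart:
  assumes "rep_smooth b a (\<lambda>x. fst (h x)) x" "rep_smooth b d (\<lambda>x. snd (h x)) x"
    and "\<forall>\<^sub>F z in nhds (coord b x). g (fst (h (coord_inv b z))) = p (snd (h (coord_inv b z)))"
  shows "rep_smooth b (product_chart g p a d) h x"
  unfolding rep_smooth_def
proof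
  have "\<forall>\<^sub>F z in nhds (coord b x). fst (h (coord_inv b z)) \<in> dom_of a"
    "\<forall>\<^sub>F z in nhds (coord b x). snd (h (coord_inv b z)) \<in> dom_of d"
    using assms(1,2) by (simp_all add: rep_smooth_def)
  with assms(3) show "\<forall>\<^sub>F z in nhds (coord b x). h (coord_inv b z) \<in> dom_of (product_chart g p a d)"
    by eventually_elim (simp add: dom_product_chart)
  show "smooth_at (\<lambda>z. coord (product_chart g p a d) (h (coord_inv b z))) (coord b x)"
    unfolding coord_product_chart
    by (intro smooth_at_Pair smooth_at_snd) (use assms(1,2) in \<open>simp_all add: rep_smooth_def\<close>)
qed

context
  fixes N :: "('n, 'u::coordinate_space) manifold" and g :: "'n \<Rightarrow> 'b"
    and M :: "('b, 'x::coordinate_space) manifold"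
    and E :: "('f, 'x \<times> 'y::coordinate_space) manifold" and p :: "'f \<Rightarrow> 'b"
  assumes N: "smooth_atlas N" and M: "smooth_atlas M" and E: "smooth_atlas E"
    and g: "\<forall>n\<in>points N. smooth_pt N M g n"
begin

context
  fixes a c d
  assumes a: "a \<in> charts N" and cd: "(c, d) \<in> fibred_charts E p M"
begin

abbreviation (input) "pchart \<equiv> product_chart g p a d"

lemma inj_on_product_chart: "inj_on (coord pchart) (dom_of pchart)"
proof (rule inj_onI)
  note D = fibred_chartsD[OF cd]
  fix q r assume q: "q \<in> dom_of pchart" and r: "r \<in> dom_of pchart"
    and eq: "coord pchart q = coord pchart r"
  have q': "fst q \<in> dom_of a" "snd q \<in> dom_of d" "g (fst q) = p (snd q)"
    and r': "fst r \<in> dom_of a" "snd r \<in> dom_of d" "g (fst r) = p (snd r)"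
    using q r by (simp_all add: dom_product_chart)
  have "coord a (fst q) = coord a (fst r)" using eq by (simp add: coord_product_chart)
  then have 1: "fst q = fst r" using q' r' coord_inv_coord[OF charts_is_chart[OF a]] by metis
  have "fst (coord d (snd q)) = fst (coord d (snd r))" using D(4) q' r' 1 by metis
  then have "coord d (snd q) = coord d (snd r)" using eq by (simp add: coord_product_chart prod_eq_iff)
  then have "snd q = snd r" using q' r' coord_inv_coord[OF charts_is_chart[OF D(2)]] by metis
  with 1 show "q = r" by (rule prod_eqI)
qed

text \<open>
  The inverse of the chart is \<open>(s, y) \<mapsto> (n, e)\<close>, where \<open>s\<close> are the coordinates of \<open>n\<close> and the
  coordinates of \<open>e\<close> are \<open>h (s, y)\<close>: their base part is forced to be that of \<open>g n\<close>. Near \<open>q0\<close> this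
  is defined because \<open>g\<close> is continuous.
\<close>

lemma product_chart_inverse:
  assumes q0: "q0 \<in> dom_of pchart"
  defines "h \<equiv> \<lambda>q. (coord c (g (coord_inv a (fst q))), snd q)"
  shows "\<forall>\<^sub>F q in nhds (coord pchart q0).
      q \<in> coord pchart ` dom_of pchart \<and>
      fst (coord_inv pchart q) \<in> dom_of a \<and>
      coord a (fst (coord_inv pchart q)) = fst q \<and>
      snd (coord_inv pchart q) \<in> dom_of d \<and>
      coord d (snd (coord_inv pchart q)) = h q" (is "eventually ?P _")
    and "smooth_at h (coord pchart q0)"
    and "rep_smooth a c g (fst q0)"
proof -
  note D = fibred_chartsD[OF cd]
  let ?D = "pchart"
  let ?z0 = "coord ?D q0"
  have q0': "fst q0 \<in> dom_of a" "snd q0 \<in> dom_of d" "g (fst q0) = p (snd q0)"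
    using q0 by (simp_all add: dom_product_chart)
  have an: "a \<in> charts_at N (fst q0)" using a q0' by (simp add: charts_atI)
  have cn: "c \<in> charts_at M (g (fst q0))" using D q0' by (simp add: charts_atI)
  show rg: "rep_smooth a c g (fst q0)" by (rule smooth_pt_rep[OF N M bspec[OF g charts_atD(4)[OF an]] an cn])
  have fz: "fst ?z0 = coord a (fst q0)" by (simp add: coord_product_chart)
  have "smooth_at (\<lambda>z. coord c (g (coord_inv a z))) (fst ?z0)" using rg by (simp add: rep_smooth_def fz)
  then show sm: "smooth_at h ?z0"
    unfolding h_def
    by (intro smooth_at_Pair smooth_at_bounded_linear[OF bounded_linear_snd]
        smooth_at_compose[OF smooth_at_bounded_linear[OF bounded_linear_fst], of "\<lambda>z. coord c (g (coord_inv a z))"])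
  have h0: "h ?z0 = coord d (snd q0)"
    using D(4)[OF q0'(2)] q0' by (simp add: h_def coord_product_chart coord_inv_coord charts_is_chart[OF a] prod_eq_iff)
  have "\<forall>\<^sub>F z in nhds (fst ?z0). z \<in> coord a ` dom_of a \<and> g (coord_inv a z) \<in> dom_of c"
    unfolding fz
    by (rule eventually_conj[OF eventually_in_chart[OF charts_atD(2,3)[OF an]] conjunct1[OF rg[unfolded rep_smooth_def]]])
  then have 1: "\<forall>\<^sub>F q in nhds ?z0. fst q \<in> coord a ` dom_of a \<and> g (coord_inv a (fst q)) \<in> dom_of c"
    by (rule eventually_nhds_fst)
  have "\<forall>\<^sub>F z in nhds (h ?z0). z \<in> coord d ` dom_of d"
    unfolding h0 by (rule eventually_in_chart[OF charts_is_chart[OF D(2)] q0'(2)])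
  then have 2: "\<forall>\<^sub>F q in nhds ?z0. h q \<in> coord d ` dom_of d"
    by (rule smooth_at_eventually_compose[OF sm])
  from 1 2 show "\<forall>\<^sub>F q in nhds ?z0. ?P q"
  proof eventually_elim
    case (elim q)
    let ?n = "coord_inv a (fst q)" and ?e = "coord_inv d (h q)"
    have n: "?n \<in> dom_of a" "coord a ?n = fst q" "g ?n \<in> dom_of c"
      using elim(1) by (simp_all add: coord_inv_in_dom coord_coord_inv)
    have e: "?e \<in> dom_of d" "coord d ?e = h q"
      using coord_inv_in_dom[OF elim(2)] coord_coord_inv[OF elim(2)] by simp_all
    have "coord c (p ?e) = coord c (g ?n)" using D(4)[OF e(1)] e(2) by (simp add: h_def)
    then have "g ?n = p ?e"
      using coord_inv_coord[OF charts_is_chart[OF D(1)]] n(3) D(3)[OF e(1)] by metis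
    then have dom: "(?n, ?e) \<in> dom_of ?D" using n e by (simp add: dom_product_chart)
    moreover have co: "coord ?D (?n, ?e) = q"
      using n e by (simp add: coord_product_chart) (simp add: h_def)
    ultimately have im: "q \<in> coord ?D ` dom_of ?D" by (metis image_eqI)
    have "coord_inv ?D q = (?n, ?e)"
      using inv_into_f_f[OF inj_on_product_chart dom] co by (simp add: coord_inv_def)
    then show ?case using im n e by simp
  qed
qed

lemma is_chart_product_chart: "is_chart pchart"
  unfolding is_chart_def
proof
  show "open (coord pchart ` dom_of pchart)"
    unfolding open_iff_eventually
  proof
    fix z assume "z \<in> coord pchart ` dom_of pchart"
    then obtain q0 where q0: "z = coord pchart q0" "q0 \<in> dom_of pchart"
      by (rule imageE)
    show "\<forall>\<^sub>F y in nhds z. y \<in> coord pchart ` dom_of pchart"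
      unfolding q0(1) using product_chart_inverse(1)[OF q0(2)] by (rule eventually_mono) (rule conjunct1)
  qed
qed (rule inj_on_product_chart)

context
  fixes q
  assumes q: "q \<in> dom_of pchart"
begin

lemma
  shows product_chart_fst: "rep_smooth pchart a fst q"
    and product_chart_deriv_fst: "rep_deriv pchart a fst q w = fst w"
proof -
  have ev: "\<forall>\<^sub>F z in nhds (coord pchart q).
      fst (coord_inv pchart z) \<in> dom_of a \<and>
      coord a (fst (coord_inv pchart z)) = fst z"
    using product_chart_inverse(1)[OF q] by eventually_elim simp
  show "rep_smooth pchart a fst q"
    by (rule rep_smooth_by_formula[OF ev smooth_at_bounded_linear[OF bounded_linear_fst]])
  show "rep_deriv pchart a fst q w = fst w"
    by (simp add: rep_deriv_by_formula[OF ev] frechet_derivative_bounded_linear[OF bounded_linear_fst])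
qed

lemma
  shows product_chart_snd: "rep_smooth pchart d snd q"
    and product_chart_deriv_snd:
      "rep_deriv pchart d snd q w = (rep_deriv a c g (fst q) (fst w), snd w)"
proof -
  define \<gamma> where "\<gamma> = (\<lambda>z. coord c (g (coord_inv a z)))"
  have ev: "\<forall>\<^sub>F z in nhds (coord pchart q).
      snd (coord_inv pchart z) \<in> dom_of d \<and>
      coord d (snd (coord_inv pchart z)) = (\<gamma> (fst z), snd z)"
    using product_chart_inverse(1)[OF q] unfolding \<gamma>_def by eventually_elim simp
  show "rep_smooth pchart d snd q"
    by (rule rep_smooth_by_formula[OF ev]) (unfold \<gamma>_def, rule product_chart_inverse(2)[OF q])
  let ?z = "coord pchart q"
  have "smooth_at \<gamma> (fst ?z)"
    using product_chart_inverse(3)[OF q] by (simp add: rep_smooth_def coord_product_chart \<gamma>_def)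
  then have "(\<gamma> has_derivative frechet_derivative \<gamma> (at (fst ?z))) (at (fst ?z))"
    by (rule smooth_at_has_derivative)
  then have "((\<lambda>z. (\<gamma> (fst z), snd z)) has_derivative
      (\<lambda>w. (frechet_derivative \<gamma> (at (fst ?z)) (fst w), snd w))) (at ?z)"
    by (intro has_derivative_Pair has_derivative_compose[OF has_derivative_fst[OF has_derivative_ident], of \<gamma>]
        has_derivative_snd has_derivative_ident)
  from frechet_derivative_at[OF this, symmetric]
  have "frechet_derivative (\<lambda>z. (\<gamma> (fst z), snd z)) (at ?z) =
    (\<lambda>w. (frechet_derivative \<gamma> (at (fst ?z)) (fst w), snd w))" .
  then show "rep_deriv pchart d snd q w = (rep_deriv a c g (fst q) (fst w), snd w)"
    unfolding rep_deriv_by_formula[OF ev] by (simp add: rep_deriv_def \<gamma>_def coord_product_chart)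
qed

lemma product_chart_dom_eventually:
  "\<forall>\<^sub>F z in nhds (coord pchart q).
    coord_inv pchart z \<in> dom_of pchart"
  using eventually_in_chart[OF is_chart_product_chart q] by eventually_elim (rule coord_inv_in_dom)

end

end

lemma product_charts_rep_smooth:
  assumes a: "a \<in> charts N" and cd: "(c, d) \<in> fibred_charts E p M"
    and a': "a' \<in> charts N" and cd': "(c', d') \<in> fibred_charts E p M"
    and q: "q \<in> dom_of (product_chart g p a d)" "q \<in> dom_of (product_chart g p a' d')"
  shows "rep_smooth (product_chart g p a d) (product_chart g p a' d') (\<lambda>q. q) q"
proof (rule rep_smooth_into_product_chart)
  note D = is_chart_product_chart[OF a cd] q(1)
  have n: "a \<in> charts_at N (fst q)" "a' \<in> charts_at N (fst q)"
    "d \<in> charts_at E (snd q)" "d' \<in> charts_at E (snd q)"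
    using q a a' fibred_chartsD(2)[OF cd] fibred_chartsD(2)[OF cd']
    by (simp_all add: dom_product_chart charts_atI)
  show "rep_smooth (product_chart g p a d) a' fst q"
    by (rule rep_smooth_compose[OF D charts_atD(2)[OF n(1)] product_chart_fst[OF a cd q(1)]
        charts_rep_smooth[OF N n(1,2)]])
  show "rep_smooth (product_chart g p a d) d' snd q"
    by (rule rep_smooth_compose[OF D charts_atD(2)[OF n(3)] product_chart_snd[OF a cd q(1)]
        charts_rep_smooth[OF E n(3,4)]])
  show "\<forall>\<^sub>F z in nhds (coord (product_chart g p a d) q).
      g (fst (coord_inv (product_chart g p a d) z)) = p (snd (coord_inv (product_chart g p a d) z))"
    using product_chart_dom_eventually[OF a cd q(1)] by eventually_elim (simp add: dom_product_chart)
qed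

lemma smooth_atlas_fibre_product: "smooth_atlas (fibre_product N g M E p)"
  unfolding smooth_atlas_def
proof (intro conjI ballI)
  fix b b' assume "b \<in> fibre_product N g M E p" "b' \<in> fibre_product N g M E p"
  then obtain a c d a' c' d' where b: "b = product_chart g p a d" "a \<in> charts N" "(c, d) \<in> fibred_charts E p M"
    and b': "b' = product_chart g p a' d'" "a' \<in> charts N" "(c', d') \<in> fibred_charts E p M"
    unfolding fibre_product_eq by (elim CollectE exE conjE) (rule that)
  show "is_chart b" unfolding b(1) by (rule is_chart_product_chart[OF b(2,3)])
  show "compatible b b'"
    unfolding b(1) b'(1)
      compatible_iff[OF is_chart_product_chart[OF b(2,3)] is_chart_product_chart[OF b'(2,3)]]
    using product_charts_rep_smooth[OF b(2,3) b'(2,3)] product_charts_rep_smooth[OF b'(2,3) b(2,3)]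
    by (intro ballI conjI) (simp_all add: Int_iff)
qed

lemma product_chart_in_charts:
  assumes "a \<in> charts N" "(c, d) \<in> fibred_charts E p M"
  shows "product_chart g p a d \<in> charts (fibre_product N g M E p)"
  using assms atlas_subset_charts[OF smooth_atlas_fibre_product] unfolding fibre_product_eq by blast

lemma fibred_chart_product_chart:
  assumes "a \<in> charts N" "(c, d) \<in> fibred_charts E p M"
  shows "(a, product_chart g p a d) \<in> fibred_charts (fibre_product N g M E p) fst N"
  unfolding fibred_charts_def
  using assms product_chart_in_charts[OF assms]
  by (auto simp: dom_product_chart coord_product_chart)

end

section \<open>Existence of fibred charts\<close>

lemma change_of_coordinates_in_charts:
  assumes M: "smooth_atlas M" and d: "d \<in> charts M"
    and S: "open S" "S \<subseteq> coord d ` dom_of d" and \<Phi>: "smooth_on \<Phi> S" "inj_on \<Phi> S"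
    and inv: "open (\<Phi> ` S)" "smooth_on (inv_into S \<Phi>) (\<Phi> ` S)"
  shows "({x \<in> dom_of d. coord d x \<in> S}, \<lambda>x. \<Phi> (coord d x)) \<in> charts M" (is "?e \<in> _")
proof (rule chartsI[OF M])
  have isd: "is_chart d" by (rule charts_is_chart[OF d])
  have inj: "inj_on (coord ?e) (dom_of ?e)"
  proof (rule inj_onI)
    fix x y assume "x \<in> dom_of ?e" "y \<in> dom_of ?e" "coord ?e x = coord ?e y"
    then have "x \<in> dom_of d" "y \<in> dom_of d" "coord d x = coord d y"
      using \<Phi>(2) by (auto dest: inj_onD)
    then show "x = y" using coord_inv_coord[OF isd] by metis
  qed
  have in_e: "coord_inv d z \<in> dom_of ?e" "coord d (coord_inv d z) = z" if "z \<in> S" for z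
  proof -
    have "z \<in> coord d ` dom_of d" using that S(2) by blast
    then show "coord_inv d z \<in> dom_of ?e" "coord d (coord_inv d z) = z"
      using that by (simp_all add: coord_inv_in_dom coord_coord_inv)
  qed
  have img: "coord ?e ` dom_of ?e = \<Phi> ` S"
  proof (intro equalityI subsetI)
    fix y assume "y \<in> \<Phi> ` S"
    then obtain z where z: "z \<in> S" "y = \<Phi> z" by blast
    then have "y = coord ?e (coord_inv d z)" using in_e by simp
    then show "y \<in> coord ?e ` dom_of ?e" using in_e(1)[OF z(1)] by (rule image_eqI)
  qed auto
  show ise: "is_chart ?e" unfolding is_chart_def img using inj inv(1) by simp
  fix x assume x: "x \<in> dom_of ?e"
  then have x': "x \<in> dom_of d" "coord d x \<in> S" by simp_all
  have "\<forall>\<^sub>F z in nhds (coord d x). z \<in> S" by (rule eventually_nhds_in_open[OF S(1) x'(2)])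
  then have "\<forall>\<^sub>F z in nhds (coord d x). coord_inv d z \<in> dom_of ?e \<and> coord ?e (coord_inv d z) = \<Phi> z"
    by eventually_elim (use in_e in simp)
  then have 1: "rep_smooth d ?e (\<lambda>x. x) x"
    by (rule rep_smooth_by_formula) (rule smooth_on_smooth_at[OF \<Phi>(1) S(1) x'(2)])
  have ex: "coord ?e x \<in> \<Phi> ` S" using x' by simp
  have "\<forall>\<^sub>F y in nhds (coord ?e x). y \<in> \<Phi> ` S" by (rule eventually_nhds_in_open[OF inv(1) ex])
  then have "\<forall>\<^sub>F y in nhds (coord ?e x). coord_inv ?e y \<in> dom_of d \<and> coord d (coord_inv ?e y) = inv_into S \<Phi> y"
  proof eventually_elim
    case (elim y)
    then obtain z where z: "z \<in> S" "y = \<Phi> z" by blast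
    then have "y = coord ?e (coord_inv d z)" using in_e by simp
    then have "coord_inv ?e y = coord_inv d z" using coord_inv_coord[OF ise in_e(1)[OF z(1)]] by simp
    then show ?case using in_e[OF z(1)] z \<Phi>(2) by simp
  qed
  then have 2: "rep_smooth ?e d (\<lambda>x. x) x"
    by (rule rep_smooth_by_formula) (rule smooth_on_smooth_at[OF inv(2,1) ex])
  from 1 2 show "\<exists>c\<in>charts_at M x. rep_smooth c ?e (\<lambda>x. x) x \<and> rep_smooth ?e c (\<lambda>x. x) x"
    using charts_atI[OF d x'(1)] by blast
qed

lemma smooth_fibred_manifoldD:
  assumes "smooth_fibred_manifold E p M"
  shows "smooth_atlas E" "smooth_atlas M"
    and "\<And>e. e \<in> points E \<Longrightarrow> smooth_pt E M p e"
    and "\<And>e. e \<in> points E \<Longrightarrow> tangent_map E M p ` tangent_space E e = tangent_space M (p e)"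
  using assms smooth_map_on_pt[of E "points E" M p]
  unfolding smooth_fibred_manifold_def smooth_manifold_def by simp_all

text \<open>
  The expression \<open>P\<close> of \<open>p\<close> in charts has a surjective derivative \<open>L\<close>, which a linear map \<open>q\<close>
  completes to a bijection. By the inverse function theorem \<open>(P, q)\<close> is a change of coordinates
  near the given point, and in the new coordinates \<open>p\<close> is the projection to the first factor.
\<close>

lemma ex_fibred_chart:
  fixes E :: "('f, 'x::coordinate_space \<times> 'y::coordinate_space) manifold"
  assumes fib: "smooth_fibred_manifold E p M" and e: "e \<in> points E" and c: "c \<in> charts_at M (p e)"
  obtains d where "(c, d) \<in> fibred_charts E p M" "e \<in> dom_of d"
proof -
  note E = smooth_fibred_manifoldD(1)[OF fib] and M = smooth_fibred_manifoldD(2)[OF fib]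
    and pe = smooth_fibred_manifoldD(3)[OF fib e] and surj_T = smooth_fibred_manifoldD(4)[OF fib e]
  obtain d where d: "d \<in> charts_at E e" using ex_atlas_chart[OF E e] by blast
  note D = charts_atD[OF d]
  have rep: "rep_smooth d c p e" by (rule smooth_pt_rep[OF E M pe d c])
  define P where "P = (\<lambda>z. coord c (p (coord_inv d z)))"
  define L where "L = rep_deriv d c p e"
  have L: "linear L" unfolding L_def by (rule linear_rep_deriv[OF rep])
  have P: "smooth_at P (coord d e)" using rep by (simp add: rep_smooth_def P_def)
  have "surj L"
    unfolding surj_def
  proof
    fix w
    have "tangent_of_comp M (p e) c w \<in> tangent_map E M p ` tangent_space E e"
      unfolding surj_T by (rule tangent_of_comp_in[OF M c])
    then obtain V where V: "tangent_of_comp M (p e) c w = tangent_map E M p V" "V \<in> tangent_space E e"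
      by (rule imageE)
    have "w = comp (tangent_map E M p V) c" unfolding V(1)[symmetric] by (simp add: comp_tangent_of_comp[OF c])
    then have "w = L (comp V d)" by (simp add: comp_tangent_map[OF E M pe V(2) d c] L_def)
    then show "\<exists>x. w = L x" by (rule exI)
  qed
  then obtain q :: "'x \<times> 'y \<Rightarrow> 'y" where q: "linear q" "bij (\<lambda>z. (L z, q z))" using surjective_complement[OF L] by blast
  note blq = linear_imp_bounded_linear[OF q(1)]
  define \<Phi> where "\<Phi> = (\<lambda>z. (P z, q z))"
  have "(\<Phi> has_derivative (\<lambda>z. (L z, q z))) (at (coord d e))"
    unfolding \<Phi>_def
    by (rule has_derivative_Pair[OF _ bounded_linear_imp_has_derivative[OF blq]])
      (use smooth_at_has_derivative[OF P] in \<open>simp add: L_def rep_deriv_def P_def\<close>)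
  then have bij: "bij (frechet_derivative \<Phi> (at (coord d e)))"
    using q(2) frechet_derivative_at by metis
  have "\<forall>\<^sub>F z in nhds (coord d e). p (coord_inv d z) \<in> dom_of c"
    using rep by (simp add: rep_smooth_def)
  with smooth_at_eventually[OF P] eventually_in_chart[OF D(2,3)]
  have "\<forall>\<^sub>F z in nhds (coord d e). smooth_at P z \<and> z \<in> coord d ` dom_of d \<and> p (coord_inv d z) \<in> dom_of c"
    by eventually_elim (intro conjI)
  then obtain T where T: "open T" "coord d e \<in> T"
    "\<And>z. z \<in> T \<Longrightarrow> smooth_at P z \<and> z \<in> coord d ` dom_of d \<and> p (coord_inv d z) \<in> dom_of c"
    unfolding eventually_nhds by blast
  have "smooth_on \<Phi> T"
    unfolding \<Phi>_def
    by (intro smooth_on_smooth_atI smooth_at_Pair smooth_at_bounded_linear[OF blq]) (use T(3) in simp)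
  then obtain S where S: "open S" "coord d e \<in> S" "S \<subseteq> T" "inj_on \<Phi> S" "open (\<Phi> ` S)"
      "smooth_on (inv_into S \<Phi>) (\<Phi> ` S)"
    using local_inverse[OF T(1,2) _ bij] by blast
  let ?d = "({x \<in> dom_of d. coord d x \<in> S}, \<lambda>x. \<Phi> (coord d x))"
  have "?d \<in> charts E"
  proof (rule change_of_coordinates_in_charts[OF E D(1) S(1) _ _ S(4,5,6)])
    show "S \<subseteq> coord d ` dom_of d" using S(3) T(3) by blast
    show "smooth_on \<Phi> S" by (rule smooth_on_subset[OF \<open>smooth_on \<Phi> T\<close> S(3)])
  qed
  moreover have "p x \<in> dom_of c \<and> fst (coord ?d x) = coord c (p x)" if "x \<in> dom_of ?d" for x
  proof -
    have x: "x \<in> dom_of d" "coord d x \<in> T" using that S(3) by auto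
    then show ?thesis using T(3)[OF x(2)] by (simp add: \<Phi>_def P_def coord_inv_coord[OF D(2)])
  qed
  ultimately have "(c, ?d) \<in> fibred_charts E p M"
    using charts_atD(1)[OF c] unfolding fibred_charts_def by blast
  then show thesis using that[of ?d] S(2) D(3) by simp
qed

section \<open>The curvature in a fibred chart\<close>

text \<open>
  The product rule for \<open>A x (w x)\<close>, obtained from the usual one after expanding \<open>w x\<close> in a basis.
\<close>

lemma frechet_derivative_linear_family:
  fixes A :: "'a::real_normed_vector \<Rightarrow> 'b::coordinate_space \<Rightarrow> 'c::real_normed_vector"
  assumes lin: "\<forall>\<^sub>F x in nhds z. linear (A x)" and A: "\<And>b. smooth_at (\<lambda>x. A x b) z" and w: "smooth_at w z"
  shows "frechet_derivative (\<lambda>x. A x (w x)) (at z) h =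
    frechet_derivative (\<lambda>x. A x (w z)) (at z) h + A z (frechet_derivative w (at z) h)"
proof -
  have linz: "linear (A z)" by (rule eventually_nhds_x_imp_x[OF lin])
  have D: "frechet_derivative (\<lambda>x. A x (w x)) (at z) h =
      (\<Sum>u\<in>onb. inner (w z) u *\<^sub>R frechet_derivative (\<lambda>x. A x u) (at z) h +
        inner (frechet_derivative w (at z) h) u *\<^sub>R A z u)" if w: "smooth_at w z" for w
  proof -
    have "((\<lambda>x. \<Sum>u\<in>onb. inner (w x) u *\<^sub>R A x u) has_derivative
        (\<lambda>h. \<Sum>u\<in>onb. inner (w z) u *\<^sub>R frechet_derivative (\<lambda>x. A x u) (at z) h +
          inner (frechet_derivative w (at z) h) u *\<^sub>R A z u)) (at z)"
      by (intro has_derivative_sum has_derivative_scaleR has_derivative_inner_left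
          smooth_at_has_derivative A w)
    from fun_cong[OF frechet_derivative_at[OF this], symmetric]
    have "frechet_derivative (\<lambda>x. \<Sum>u\<in>onb. inner (w x) u *\<^sub>R A x u) (at z) h =
      (\<Sum>u\<in>onb. inner (w z) u *\<^sub>R frechet_derivative (\<lambda>x. A x u) (at z) h +
        inner (frechet_derivative w (at z) h) u *\<^sub>R A z u)" .
    moreover have "\<forall>\<^sub>F x in nhds z. A x (w x) = (\<Sum>u\<in>onb. inner (w x) u *\<^sub>R A x u)"
      using lin by eventually_elim (rule linear_onb_expansion)
    ultimately show ?thesis by (simp only: frechet_derivative_cong)
  qed
  have 0: "frechet_derivative (\<lambda>x. w z) (at z) h = 0" by (simp add: frechet_derivative_const)
  show ?thesis
    unfolding D[OF w] D[OF smooth_at_const[of "w z"]] 0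
    by (simp add: sum.distrib linear_onb_expansion[OF linz, symmetric])
qed

text \<open>
  The connection coefficients of two fibred charts are related by \<open>rel\<close>: the transition map
  \<open>\<tau>\<close> maps horizontal vectors to horizontal vectors. Differentiating \<open>rel\<close> along a horizontal
  vector produces second derivatives of \<open>\<tau>\<close> and \<open>\<phi>\<close>, which are symmetric and cancel after
  antisymmetrisation.
\<close>

lemma curvature_transformation:
  fixes \<tau> :: "'x::coordinate_space \<times> 'y::coordinate_space \<Rightarrow> 'x \<times> 'y" and \<phi> :: "'x \<Rightarrow> 'x"
    and \<kappa> \<kappa>' :: "'x \<times> 'y \<Rightarrow> 'x \<Rightarrow> 'y"
  assumes \<tau>: "smooth_at \<tau> z" and \<phi>: "smooth_at \<phi> (fst z)"
    and fib: "\<forall>\<^sub>F y in nhds z. fst (\<tau> y) = \<phi> (fst y)"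
    and \<kappa>: "\<And>w. smooth_at (\<lambda>y. \<kappa> y w) z"
    and \<kappa>': "\<forall>\<^sub>F y in nhds (\<tau> z). linear (\<kappa>' y)" "\<And>w. smooth_at (\<lambda>y. \<kappa>' y w) (\<tau> z)"
    and rel: "\<forall>\<^sub>F y in nhds z. \<forall>w. \<kappa>' (\<tau> y) (frechet_derivative \<phi> (at (fst y)) w) =
      snd (frechet_derivative \<tau> (at y) (w, \<kappa> y w))"
  defines "ct \<equiv> \<lambda>\<kappa> (z::'x \<times> 'y) (u::'x) v. frechet_derivative (\<lambda>y. \<kappa> y v) (at z) (u, \<kappa> z u) :: 'y"
    and "D\<phi> \<equiv> frechet_derivative \<phi> (at (fst z))"
  shows "snd (frechet_derivative \<tau> (at z) (0, ct \<kappa> z u v - ct \<kappa> z v u)) =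
    ct \<kappa>' (\<tau> z) (D\<phi> u) (D\<phi> v) - ct \<kappa>' (\<tau> z) (D\<phi> v) (D\<phi> u)"
proof -
  define T where "T = frechet_derivative \<tau> (at z)"
  define T2 where "T2 V U = frechet_derivative (\<lambda>y. frechet_derivative \<tau> (at y) V) (at z) U" for V U
  define \<phi>2 where "\<phi>2 v u = frechet_derivative (\<lambda>x. frechet_derivative \<phi> (at x) v) (at (fst z)) u" for v u
  have linT: "linear T" unfolding T_def by (rule smooth_at_linear_derivative[OF \<tau>])
  have linT_ev: "\<forall>\<^sub>F y in nhds z. linear (frechet_derivative \<tau> (at y))"
    using smooth_at_eventually[OF \<tau>] by eventually_elim (rule smooth_at_linear_derivative)
  have s_fst: "smooth_at fst z" by (rule smooth_at_bounded_linear[OF bounded_linear_fst])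
  have D_fst: "frechet_derivative fst (at z) = fst" by (rule frechet_derivative_bounded_linear[OF bounded_linear_fst])
  have rel_z: "\<kappa>' (\<tau> z) (D\<phi> w) = snd (T (w, \<kappa> z w))" for w
    using eventually_nhds_x_imp_x[OF rel] by (simp add: D\<phi>_def T_def)
  have fst_T: "fst (T U) = D\<phi> (fst U)" for U
  proof -
    have "fst (T U) = frechet_derivative (\<lambda>y. fst (\<tau> y)) (at z) U"
      unfolding T_def
      using frechet_derivative_compose[OF \<tau> smooth_at_bounded_linear[OF bounded_linear_fst]]
      by (simp add: frechet_derivative_bounded_linear[OF bounded_linear_fst])
    also have "\<dots> = frechet_derivative (\<lambda>y. \<phi> (fst y)) (at z) U"
      by (simp add: frechet_derivative_cong[OF fib])
    also have "\<dots> = D\<phi> (fst U)"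
      by (simp add: frechet_derivative_compose[OF s_fst \<phi>] D_fst D\<phi>_def)
    finally show ?thesis .
  qed
  have horizontal: "T (w, \<kappa> z w) = (D\<phi> w, \<kappa>' (\<tau> z) (D\<phi> w))" for w
    using fst_T[of "(w, \<kappa> z w)"] rel_z[of w] by (simp add: prod_eq_iff)
  have key: "ct \<kappa>' (\<tau> z) (D\<phi> u) (D\<phi> v) + \<kappa>' (\<tau> z) (\<phi>2 v u) =
      snd (T2 (v, \<kappa> z v) (u, \<kappa> z u)) + snd (T (0, ct \<kappa> z u v))" for u v
  proof -
    let ?U = "(u, \<kappa> z u)"
    have s\<phi>: "smooth_at (\<lambda>x. frechet_derivative \<phi> (at x) v) (fst z)" by (rule smooth_at_derivative[OF \<phi>])
    have s\<kappa>\<tau>: "smooth_at (\<lambda>y. \<kappa>' (\<tau> y) b) z" for b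
      by (rule smooth_at_compose[OF \<tau> \<kappa>'(2)])
    have "frechet_derivative (\<lambda>y. \<kappa>' (\<tau> y) (frechet_derivative \<phi> (at (fst y)) v)) (at z) ?U =
        frechet_derivative (\<lambda>y. \<kappa>' (\<tau> y) (frechet_derivative \<phi> (at (fst z)) v)) (at z) ?U +
        \<kappa>' (\<tau> z) (frechet_derivative (\<lambda>y. frechet_derivative \<phi> (at (fst y)) v) (at z) ?U)"
      by (rule frechet_derivative_linear_family[OF smooth_at_eventually_compose[OF \<tau> \<kappa>'(1)] s\<kappa>\<tau>
            smooth_at_compose[OF s_fst s\<phi>]])
    also have "frechet_derivative (\<lambda>y. \<kappa>' (\<tau> y) (frechet_derivative \<phi> (at (fst z)) v)) (at z) ?U =
        frechet_derivative (\<lambda>y. \<kappa>' y (D\<phi> v)) (at (\<tau> z)) (T ?U)"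
      unfolding D\<phi>_def T_def by (rule frechet_derivative_compose[OF \<tau> \<kappa>'(2)])
    also have "\<dots> = ct \<kappa>' (\<tau> z) (D\<phi> u) (D\<phi> v)" by (simp add: ct_def horizontal)
    also have "frechet_derivative (\<lambda>y. frechet_derivative \<phi> (at (fst y)) v) (at z) ?U = \<phi>2 v u"
      using frechet_derivative_compose[OF s_fst s\<phi>, of ?U] by (simp add: D_fst \<phi>2_def)
    finally have L: "frechet_derivative (\<lambda>y. \<kappa>' (\<tau> y) (frechet_derivative \<phi> (at (fst y)) v)) (at z) ?U =
        ct \<kappa>' (\<tau> z) (D\<phi> u) (D\<phi> v) + \<kappa>' (\<tau> z) (\<phi>2 v u)" .
    have s1: "smooth_at (\<lambda>y. (v, \<kappa> y v)) z" by (rule smooth_at_Pair[OF smooth_at_const \<kappa>])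
    have d1: "frechet_derivative (\<lambda>y. (v, \<kappa> y v)) (at z) ?U = (0, ct \<kappa> z u v)"
    proof -
      have "((\<lambda>y. (v, \<kappa> y v)) has_derivative (\<lambda>h. (0, frechet_derivative (\<lambda>y. \<kappa> y v) (at z) h))) (at z)"
        by (intro has_derivative_Pair has_derivative_const smooth_at_has_derivative \<kappa>)
      from fun_cong[OF frechet_derivative_at[OF this], of ?U] show ?thesis by (simp add: ct_def)
    qed
    have s2: "smooth_at (\<lambda>y. frechet_derivative \<tau> (at y) (v, \<kappa> y v)) z"
      by (rule smooth_at_linear_family[OF linT_ev smooth_at_derivative[OF \<tau>] s1])
    have "frechet_derivative (\<lambda>y. snd (frechet_derivative \<tau> (at y) (v, \<kappa> y v))) (at z) ?U =
        snd (frechet_derivative (\<lambda>y. frechet_derivative \<tau> (at y) (v, \<kappa> y v)) (at z) ?U)"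
      using frechet_derivative_compose[OF s2 smooth_at_bounded_linear[OF bounded_linear_snd], of ?U]
      by (simp add: frechet_derivative_bounded_linear[OF bounded_linear_snd])
    also have "frechet_derivative (\<lambda>y. frechet_derivative \<tau> (at y) (v, \<kappa> y v)) (at z) ?U =
        T2 (v, \<kappa> z v) ?U + T (0, ct \<kappa> z u v)"
      using frechet_derivative_linear_family[OF linT_ev smooth_at_derivative[OF \<tau>] s1, of ?U]
      by (simp add: d1 T2_def T_def)
    finally have R: "frechet_derivative (\<lambda>y. snd (frechet_derivative \<tau> (at y) (v, \<kappa> y v))) (at z) ?U =
        snd (T2 (v, \<kappa> z v) ?U) + snd (T (0, ct \<kappa> z u v))" by simp
    have "\<forall>\<^sub>F y in nhds z. \<kappa>' (\<tau> y) (frechet_derivative \<phi> (at (fst y)) v) =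
        snd (frechet_derivative \<tau> (at y) (v, \<kappa> y v))"
      using rel by eventually_elim blast
    from frechet_derivative_cong[OF this] L R show ?thesis by simp
  qed
  have sym: "T2 V U = T2 U V" "\<phi>2 v u = \<phi>2 u v" for U V u v
    unfolding T2_def \<phi>2_def
    by (rule second_derivative_symmetric[OF \<tau>], rule second_derivative_symmetric[OF \<phi>])
  have "snd (T (0, ct \<kappa> z u v - ct \<kappa> z v u)) = snd (T (0, ct \<kappa> z u v)) - snd (T (0, ct \<kappa> z v u))"
    using linear_diff[OF linT, of "(0, ct \<kappa> z u v)" "(0, ct \<kappa> z v u)"] by simp
  also have "\<dots> = ct \<kappa>' (\<tau> z) (D\<phi> u) (D\<phi> v) - ct \<kappa>' (\<tau> z) (D\<phi> v) (D\<phi> u)"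
  proof -
    let ?s = "snd (T2 (v, \<kappa> z v) (u, \<kappa> z u)) - \<kappa>' (\<tau> z) (\<phi>2 v u)"
    have "ct \<kappa>' (\<tau> z) (D\<phi> u) (D\<phi> v) = ?s + snd (T (0, ct \<kappa> z u v))"
      using key[of u v] by (simp add: eq_diff_eq diff_add_eq)
    moreover have "ct \<kappa>' (\<tau> z) (D\<phi> v) (D\<phi> u) = ?s + snd (T (0, ct \<kappa> z v u))"
      using key[of v u] unfolding sym(1)[of "(u, \<kappa> z u)"] sym(2)[of u v]
      by (simp add: eq_diff_eq diff_add_eq)
    ultimately show ?thesis by simp
  qed
  finally show ?thesis unfolding T_def .
qed

text \<open>
  The condition is imposed at a single point so that it applies to connections that are defined
  only over an open set.
\<close>

definition connection_at ::
  "('f, 'x::coordinate_space \<times> 'y::coordinate_space) manifold \<Rightarrow> ('f \<Rightarrow> 'b) \<Rightarrow> ('b, 'x) manifold \<Rightarrow>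
   ('f \<Rightarrow> ('b, 'x) tvec \<Rightarrow> ('f, 'x \<times> 'y) tvec) \<Rightarrow> 'f \<Rightarrow> bool" where
  "connection_at E p M K e \<longleftrightarrow>
     (\<forall>v\<in>tangent_space M (p e). K e v \<in> tangent_space E e \<and> tangent_map E M p (K e v) = v)"

context
  fixes E :: "('f, 'x::coordinate_space \<times> 'y::coordinate_space) manifold" and p :: "'f \<Rightarrow> 'b"
    and M :: "('b, 'x) manifold"
  assumes E: "smooth_atlas E" and M: "smooth_atlas M"
begin

lemma fibred_charts_at:
  assumes "(c, d) \<in> fibred_charts E p M" "e \<in> dom_of d"
  shows "d \<in> charts_at E e" "c \<in> charts_at M (p e)" "smooth_pt E M p e"
proof -
  show d: "d \<in> charts_at E e" and c: "c \<in> charts_at M (p e)"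
    using assms fibred_chartsD[OF assms(1)] by (simp_all add: charts_atI)
  show "smooth_pt E M p e" by (rule smooth_ptI[of d E e c M p, OF d c fibred_chart_rep_smooth[OF assms]])
qed

lemma comp_tangent_map_fibred:
  assumes "(c, d) \<in> fibred_charts E p M" "e \<in> dom_of d" "V \<in> tangent_space E e"
  shows "comp (tangent_map E M p V) c = fst (comp V d)"
  using comp_tangent_map[OF E M fibred_charts_at(3)[OF assms(1,2)] assms(3) fibred_charts_at(1,2)[OF assms(1,2)]]
  by (simp add: fibred_chart_rep_deriv[OF assms(1,2)])

lemma comp_connection:
  assumes cd: "(c, d) \<in> fibred_charts E p M" and e: "e \<in> dom_of d" and K: "connection_at E p M K e"
  shows "comp (K e (tangent_of_comp M (p e) c w)) d = (w, conn_coeff E p M K c d (coord d e) w)"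
proof -
  let ?V = "K e (tangent_of_comp M (p e) c w)"
  note at = fibred_charts_at[OF cd e]
  have "?V \<in> tangent_space E e" "tangent_map E M p ?V = tangent_of_comp M (p e) c w"
    using K tangent_of_comp_in[OF M at(2)] by (simp_all add: connection_at_def)
  then have "fst (comp ?V d) = w"
    using comp_tangent_map_fibred[OF cd e] comp_tangent_of_comp[OF at(2)] by metis
  moreover have "snd (comp ?V d) = conn_coeff E p M K c d (coord d e) w"
    by (simp add: conn_coeff_def coord_inv_coord[OF charts_atD(2)[OF at(1)] e])
  ultimately show ?thesis by (simp add: prod_eq_iff)
qed

text \<open>
  Both sides are vertical components, in the chart \<open>d'\<close>, of one and the same horizontal vector.
\<close>

lemma conn_coeff_change:
  assumes cd: "(c, d) \<in> fibred_charts E p M" and e: "e \<in> dom_of d"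
    and cd': "(c', d') \<in> fibred_charts E p M" and e': "e \<in> dom_of d'" and K: "connection_at E p M K e"
  shows "conn_coeff E p M K c' d' (coord d' e) (rep_deriv c c' (\<lambda>b. b) (p e) w) =
    snd (rep_deriv d d' (\<lambda>e. e) e (w, conn_coeff E p M K c d (coord d e) w))"
proof -
  note at = fibred_charts_at[OF cd e] and at' = fibred_charts_at[OF cd' e']
  let ?v = "tangent_of_comp M (p e) c w" and ?w' = "rep_deriv c c' (\<lambda>b. b) (p e) w"
  have v: "?v \<in> tangent_space M (p e)" by (rule tangent_of_comp_in[OF M at(2)])
  have "comp ?v c' = ?w'" by (rule comp_tangent_of_comp_change[OF at'(2)])
  then have "?v = tangent_of_comp M (p e) c' ?w'"
    using tangent_of_comp_comp[OF M at'(2) v] by simp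
  then have "comp (K e ?v) d' = (?w', conn_coeff E p M K c' d' (coord d' e) ?w')"
    using comp_connection[OF cd' e' K] by simp
  moreover have "K e ?v \<in> tangent_space E e" using K v by (simp add: connection_at_def)
  then have "comp (K e ?v) d' = rep_deriv d d' (\<lambda>e. e) e (comp (K e ?v) d)"
    by (rule tangent_comp_change[OF _ at(1) at'(1)])
  ultimately show ?thesis using comp_connection[OF cd e K, of w] by (metis snd_conv)
qed

lemma base_change_inverse:
  assumes "c \<in> charts_at M b" "c' \<in> charts_at M b"
  shows "rep_deriv c' c (\<lambda>b. b) b (rep_deriv c c' (\<lambda>b. b) b w) = w"
  using rep_deriv_compose[OF charts_atD(2,3)[OF assms(1)] charts_atD(2)[OF assms(2)]
    charts_rep_smooth[OF M assms] charts_rep_smooth[OF M assms(2,1)], of w]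
  by (simp add: rep_deriv_id[OF charts_atD(2,3)[OF assms(1)]])

context
  fixes K c d e0
  assumes cd: "(c, d) \<in> fibred_charts E p M" and e0: "e0 \<in> dom_of d"
    and K: "\<forall>\<^sub>F z in nhds (coord d e0). connection_at E p M K (coord_inv d z)"
    and lin: "\<forall>\<^sub>F z in nhds (coord d e0). linear (conn_coeff E p M K c d z)"
    and sm: "\<And>w. smooth_at (\<lambda>z. conn_coeff E p M K c d z w) (coord d e0)"
begin

context
  fixes c' d'
  assumes cd': "(c', d') \<in> fibred_charts E p M" and e0': "e0 \<in> dom_of d'"
begin

text \<open>
  Linearity and smoothness of the coefficients carry over from one fibred chart to another,
  since the coefficients in \<open>(c', d')\<close> are an explicit expression in those in \<open>(c, d)\<close>.
\<close>

lemma
  shows linear_conn_coeff_change: "\<forall>\<^sub>F z in nhds (coord d' e0). linear (conn_coeff E p M K c' d' z)"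
    and smooth_conn_coeff_change: "smooth_at (\<lambda>z. conn_coeff E p M K c' d' z w) (coord d' e0)"
proof -
  note at = fibred_charts_at[OF cd e0] and at' = fibred_charts_at[OF cd' e0']
  note isc = charts_atD(2)[OF at(1)] charts_atD(2)[OF at'(1)] charts_atD(2)[OF at(2)] charts_atD(2)[OF at'(2)]
  let ?\<tau> = "\<lambda>z. coord d' (coord_inv d z)" and ?\<sigma> = "\<lambda>z. coord d (coord_inv d' z)"
  let ?\<psi> = "\<lambda>x. coord c (coord_inv c' x)"
  let ?\<kappa> = "conn_coeff E p M K c d"
  define W where "W z w = frechet_derivative ?\<psi> (at (fst z)) w" for z :: "'x \<times> 'y" and w
  define k' where "k' z w = snd (frechet_derivative ?\<tau> (at (?\<sigma> z)) (W z w, ?\<kappa> (?\<sigma> z) (W z w)))" for z w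
  have rep: "rep_smooth d d' (\<lambda>e. e) e0" "rep_smooth d' d (\<lambda>e. e) e0" "rep_smooth c' c (\<lambda>b. b) (p e0)"
    using charts_rep_smooth[OF E] charts_rep_smooth[OF M] at at' by blast+
  have \<tau>: "smooth_at ?\<tau> (coord d e0)" and \<sigma>: "smooth_at ?\<sigma> (coord d' e0)"
    and \<psi>: "smooth_at ?\<psi> (coord c' (p e0))"
    using rep by (simp_all add: rep_smooth_def)
  have \<sigma>0: "?\<sigma> (coord d' e0) = coord d e0" by (simp add: coord_inv_coord[OF isc(2) e0'])
  have fst0: "fst (coord d' e0) = coord c' (p e0)" by (rule fibred_chartsD(4)[OF cd' e0'])
  have K': "\<forall>\<^sub>F z in nhds (coord d' e0). connection_at E p M K (coord_inv d' z)"
    by (rule rep_smooth_eventually[OF isc(2) e0' isc(1) rep(2) K])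
  have dom: "\<forall>\<^sub>F z in nhds (coord d' e0). coord_inv d' z \<in> dom_of d" using rep(2) by (simp add: rep_smooth_def)
  have eq: "\<forall>\<^sub>F z in nhds (coord d' e0). conn_coeff E p M K c' d' z = k' z"
    using K' dom eventually_in_chart[OF isc(2) e0']
  proof eventually_elim
    case (elim z)
    let ?e = "coord_inv d' z"
    have e': "?e \<in> dom_of d'" "coord d' ?e = z" using elim(3) by (simp_all add: coord_inv_in_dom coord_coord_inv)
    note bt = fibred_charts_at[OF cd elim(2)] fibred_charts_at[OF cd' e'(1)]
    have fz: "coord c' (p ?e) = fst z" using fibred_chartsD(4)[OF cd' e'(1)] e'(2) by simp
    show ?case
    proof
      fix w
      let ?w = "rep_deriv c' c (\<lambda>b. b) (p ?e) w"
      have "W z w = ?w" by (simp add: W_def rep_deriv_def fz)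
      then have "k' z w = snd (rep_deriv d d' (\<lambda>e. e) ?e (?w, ?\<kappa> (coord d ?e) ?w))"
        by (simp add: k'_def rep_deriv_def)
      also have "\<dots> = conn_coeff E p M K c' d' z (rep_deriv c c' (\<lambda>b. b) (p ?e) ?w)"
        using conn_coeff_change[OF cd elim(2) cd' e'(1) elim(1), of ?w] e'(2) by simp
      also have "\<dots> = conn_coeff E p M K c' d' z w" by (simp add: base_change_inverse[OF bt(5,2)])
      finally show "conn_coeff E p M K c' d' z w = k' z w" by simp
    qed
  qed
  have lin\<tau>: "\<forall>\<^sub>F z in nhds (coord d' e0). linear (frechet_derivative ?\<tau> (at (?\<sigma> z)))"
  proof -
    have "\<forall>\<^sub>F z in nhds (?\<sigma> (coord d' e0)). linear (frechet_derivative ?\<tau> (at z))"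
      unfolding \<sigma>0 using smooth_at_eventually[OF \<tau>] by eventually_elim (rule smooth_at_linear_derivative)
    then show ?thesis by (rule smooth_at_eventually_compose[OF \<sigma>])
  qed
  have lin\<kappa>: "\<forall>\<^sub>F z in nhds (coord d' e0). linear (?\<kappa> (?\<sigma> z))"
  proof -
    have "\<forall>\<^sub>F z in nhds (?\<sigma> (coord d' e0)). linear (?\<kappa> z)" unfolding \<sigma>0 by (rule lin)
    then show ?thesis by (rule smooth_at_eventually_compose[OF \<sigma>])
  qed
  have linW: "\<forall>\<^sub>F z in nhds (coord d' e0). linear (W z)"
  proof -
    have "\<forall>\<^sub>F x in nhds (fst (coord d' e0)). linear (frechet_derivative ?\<psi> (at x))"
      unfolding fst0 using smooth_at_eventually[OF \<psi>] by eventually_elim (rule smooth_at_linear_derivative)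
    then have "\<forall>\<^sub>F z in nhds (coord d' e0). linear (frechet_derivative ?\<psi> (at (fst z)))"
      by (rule eventually_nhds_fst)
    then show ?thesis by eventually_elim (simp add: W_def[abs_def])
  qed
  from eq lin\<tau> lin\<kappa> linW show "\<forall>\<^sub>F z in nhds (coord d' e0). linear (conn_coeff E p M K c' d' z)"
  proof eventually_elim
    case (elim z)
    have "linear (k' z)"
      by (rule linearI)
        (simp_all add: k'_def linear_add[OF elim(4)] linear_scale[OF elim(4)] linear_add[OF elim(3)]
          linear_scale[OF elim(3)] linear_add[OF elim(2), symmetric] linear_scale[OF elim(2), symmetric]
          flip: snd_add snd_scaleR)
    then show ?case using elim(1) by simp
  qed
  have sW: "smooth_at (\<lambda>z. W z w) (coord d' e0)"
    unfolding W_def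
    by (rule smooth_at_compose[OF smooth_at_bounded_linear[OF bounded_linear_fst]])
      (unfold fst0, rule smooth_at_derivative[OF \<psi>])
  have s\<kappa>: "smooth_at (\<lambda>z. ?\<kappa> (?\<sigma> z) b) (coord d' e0)" for b
    by (rule smooth_at_compose[OF \<sigma>]) (unfold \<sigma>0, rule sm)
  have s\<tau>: "smooth_at (\<lambda>z. frechet_derivative ?\<tau> (at (?\<sigma> z)) b) (coord d' e0)" for b
    by (rule smooth_at_compose[OF \<sigma>]) (unfold \<sigma>0, rule smooth_at_derivative[OF \<tau>])
  have "smooth_at (\<lambda>z. k' z w) (coord d' e0)"
    unfolding k'_def
    by (rule smooth_at_snd[OF smooth_at_linear_family[OF lin\<tau> s\<tau>
          smooth_at_Pair[OF sW smooth_at_linear_family[OF lin\<kappa> s\<kappa> sW]]]])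
  moreover have "\<forall>\<^sub>F z in nhds (coord d' e0). conn_coeff E p M K c' d' z w = k' z w"
    using eq by eventually_elim simp
  ultimately show "smooth_at (\<lambda>z. conn_coeff E p M K c' d' z w) (coord d' e0)"
    by (simp add: smooth_at_cong)
qed

lemma curv_term_change:
  fixes u v :: 'x
  defines "u' \<equiv> rep_deriv c c' (\<lambda>b. b) (p e0) u" and "v' \<equiv> rep_deriv c c' (\<lambda>b. b) (p e0) v"
  shows "snd (rep_deriv d d' (\<lambda>e. e) e0
      (0, curv_term E p M K c d (coord d e0) u v - curv_term E p M K c d (coord d e0) v u)) =
    curv_term E p M K c' d' (coord d' e0) u' v' - curv_term E p M K c' d' (coord d' e0) v' u'"
proof -
  note at = fibred_charts_at[OF cd e0] and at' = fibred_charts_at[OF cd' e0']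
  note isc = charts_atD(2)[OF at(1)] charts_atD(2)[OF at'(1)]
  let ?\<tau> = "\<lambda>z. coord d' (coord_inv d z)" and ?\<phi> = "\<lambda>x. coord c' (coord_inv c x)"
  let ?\<kappa> = "conn_coeff E p M K c d" and ?\<kappa>' = "conn_coeff E p M K c' d'"
  have rep: "rep_smooth d d' (\<lambda>e. e) e0" "rep_smooth c c' (\<lambda>b. b) (p e0)"
    using charts_rep_smooth[OF E] charts_rep_smooth[OF M] at at' by blast+
  have \<tau>0: "?\<tau> (coord d e0) = coord d' e0" by (simp add: coord_inv_coord[OF isc(1) e0])
  have fst0: "fst (coord d e0) = coord c (p e0)" by (rule fibred_chartsD(4)[OF cd e0])
  have dom: "\<forall>\<^sub>F z in nhds (coord d e0). coord_inv d z \<in> dom_of d'" using rep(1) by (simp add: rep_smooth_def)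
  have "snd (frechet_derivative ?\<tau> (at (coord d e0))
      (0, frechet_derivative (\<lambda>y. ?\<kappa> y v) (at (coord d e0)) (u, ?\<kappa> (coord d e0) u) -
        frechet_derivative (\<lambda>y. ?\<kappa> y u) (at (coord d e0)) (v, ?\<kappa> (coord d e0) v))) =
    frechet_derivative (\<lambda>y. ?\<kappa>' y (frechet_derivative ?\<phi> (at (fst (coord d e0))) v)) (at (?\<tau> (coord d e0)))
      (frechet_derivative ?\<phi> (at (fst (coord d e0))) u,
       ?\<kappa>' (?\<tau> (coord d e0)) (frechet_derivative ?\<phi> (at (fst (coord d e0))) u)) -
    frechet_derivative (\<lambda>y. ?\<kappa>' y (frechet_derivative ?\<phi> (at (fst (coord d e0))) u)) (at (?\<tau> (coord d e0)))
      (frechet_derivative ?\<phi> (at (fst (coord d e0))) v,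
       ?\<kappa>' (?\<tau> (coord d e0)) (frechet_derivative ?\<phi> (at (fst (coord d e0))) v))"
  proof (rule curvature_transformation)
    show "smooth_at ?\<tau> (coord d e0)" using rep(1) by (simp add: rep_smooth_def)
    show "smooth_at ?\<phi> (fst (coord d e0))" using rep(2) by (simp add: rep_smooth_def fst0)
    show "\<forall>\<^sub>F y in nhds (coord d e0). fst (?\<tau> y) = ?\<phi> (fst y)"
      using dom eventually_in_chart[OF isc(1) e0]
    proof eventually_elim
      case (elim z)
      have e: "coord_inv d z \<in> dom_of d" "coord d (coord_inv d z) = z"
        using elim(2) by (simp_all add: coord_inv_in_dom coord_coord_inv)
      have "fst z = coord c (p (coord_inv d z))" using fibred_chartsD(4)[OF cd e(1)] e(2) by simp
      then show ?case
        using fibred_chartsD(4)[OF cd' elim(1)] coord_inv_coord[OF charts_is_chart[OF fibred_chartsD(1)[OF cd]]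
          fibred_chartsD(3)[OF cd e(1)]] by simp
    qed
    show "smooth_at (\<lambda>y. ?\<kappa> y w) (coord d e0)" for w by (rule sm)
    show "\<forall>\<^sub>F y in nhds (?\<tau> (coord d e0)). linear (?\<kappa>' y)" unfolding \<tau>0 by (rule linear_conn_coeff_change)
    show "smooth_at (\<lambda>y. ?\<kappa>' y w) (?\<tau> (coord d e0))" for w unfolding \<tau>0 by (rule smooth_conn_coeff_change)
    show "\<forall>\<^sub>F y in nhds (coord d e0). \<forall>w. ?\<kappa>' (?\<tau> y) (frechet_derivative ?\<phi> (at (fst y)) w) =
        snd (frechet_derivative ?\<tau> (at y) (w, ?\<kappa> y w))"
      using dom K eventually_in_chart[OF isc(1) e0]
    proof eventually_elim
      case (elim z)
      have e: "coord_inv d z \<in> dom_of d" "coord d (coord_inv d z) = z"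
        using elim(3) by (simp_all add: coord_inv_in_dom coord_coord_inv)
      have "fst z = coord c (p (coord_inv d z))" using fibred_chartsD(4)[OF cd e(1)] e(2) by simp
      then show ?case
        using conn_coeff_change[OF cd e(1) cd' elim(1,2)] e(2) by (simp add: rep_deriv_def)
    qed
  qed
  then show ?thesis unfolding \<tau>0 fst0 curv_term_def u'_def v'_def rep_deriv_def .
qed

end

abbreviation (input) "curv_comp b e u v \<equiv>
  (- 2) *\<^sub>R (curv_term E p M K b e (coord e e0) (comp u b) (comp v b) -
             curv_term E p M K b e (coord e e0) (comp v b) (comp u b))"

text \<open>
  The components prescribed in the various fibred charts are consistent by \<open>curv_term_change\<close>, so
  one tangent vector has them all; and those in \<open>(c, d)\<close> leave no choice for a vertical vector.
\<close>

theorem curvature_in_chart: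
  assumes u: "u \<in> tangent_space M (p e0)" and v: "v \<in> tangent_space M (p e0)"
  shows "curvature E p M K e0 u v = tangent_of_comp E e0 d
    (0, curv_comp c d u v)"
  unfolding curvature_def
proof (rule the_equality)
  note at = fibred_charts_at[OF cd e0]
  let ?r = "curv_comp c d u v"
  let ?w = "tangent_of_comp E e0 d (0, ?r)"
  have w: "?w \<in> tangent_space E e0" by (rule tangent_of_comp_in[OF E at(1)])
  have cw: "comp ?w d = (0, ?r)" by (rule comp_tangent_of_comp[OF at(1)])
  show "?w \<in> vertical_space E p M e0 \<and>
      (\<forall>(c, d)\<in>fibred_charts E p M. e0 \<in> dom_of d \<longrightarrow> snd (comp ?w d) =
        curv_comp c d u v)"
  proof (intro conjI)
    have "tangent_map E M p ?w = (p e0, \<lambda>_. 0)"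
      by (rule tangent_eqI[OF tangent_map_in[OF E M at(3) w] zero_in_tangent_space[OF M] at(2)])
        (unfold comp_tangent_map_fibred[OF cd e0 w] cw, simp)
    then show "?w \<in> vertical_space E p M e0" using w by (simp add: vertical_space_def)
    show "\<forall>(c, d)\<in>fibred_charts E p M. e0 \<in> dom_of d \<longrightarrow> snd (comp ?w d) =
        curv_comp c d u v"
    proof (intro ballI, clarify)
      fix c' d' assume cd': "(c', d') \<in> fibred_charts E p M" and e0': "e0 \<in> dom_of d'"
      note at' = fibred_charts_at[OF cd' e0']
      let ?R = "curv_term E p M K c d (coord d e0) (comp u c) (comp v c) -
                   curv_term E p M K c d (coord d e0) (comp v c) (comp u c)"
      have lin: "linear (rep_deriv d d' (\<lambda>e. e) e0)"
        by (rule linear_rep_deriv[OF charts_rep_smooth[OF E at(1) at'(1)]])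
      have "comp ?w d' = rep_deriv d d' (\<lambda>e. e) e0 ((- 2) *\<^sub>R (0, ?R))"
        unfolding tangent_comp_change[OF w at(1) at'(1)] cw by simp
      also have "\<dots> = (- 2) *\<^sub>R rep_deriv d d' (\<lambda>e. e) e0 (0, ?R)" by (rule linear_scale[OF lin])
      finally have "snd (comp ?w d') = (- 2) *\<^sub>R snd (rep_deriv d d' (\<lambda>e. e) e0 (0, ?R))" by simp
      also have "\<dots> = curv_comp c' d' u v"
        unfolding curv_term_change[OF cd' e0']
        unfolding tangent_comp_change[OF u at(2) at'(2)] tangent_comp_change[OF v at(2) at'(2)] ..
      finally show "snd (comp ?w d') = curv_comp c' d' u v" .
    qed
  qed
  fix w' assume w': "w' \<in> vertical_space E p M e0 \<and>
      (\<forall>(c, d)\<in>fibred_charts E p M. e0 \<in> dom_of d \<longrightarrow> snd (comp w' d) =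
        curv_comp c d u v)"
  then have T: "w' \<in> tangent_space E e0" "tangent_map E M p w' = (p e0, \<lambda>_. 0)"
    by (simp_all add: vertical_space_def)
  have "fst (comp w' d) = 0" using comp_tangent_map_fibred[OF cd e0 T(1)] T(2) by simp
  moreover have "snd (comp w' d) = ?r" using w' cd e0 by blast
  ultimately have "comp w' d = comp ?w d" unfolding cw by (simp add: prod_eq_iff)
  then show "w' = ?w" by (rule tangent_eqI[OF T(1) w at(1)])
qed

end

end

section \<open>Systems of connections\<close>

context
  fixes B :: "('b, 'x::coordinate_space) manifold"
    and F :: "('f, 'x \<times> 'y::coordinate_space) manifold"
    and C :: "('c, 'x \<times> 'z::coordinate_space) manifold"
    and p :: "'f \<Rightarrow> 'b" and \<zeta> :: "'c \<Rightarrow> 'b"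
    and \<epsilon> :: "'c \<Rightarrow> 'f \<Rightarrow> ('b, 'x) tvec \<Rightarrow> ('f, 'x \<times> 'y) tvec"
  assumes fibF: "smooth_fibred_manifold F p B"
    and fibC: "smooth_fibred_manifold C \<zeta> B"
    and sys: "smooth_connection_system C \<zeta> F p B \<epsilon>"
begin

lemmas atlas_F = smooth_fibred_manifoldD(1)[OF fibF]
  and atlas_B = smooth_fibred_manifoldD(2)[OF fibF]
  and atlas_C = smooth_fibred_manifoldD(1)[OF fibC]

lemma smooth_zeta: "\<forall>k\<in>points C. smooth_pt C B \<zeta> k"
  by (intro ballI smooth_fibred_manifoldD(3)[OF fibC])

lemma
  assumes "k \<in> points C" "f \<in> points F" "\<zeta> k = p f"
  shows eps_in: "v \<in> tangent_space B (p f) \<Longrightarrow> \<epsilon> k f v \<in> tangent_space F f"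
    and eps_proj: "v \<in> tangent_space B (p f) \<Longrightarrow> tangent_map F B p (\<epsilon> k f v) = v"
    and eps_add: "u \<in> tangent_space B (p f) \<Longrightarrow> v \<in> tangent_space B (p f) \<Longrightarrow>
      \<epsilon> k f (tangent_add u v) = tangent_add (\<epsilon> k f u) (\<epsilon> k f v)"
    and eps_scale: "v \<in> tangent_space B (p f) \<Longrightarrow>
      \<epsilon> k f (tangent_scale r v) = tangent_scale r (\<epsilon> k f v)"
  using sys assms unfolding smooth_connection_system_def by simp_all

abbreviation (input) "Fup \<equiv> F_up C \<zeta> F p B"

abbreviation (input) "epsup \<equiv> eps_up C \<zeta> F p B \<epsilon>"

lemma atlas_F_up: "smooth_atlas Fup"
  unfolding F_up_def by (rule smooth_atlas_fibre_product[OF atlas_C atlas_B atlas_F smooth_zeta])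

text \<open>
  The common base chart \<open>c\<close> makes both \<open>p\<close> and \<open>\<zeta>\<close> the projection to the first factor, so that
  the components of \<open>T\<zeta>(X)\<close> are among those of \<open>X\<close>.
\<close>

lemma ex_fibred_charts_same_base:
  assumes "k \<in> points C" "f \<in> points F" "\<zeta> k = p f"
  obtains c d a where "(c, d) \<in> fibred_charts F p B" "(c, a) \<in> fibred_charts C \<zeta> B" "f \<in> dom_of d" "k \<in> dom_of a"
proof -
  obtain c where c: "c \<in> charts_at B (p f)"
    using smooth_fibred_manifoldD(3)[OF fibF assms(2)] unfolding smooth_pt_def by blast
  obtain d where d: "(c, d) \<in> fibred_charts F p B" "f \<in> dom_of d"
    by (rule ex_fibred_chart[OF fibF assms(2) c])
  obtain a where a: "(c, a) \<in> fibred_charts C \<zeta> B" "k \<in> dom_of a"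
    by (rule ex_fibred_chart[OF fibC assms(1), of c]) (use c assms(3) in simp_all)
  show thesis by (rule that[OF d(1) a(1) d(2) a(2)])
qed

context
  fixes c d a
  assumes cd: "(c, d) \<in> fibred_charts F p B" and ca: "(c, a) \<in> fibred_charts C \<zeta> B"
begin

lemmas base_chart_in = fibred_chartsD(2)[OF ca]
lemmas up_chart_facts [unfolded F_up_def[symmetric]] =
  product_chart_in_charts[OF atlas_C atlas_B atlas_F smooth_zeta base_chart_in cd]
  fibred_chart_product_chart[OF atlas_C atlas_B atlas_F smooth_zeta base_chart_in cd]
lemmas is_up_chart = is_chart_product_chart[OF atlas_C atlas_B atlas_F smooth_zeta base_chart_in cd]

context
  fixes k f
  assumes kf: "(k, f) \<in> dom_of (product_chart \<zeta> p a d)"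
begin

lemma point_facts: "k \<in> dom_of a" "f \<in> dom_of d" "\<zeta> k = p f" "k \<in> points C" "f \<in> points F"
proof -
  show 1: "k \<in> dom_of a" "f \<in> dom_of d" "\<zeta> k = p f" using kf by (simp_all add: dom_product_chart)
  show "k \<in> points C" "f \<in> points F"
    using 1 charts_dom[OF base_chart_in] charts_dom[OF fibred_chartsD(2)[OF cd]] by blast+
qed

lemma charts_at_facts:
  "a \<in> charts_at C k" "d \<in> charts_at F f" "c \<in> charts_at B (p f)" "c \<in> charts_at B (\<zeta> k)"
  "product_chart \<zeta> p a d \<in> charts_at Fup (k, f)"
  using point_facts base_chart_in fibred_chartsD[OF cd] up_chart_facts(1) kf
  by (simp_all add: charts_atI)

lemma smooth_pt_projections:
  "smooth_pt Fup C fst (k, f)" "smooth_pt Fup F snd (k, f)"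
proof -
  note pf = product_chart_fst[OF atlas_C atlas_B atlas_F smooth_zeta base_chart_in cd kf]
    and ps = product_chart_snd[OF atlas_C atlas_B atlas_F smooth_zeta base_chart_in cd kf]
  show "smooth_pt Fup C fst (k, f)"
    by (rule smooth_ptI[OF charts_at_facts(5) _ pf]) (simp add: charts_at_facts)
  show "smooth_pt Fup F snd (k, f)"
    by (rule smooth_ptI[OF charts_at_facts(5) _ ps]) (simp add: charts_at_facts)
qed

lemma
  assumes W: "W \<in> tangent_space Fup (k, f)"
  shows comp_fst_up: "comp (tangent_map Fup C fst W) a = fst (comp W (product_chart \<zeta> p a d))"
    and comp_snd_up: "comp (tangent_map Fup F snd W) d =
      (fst (fst (comp W (product_chart \<zeta> p a d))), snd (comp W (product_chart \<zeta> p a d)))"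
    and fst_up_in: "tangent_map Fup C fst W \<in> tangent_space C k"
    and snd_up_in: "tangent_map Fup F snd W \<in> tangent_space F f"
proof -
  show "comp (tangent_map Fup C fst W) a = fst (comp W (product_chart \<zeta> p a d))"
    using comp_tangent_map[OF atlas_F_up atlas_C smooth_pt_projections(1) W charts_at_facts(5), of a]
    by (simp add: charts_at_facts product_chart_deriv_fst[OF atlas_C atlas_B atlas_F smooth_zeta base_chart_in cd kf])
  show "comp (tangent_map Fup F snd W) d =
      (fst (fst (comp W (product_chart \<zeta> p a d))), snd (comp W (product_chart \<zeta> p a d)))"
    using comp_tangent_map[OF atlas_F_up atlas_F smooth_pt_projections(2) W charts_at_facts(5), of d]
    by (simp add: charts_at_facts product_chart_deriv_snd[OF atlas_C atlas_B atlas_F smooth_zeta base_chart_in cd kf]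
      fibred_chart_rep_deriv[OF ca point_facts(1)])
  show "tangent_map Fup C fst W \<in> tangent_space C k"
    using tangent_map_in[OF atlas_F_up atlas_C smooth_pt_projections(1) W] by simp
  show "tangent_map Fup F snd W \<in> tangent_space F f"
    using tangent_map_in[OF atlas_F_up atlas_F smooth_pt_projections(2) W] by simp
qed

lemma comp_zeta:
  assumes "X \<in> tangent_space C k"
  shows "comp (tangent_map C B \<zeta> X) c = fst (comp X a)"
  by (rule comp_tangent_map_fibred[OF atlas_C atlas_B ca point_facts(1) assms])

lemma zeta_in:
  assumes "X \<in> tangent_space C k"
  shows "tangent_map C B \<zeta> X \<in> tangent_space B (p f)"
  using tangent_map_in[OF atlas_C atlas_B bspec[OF smooth_zeta point_facts(4)] assms] by (simp add: point_facts(3))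

text \<open>
  A tangent vector of \<open>F\<^sup>\<up>\<close> is determined by its two projections, as its components in the chart
  show. The pair of \<open>X\<close> and \<open>\<epsilon> k f (T\<zeta>(X))\<close> is realised by one because both project to \<open>T\<zeta>(X)\<close>.
\<close>

lemma
  assumes X: "X \<in> tangent_space C k"
  shows eps_up_in: "epsup (k, f) X \<in> tangent_space Fup (k, f)"
    and eps_up_fst: "tangent_map Fup C fst (epsup (k, f) X) = X"
    and eps_up_snd: "tangent_map Fup F snd (epsup (k, f) X) =
      \<epsilon> k f (tangent_map C B \<zeta> X)"
proof -
  let ?T = "\<epsilon> k f (tangent_map C B \<zeta> X)" and ?D = "product_chart \<zeta> p a d"
  let ?P = "\<lambda>W. W \<in> tangent_space Fup (k, f) \<and> tangent_map Fup C fst W = X \<and> tangent_map Fup F snd W = ?T"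
  have T: "?T \<in> tangent_space F f" by (rule eps_in[OF point_facts(4,5,3) zeta_in[OF X]])
  have "fst (comp ?T d) = comp (tangent_map F B p ?T) c"
    by (rule comp_tangent_map_fibred[OF atlas_F atlas_B cd point_facts(2) T, symmetric])
  also have "\<dots> = fst (comp X a)"
    unfolding eps_proj[OF point_facts(4,5,3) zeta_in[OF X]] by (rule comp_zeta[OF X])
  finally have fstT: "fst (comp ?T d) = fst (comp X a)" .
  let ?W = "tangent_of_comp Fup (k, f) ?D (comp X a, snd (comp ?T d))"
  have W: "?W \<in> tangent_space Fup (k, f)" by (rule tangent_of_comp_in[OF atlas_F_up charts_at_facts(5)])
  have cW: "comp ?W ?D = (comp X a, snd (comp ?T d))" by (rule comp_tangent_of_comp[OF charts_at_facts(5)])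
  have "?P ?W"
  proof (intro conjI W)
    show "tangent_map Fup C fst ?W = X"
      by (rule tangent_eqI[OF fst_up_in[OF W] X charts_at_facts(1)]) (unfold comp_fst_up[OF W] cW, simp)
    show "tangent_map Fup F snd ?W = ?T"
      by (rule tangent_eqI[OF snd_up_in[OF W] T charts_at_facts(2)])
        (unfold comp_snd_up[OF W] cW, simp add: prod_eq_iff fstT)
  qed
  moreover have "W' = ?W" if W': "?P W'" for W'
  proof (rule tangent_eqI[OF conjunct1[OF W'] W charts_at_facts(5)])
    have "fst (comp W' ?D) = comp X a" "snd (comp W' ?D) = snd (comp ?T d)"
      using comp_fst_up[OF conjunct1[OF W']] comp_snd_up[OF conjunct1[OF W']] W' by simp_all
    then show "comp W' ?D = comp ?W ?D" unfolding cW by (simp add: prod_eq_iff)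
  qed
  ultimately have "?P (THE W. ?P W)" by (rule theI)
  then show "epsup (k, f) X \<in> tangent_space Fup (k, f)"
    "tangent_map Fup C fst (epsup (k, f) X) = X"
    "tangent_map Fup F snd (epsup (k, f) X) = ?T"
    unfolding eps_up_def by simp_all
qed

end

end

text \<open>Surjectivity of \<open>T\<zeta>\<close> makes the factor unique.\<close>

lemma reducing_factor_eps_up:
  assumes kf: "k \<in> points C" "f \<in> points F" "\<zeta> k = p f" and v: "v \<in> tangent_space B (p f)"
  shows "reducing_factor C \<zeta> F p B epsup (k, f) v = \<epsilon> k f v"
proof -
  obtain c d a where ch: "(c, d) \<in> fibred_charts F p B" "(c, a) \<in> fibred_charts C \<zeta> B" "f \<in> dom_of d" "k \<in> dom_of a"
    by (rule ex_fibred_charts_same_base[OF kf])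
  have dom: "(k, f) \<in> dom_of (product_chart \<zeta> p a d)" using ch(3,4) kf(3) by (simp add: dom_product_chart)
  have "v \<in> tangent_map C B \<zeta> ` tangent_space C k"
    using smooth_fibred_manifoldD(4)[OF fibC kf(1)] v kf(3) by simp
  then obtain X where X: "v = tangent_map C B \<zeta> X" "X \<in> tangent_space C k" by (rule imageE)
  have "(THE w. \<forall>X\<in>tangent_space C k. tangent_map C B \<zeta> X = v \<longrightarrow>
      tangent_map Fup F snd (epsup (k, f) X) = w) = \<epsilon> k f v"
  proof (rule the_equality)
    show "\<forall>X\<in>tangent_space C k. tangent_map C B \<zeta> X = v \<longrightarrow>
        tangent_map Fup F snd (epsup (k, f) X) = \<epsilon> k f v"
      by (simp add: eps_up_snd[OF ch(1,2) dom])
    fix w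
    assume "\<forall>X\<in>tangent_space C k. tangent_map C B \<zeta> X = v \<longrightarrow>
        tangent_map Fup F snd (epsup (k, f) X) = w"
    from bspec[OF this X(2)] show "w = \<epsilon> k f v"
      using X by (simp add: eps_up_snd[OF ch(1,2) dom])
  qed
  then show ?thesis unfolding reducing_factor_def by simp
qed

subsection \<open>Coefficients of the evaluation map\<close>

text \<open>
  These coefficients determine both connections: they are those of \<open>\<epsilon>\<^sup>\<up>\<close> and, after substitution
  of \<open>\<gamma>\<close>, those of the connection given by \<open>\<gamma>\<close>.
\<close>

definition eps_coeff where
  "eps_coeff c d a q w =
     (let kf = coord_inv (product_chart \<zeta> p a d) q in
      snd (comp (\<epsilon> (fst kf) (snd kf) (tangent_of_comp B (p (snd kf)) c w)) d))"

lemma smooth_zeta_fst: "\<forall>q\<in>points Fup. smooth_pt Fup B (\<lambda>(k, f). \<zeta> k) q"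
proof
  fix q assume "q \<in> points Fup"
  then obtain b where "b \<in> Fup" "q \<in> dom_of b" unfolding points_def by blast
  then obtain a c d where b: "b = product_chart \<zeta> p a d" "a \<in> charts C" "(c, d) \<in> fibred_charts F p B"
    unfolding F_up_def fibre_product_eq by (elim CollectE exE conjE) (rule that)
  have q: "q \<in> dom_of (product_chart \<zeta> p a d)" using \<open>q \<in> dom_of b\<close> b(1) by simp
  have k: "fst q \<in> dom_of a" using q by (simp add: dom_product_chart)
  have at: "product_chart \<zeta> p a d \<in> charts_at Fup q"
    unfolding F_up_def
    by (rule charts_atI[OF product_chart_in_charts[OF atlas_C atlas_B atlas_F smooth_zeta b(2,3)] q])
  have "smooth_pt Fup C fst q"
    by (rule smooth_ptI[OF at charts_atI[OF b(2) k]
      product_chart_fst[OF atlas_C atlas_B atlas_F smooth_zeta b(2,3) q]])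
  moreover have "smooth_pt C B \<zeta> (fst q)" using k charts_dom[OF b(2)] by (intro bspec[OF smooth_zeta]) blast
  ultimately have "smooth_pt Fup B (\<lambda>q. \<zeta> (fst q)) q" by (rule smooth_pt_compose[OF atlas_C])
  then show "smooth_pt Fup B (\<lambda>(k, f). \<zeta> k) q" by (simp add: case_prod_unfold)
qed

context
  fixes c d a
  assumes cd: "(c, d) \<in> fibred_charts F p B" and ca: "(c, a) \<in> fibred_charts C \<zeta> B"
begin

abbreviation (input) "up_chart \<equiv> product_chart \<zeta> p a d"

lemma eps_coeff_coord:
  assumes "(k, f) \<in> dom_of up_chart"
  shows "eps_coeff c d a (coord up_chart (k, f)) w = snd (comp (\<epsilon> k f (tangent_of_comp B (p f) c w)) d)"
  using coord_inv_coord[OF is_up_chart[OF cd ca] assms] by (simp add: eps_coeff_def)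

text \<open>
  Smoothness of \<open>\<epsilon>\<close> is a statement about \<open>F\<^sup>\<up> \<times>\<^sub>B TB\<close>. It is pulled back along \<open>h\<close>, which attaches to
  a point of \<open>F\<^sup>\<up>\<close> the vector with the constant components \<open>w\<close>.
\<close>

lemma smooth_eps_coeff:
  assumes q0: "q0 \<in> dom_of up_chart"
  shows "smooth_at (\<lambda>q. eps_coeff c d a q w) (coord up_chart q0)"
proof -
  let ?g = "\<lambda>(k, f). \<zeta> k"
  let ?Y = "fibre_product Fup ?g B (tangent_bundle B) fst"
  let ?Yc = "product_chart ?g fst up_chart (tangent_chart B c)"
  let ?E = "\<lambda>((k, f), v). \<epsilon> k f v"
  obtain k0 f0 where kf0: "q0 = (k0, f0)" by (cases q0)
  note q = q0[unfolded kf0]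
  note pts = point_facts[OF cd ca q] and at = charts_at_facts[OF cd ca q]
  note isD = is_up_chart[OF cd ca]
  have c: "c \<in> charts B" by (rule fibred_chartsD(1)[OF cd])
  have Din: "up_chart \<in> charts Fup" by (rule up_chart_facts(1)[OF cd ca])
  note TB = smooth_atlas_tangent_bundle[OF atlas_B] and TF = smooth_atlas_tangent_bundle[OF atlas_F]
  note ctb = fibred_chart_tangent_bundle[OF atlas_B c]
  have atlas_Y: "smooth_atlas ?Y"
    by (rule smooth_atlas_fibre_product[OF atlas_F_up atlas_B TB smooth_zeta_fst])
  have Yc: "?Yc \<in> charts ?Y"
    by (rule product_chart_in_charts[OF atlas_F_up atlas_B TB smooth_zeta_fst Din ctb])
  define h where "h = (\<lambda>q::'c \<times> 'f. (q, tangent_of_comp B (p (snd q)) c w))"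
  have dom_h: "h r \<in> dom_of ?Yc" "c \<in> charts_at B (p (snd r))" if r: "r \<in> dom_of up_chart" for r
  proof -
    have r': "fst r \<in> dom_of a" "snd r \<in> dom_of d" "\<zeta> (fst r) = p (snd r)"
      using r by (simp_all add: dom_product_chart)
    show cr: "c \<in> charts_at B (p (snd r))"
      using fibred_chartsD(3)[OF cd r'(2)] c by (simp add: charts_atI)
    show "h r \<in> dom_of ?Yc"
      using r r'(3) charts_atD(3)[OF cr] tangent_of_comp_in[OF atlas_B cr]
      by (simp add: dom_product_chart h_def dom_tangent_chart case_prod_unfold)
  qed
  have Eh: "?E (h r) = \<epsilon> (fst r) (snd r) (tangent_of_comp B (p (snd r)) c w)" for r
    by (simp add: h_def case_prod_unfold)
  have v0: "tangent_of_comp B (p f0) c w \<in> tangent_space B (p f0)" by (rule tangent_of_comp_in[OF atlas_B at(3)])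
  have sE: "smooth_pt ?Y (tangent_bundle F) ?E (h q0)"
  proof (rule smooth_map_on_pt)
    show "smooth_map_on ?Y {((k, f), v). k \<in> points C \<and> f \<in> points F \<and> \<zeta> k = p f \<and> v \<in> tangent_space B (p f)}
        (tangent_bundle F) ?E"
      using sys unfolding smooth_connection_system_def by simp
    show "h q0 \<in> {((k, f), v). k \<in> points C \<and> f \<in> points F \<and> \<zeta> k = p f \<and> v \<in> tangent_space B (p f)}"
      using pts v0 by (simp add: h_def kf0)
  qed
  have e0: "\<epsilon> k0 f0 (tangent_of_comp B (p f0) c w) \<in> tangent_space F f0" by (rule eps_in[OF pts(4,5,3) v0])
  then have "tangent_chart F d \<in> charts_at (tangent_bundle F) (?E (h q0))"
    using pts(2) tangent_space_fst[OF e0]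
    by (intro charts_atI tangent_chart_in_charts[OF atlas_F fibred_chartsD(2)[OF cd]])
      (simp add: Eh kf0 dom_tangent_chart)
  then have rE: "rep_smooth ?Yc (tangent_chart F d) ?E (h q0)"
    by (rule smooth_pt_rep[OF atlas_Y TF sE charts_atI[OF Yc dom_h(1)[OF q0]]])
  have dom_ev: "\<forall>\<^sub>F z in nhds (coord up_chart q0). coord_inv up_chart z \<in> dom_of up_chart"
    using eventually_in_chart[OF isD q0] by eventually_elim (rule coord_inv_in_dom)
  have "rep_smooth up_chart ?Yc h q0"
  proof (rule rep_smooth_into_product_chart)
    show "rep_smooth up_chart up_chart (\<lambda>r. fst (h r)) q0" using rep_smooth_id[OF isD q0] by (simp add: h_def)
    have "snd q0 \<in> dom_of d" by (simp add: kf0 pts)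
    from rep_smooth_compose[OF isD q0 charts_is_chart[OF fibred_chartsD(2)[OF cd]]
        product_chart_snd[OF atlas_C atlas_B atlas_F smooth_zeta fibred_chartsD(2)[OF ca] cd q0] fibred_chart_rep_smooth[OF cd this]]
    have "smooth_at (\<lambda>z. coord c (p (snd (coord_inv up_chart z)))) (coord up_chart q0)" by (simp add: rep_smooth_def)
    then have "smooth_at (\<lambda>z. (coord c (p (snd (coord_inv up_chart z))), w)) (coord up_chart q0)"
      by (rule smooth_at_Pair[OF _ smooth_at_const])
    moreover have "\<forall>\<^sub>F z in nhds (coord up_chart q0). snd (h (coord_inv up_chart z)) \<in> dom_of (tangent_chart B c) \<and>
        coord (tangent_chart B c) (snd (h (coord_inv up_chart z))) = (coord c (p (snd (coord_inv up_chart z))), w)"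
      using dom_ev
    proof eventually_elim
      case (elim z)
      show ?case
        using dom_h[OF elim] by (simp add: dom_product_chart h_def coord_tangent_chart comp_tangent_of_comp)
    qed
    ultimately show "rep_smooth up_chart (tangent_chart B c) (\<lambda>r. snd (h r)) q0"
      by (rule rep_smooth_by_formula[rotated])
    show "\<forall>\<^sub>F z in nhds (coord up_chart q0). ?g (fst (h (coord_inv up_chart z))) = fst (snd (h (coord_inv up_chart z)))"
      using dom_ev by eventually_elim (simp add: h_def dom_product_chart case_prod_unfold)
  qed
  from rep_smooth_compose(1)[OF isD q0 charts_is_chart[OF Yc] this rE]
  have "smooth_at (\<lambda>z. coord (tangent_chart F d) (?E (h (coord_inv up_chart z)))) (coord up_chart q0)"
    unfolding rep_smooth_def by (rule conjunct2)
  from smooth_at_snd[OF this] have "smooth_at (\<lambda>z. comp (?E (h (coord_inv up_chart z))) d) (coord up_chart q0)"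
    by (simp add: coord_tangent_chart)
  from smooth_at_snd[OF this] show ?thesis unfolding Eh eps_coeff_def Let_def .
qed

lemma linear_eps_coeff:
  assumes kf: "(k, f) \<in> dom_of up_chart"
  shows "linear (eps_coeff c d a (coord up_chart (k, f)))"
proof -
  note pts = point_facts[OF cd ca kf] and at = charts_at_facts[OF cd ca kf]
  note t = tangent_of_comp_in[OF atlas_B at(3)]
  show ?thesis
    by (rule linearI)
      (simp_all add: eps_coeff_coord[OF kf] tangent_of_comp_add[OF atlas_B at(3)] tangent_of_comp_scale[OF atlas_B at(3)]
        eps_add[OF pts(4,5,3) t t] eps_scale[OF pts(4,5,3) t],
       simp_all add: tangent_add_def tangent_scale_def)
qed

text \<open>
  A vector of \<open>C\<close> enters \<open>\<epsilon>\<^sup>\<up>\<close> only through its image under \<open>T\<zeta>\<close>, which has the components \<open>fst w\<close>.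
\<close>

lemma conn_coeff_eps_up:
  assumes kf: "(k, f) \<in> dom_of up_chart"
  shows "conn_coeff Fup fst C epsup a up_chart (coord up_chart (k, f)) w =
    eps_coeff c d a (coord up_chart (k, f)) (fst w)"
proof -
  note pts = point_facts[OF cd ca kf] and at = charts_at_facts[OF cd ca kf]
  let ?X = "tangent_of_comp C k a w"
  have X: "?X \<in> tangent_space C k" by (rule tangent_of_comp_in[OF atlas_C at(1)])
  have "comp (tangent_map C B \<zeta> ?X) c = fst w"
    unfolding comp_zeta[OF cd ca kf X] comp_tangent_of_comp[OF at(1)] ..
  then have T: "tangent_map C B \<zeta> ?X = tangent_of_comp B (p f) c (fst w)"
    using tangent_of_comp_comp[OF atlas_B at(3) zeta_in[OF cd ca kf X]] by simp
  have "snd (comp (epsup (k, f) ?X) up_chart) =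
      snd (comp (tangent_map Fup F snd (epsup (k, f) ?X)) d)"
    unfolding comp_snd_up[OF cd ca kf eps_up_in[OF cd ca kf X]] by simp
  also have "\<dots> = eps_coeff c d a (coord up_chart (k, f)) (fst w)"
    unfolding eps_up_snd[OF cd ca kf X] T eps_coeff_coord[OF kf] ..
  finally show ?thesis
    using coord_inv_coord[OF is_up_chart[OF cd ca] kf] by (simp add: conn_coeff_def)
qed

text \<open>
  Let \<open>\<theta>\<close> be the expression of \<open>\<gamma>\<^sub>F\<close> in charts. The coefficients of the connection given by \<open>\<gamma>\<close> are
  those of \<open>\<epsilon>\<close> composed with \<open>\<theta>\<close>, and the derivative of \<open>\<theta>\<close> maps a horizontal vector with base
  part \<open>u\<close> to the horizontal vector of \<open>\<epsilon>\<^sup>\<up>\<close> with base part \<open>T\<gamma>(u)\<close>. By the chain rule the curvature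
  terms agree even before antisymmetrisation.
\<close>

lemma curvature_pullback:
  assumes sec: "smooth_local_section C \<zeta> B U \<gamma>" and f0: "f0 \<in> points F" "p f0 \<in> U"
    and dom: "f0 \<in> dom_of d" "\<gamma> (p f0) \<in> dom_of a"
    and u: "u \<in> tangent_space B (p f0)" and v: "v \<in> tangent_space B (p f0)"
  shows "curvature F p B (system_connection p \<epsilon> \<gamma>) f0 u v =
    pullback_curvature C \<zeta> F p B \<gamma> (curvature Fup fst C epsup) f0 u v"
proof -
  let ?K = "epsup" and ?S = "system_connection p \<epsilon> \<gamma>"
  define k0 where "k0 = \<gamma> (p f0)"
  define G where "G = (\<lambda>f. (\<gamma> (p f), f))"
  have sec': "smooth_map_on B U C \<gamma>" "\<And>b. b \<in> U \<Longrightarrow> \<gamma> b \<in> points C \<and> \<zeta> (\<gamma> b) = b"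
    using sec unfolding smooth_local_section_def by simp_all
  have G0: "G f0 = (k0, f0)" by (simp add: G_def k0_def)
  have kf0: "(k0, f0) \<in> dom_of up_chart" using dom sec'(2)[OF f0(2)] by (simp add: dom_product_chart k0_def)
  note pts = point_facts[OF cd ca kf0] and at = charts_at_facts[OF cd ca kf0]
  note isD = is_up_chart[OF cd ca] and aD = up_chart_facts(2)[OF cd ca]
  note isd = charts_atD(2)[OF at(2)] and isc = charts_atD(2)[OF at(3)]
  let ?z0 = "coord d f0" and ?q0 = "coord up_chart (k0, f0)"

  have in_d: "\<forall>\<^sub>F z in nhds ?z0. z \<in> coord d ` dom_of d" by (rule eventually_in_chart[OF isd pts(2)])
  have rp: "rep_smooth d c p f0" by (rule fibred_chart_rep_smooth[OF cd pts(2)])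
  have s\<gamma>: "smooth_pt B C \<gamma> (p f0)" by (rule smooth_map_on_pt[OF sec'(1) f0(2)])
  have r\<gamma>: "rep_smooth c a \<gamma> (p f0)"
    by (rule smooth_pt_rep[OF atlas_B atlas_C s\<gamma> at(3)]) (use at(1) in \<open>simp add: k0_def\<close>)
  have r\<gamma>p: "rep_smooth d a (\<lambda>f. \<gamma> (p f)) f0" by (rule rep_smooth_compose[OF isd pts(2) isc rp r\<gamma>])
  \<comment> \<open>\<open>U\<close> contains the domain of a chart around \<open>p f0\<close>\<close>
  have in_U: "\<forall>\<^sub>F z in nhds ?z0. p (coord_inv d z) \<in> U"
  proof -
    obtain c' where c': "c' \<in> charts_at B (p f0)" "dom_of c' \<subseteq> U"
      using bspec[OF sec'(1)[unfolded smooth_map_on_def] f0(2)] by blast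
    have "rep_smooth d c' p f0"
      by (rule rep_smooth_compose[OF isd pts(2) isc rp charts_rep_smooth[OF atlas_B at(3) c'(1)]])
    then have "\<forall>\<^sub>F z in nhds ?z0. p (coord_inv d z) \<in> dom_of c'" by (simp add: rep_smooth_def)
    then show ?thesis by eventually_elim (use c'(2) in blast)
  qed
  have rG: "rep_smooth d up_chart G f0"
  proof (rule rep_smooth_into_product_chart)
    show "rep_smooth d a (\<lambda>f. fst (G f)) f0" using r\<gamma>p by (simp add: G_def)
    show "rep_smooth d d (\<lambda>f. snd (G f)) f0" using rep_smooth_id[OF isd pts(2)] by (simp add: G_def)
    show "\<forall>\<^sub>F z in nhds ?z0. \<zeta> (fst (G (coord_inv d z))) = p (snd (G (coord_inv d z)))"
      using in_U by eventually_elim (simp add: G_def sec'(2))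
  qed
  define \<theta> where "\<theta> = (\<lambda>z. coord up_chart (G (coord_inv d z)))"
  have s\<theta>: "smooth_at \<theta> ?z0" using rG by (simp add: rep_smooth_def \<theta>_def)
  have \<theta>0: "\<theta> ?z0 = ?q0" by (simp add: \<theta>_def coord_inv_coord[OF isd pts(2)] G0)
  have G_ev: "\<forall>\<^sub>F z in nhds ?z0. G (coord_inv d z) \<in> dom_of up_chart" using rG by (simp add: rep_smooth_def)
  have D\<theta>: "frechet_derivative \<theta> (at ?z0) (w, y) = (rep_deriv c a \<gamma> (p f0) w, y)" for w y
  proof -
    let ?\<alpha> = "\<lambda>z. coord a (\<gamma> (p (coord_inv d z)))"
    have "smooth_at ?\<alpha> ?z0" using r\<gamma>p by (simp add: rep_smooth_def)
    from has_derivative_Pair[OF smooth_at_has_derivative[OF this]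
        has_derivative_snd[OF has_derivative_ident]]
    have "((\<lambda>z. (?\<alpha> z, snd z)) has_derivative
        (\<lambda>h. (frechet_derivative ?\<alpha> (at ?z0) h, snd h))) (at ?z0)" .
    from fun_cong[OF frechet_derivative_at[OF this], of "(w, y)"]
    have "frechet_derivative (\<lambda>z. (?\<alpha> z, snd z)) (at ?z0) (w, y) = (frechet_derivative ?\<alpha> (at ?z0) (w, y), y)"
      by simp
    moreover have "frechet_derivative ?\<alpha> (at ?z0) (w, y) = rep_deriv c a \<gamma> (p f0) w"
      using rep_deriv_compose[OF isd pts(2) isc rp r\<gamma>, of "(w, y)"]
      by (simp add: fibred_chart_rep_deriv[OF cd pts(2)]) (simp add: rep_deriv_def)
    moreover have "\<forall>\<^sub>F z in nhds ?z0. \<theta> z = (?\<alpha> z, snd z)"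
      using in_d by eventually_elim (simp add: \<theta>_def G_def coord_product_chart coord_coord_inv)
    ultimately show ?thesis by (simp add: frechet_derivative_cong)
  qed

  have coeff_S: "\<forall>\<^sub>F z in nhds ?z0. conn_coeff F p B ?S c d z = eps_coeff c d a (\<theta> z)"
    using G_ev
  proof eventually_elim
    case (elim z)
    show ?case
      using eps_coeff_coord[OF elim[unfolded G_def]]
      by (intro ext) (simp add: conn_coeff_def system_connection_def \<theta>_def G_def Let_def)
  qed
  have conn_S: "\<forall>\<^sub>F z in nhds ?z0. connection_at F p B ?S (coord_inv d z)"
    using G_ev
  proof eventually_elim
    case (elim z)
    note pt = point_facts[OF cd ca elim[unfolded G_def]]
    show ?case
      unfolding connection_at_def system_connection_def
      using eps_in[OF pt(4,5,3)] eps_proj[OF pt(4,5,3)] by blast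
  qed
  have lin_S: "\<forall>\<^sub>F z in nhds ?z0. linear (conn_coeff F p B ?S c d z)"
    using G_ev coeff_S
    by eventually_elim (use linear_eps_coeff in \<open>simp add: \<theta>_def G_def\<close>)
  have sm_\<theta>: "smooth_at (\<lambda>z. eps_coeff c d a (\<theta> z) w) ?z0" for w
    by (rule smooth_at_compose[OF s\<theta>]) (unfold \<theta>0, rule smooth_eps_coeff[OF kf0])
  have coeff_S_w: "\<forall>\<^sub>F z in nhds ?z0. conn_coeff F p B ?S c d z w = eps_coeff c d a (\<theta> z) w" for w
    using coeff_S by eventually_elim simp
  have sm_S: "smooth_at (\<lambda>z. conn_coeff F p B ?S c d z w) ?z0" for w
    using sm_\<theta> smooth_at_cong[OF coeff_S_w] by simp

  have in_D: "\<forall>\<^sub>F q in nhds ?q0. q \<in> coord up_chart ` dom_of up_chart" by (rule eventually_in_chart[OF isD kf0])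
  have coeff_K: "\<forall>\<^sub>F q in nhds ?q0. conn_coeff Fup fst C ?K a up_chart q = (\<lambda>w. eps_coeff c d a q (fst w))"
    using in_D
  proof eventually_elim
    case (elim q)
    then obtain r where r: "q = coord up_chart r" "r \<in> dom_of up_chart" by (rule imageE)
    show ?case
      unfolding r(1) using conn_coeff_eps_up[of "fst r" "snd r"] r(2) by (intro ext) simp
  qed
  have conn_K: "\<forall>\<^sub>F q in nhds ?q0. connection_at Fup fst C ?K (coord_inv up_chart q)"
    using in_D
  proof eventually_elim
    case (elim q)
    obtain k f where kf: "coord_inv up_chart q = (k, f)" by (cases "coord_inv up_chart q")
    have kf': "(k, f) \<in> dom_of up_chart" using coord_inv_in_dom[OF elim] kf by simp
    show ?case
      unfolding connection_at_def kf
      using eps_up_in[OF cd ca kf'] eps_up_fst[OF cd ca kf'] by simp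
  qed
  have lin_K: "\<forall>\<^sub>F q in nhds ?q0. linear (conn_coeff Fup fst C ?K a up_chart q)"
    using in_D coeff_K
  proof eventually_elim
    case (elim q)
    then obtain r where r: "q = coord up_chart r" "r \<in> dom_of up_chart" by (elim imageE)
    have "linear (eps_coeff c d a q)" unfolding r(1) using linear_eps_coeff[of "fst r" "snd r"] r(2) by simp
    then show ?case unfolding elim(2) by (intro linearI) (simp_all add: linear_add linear_scale)
  qed
  have coeff_K_w: "\<forall>\<^sub>F q in nhds ?q0. conn_coeff Fup fst C ?K a up_chart q w = eps_coeff c d a q (fst w)" for w
    using coeff_K by eventually_elim simp
  have sm_K: "smooth_at (\<lambda>q. conn_coeff Fup fst C ?K a up_chart q w) ?q0" for w
    using smooth_eps_coeff[OF kf0] smooth_at_cong[OF coeff_K_w] by simp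

  have terms: "curv_term F p B ?S c d ?z0 x y =
      curv_term Fup fst C ?K a up_chart ?q0 (rep_deriv c a \<gamma> (p f0) x) (rep_deriv c a \<gamma> (p f0) y)" for x y
  proof -
    let ?\<gamma>' = "rep_deriv c a \<gamma> (p f0)"
    \<comment> \<open>\<open>\<gamma>\<close> is a section\<close>
    have id: "fst (?\<gamma>' w) = w" for w
    proof -
      have "\<forall>\<^sub>F z in nhds ?z0. fst (fst (\<theta> z)) = fst z"
        using in_d G_ev
      proof eventually_elim
        case (elim z)
        note pt = point_facts[OF cd ca elim(2)[unfolded G_def]]
        show ?case
          using fibred_chartsD(4)[OF ca pt(1)] fibred_chartsD(4)[OF cd pt(2)] pt(3) coord_coord_inv[OF elim(1)]
          by (simp add: \<theta>_def G_def coord_product_chart)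
      qed
      from frechet_derivative_cong[OF this]
      have "frechet_derivative (\<lambda>z. fst (fst (\<theta> z))) (at ?z0) (w, 0) = w"
        by (simp add: frechet_derivative_bounded_linear[OF bounded_linear_fst])
      moreover have "((\<lambda>z. fst (fst (\<theta> z))) has_derivative (\<lambda>h. fst (fst (frechet_derivative \<theta> (at ?z0) h)))) (at ?z0)"
        by (intro has_derivative_fst smooth_at_has_derivative s\<theta>)
      from fun_cong[OF frechet_derivative_at[OF this], of "(w, 0)"]
      have "fst (fst (frechet_derivative \<theta> (at ?z0) (w, 0))) = frechet_derivative (\<lambda>z. fst (fst (\<theta> z))) (at ?z0) (w, 0)" .
      ultimately show ?thesis by (simp add: D\<theta>)
    qed
    have S0: "conn_coeff F p B ?S c d ?z0 x = eps_coeff c d a ?q0 x"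
      using eventually_nhds_x_imp_x[OF coeff_S_w] by (simp add: \<theta>0)
    have K0: "conn_coeff Fup fst C ?K a up_chart ?q0 (?\<gamma>' x) = eps_coeff c d a ?q0 x"
      using eventually_nhds_x_imp_x[OF coeff_K_w] by (simp add: id)
    have "curv_term F p B ?S c d ?z0 x y =
        frechet_derivative (\<lambda>z. eps_coeff c d a (\<theta> z) y) (at ?z0) (x, eps_coeff c d a ?q0 x)"
      unfolding curv_term_def S0 frechet_derivative_cong[OF coeff_S_w] ..
    also have "\<dots> = frechet_derivative (\<lambda>q. eps_coeff c d a q y) (at ?q0) (?\<gamma>' x, eps_coeff c d a ?q0 x)"
      using frechet_derivative_compose[OF s\<theta>, of "\<lambda>q. eps_coeff c d a q y"] smooth_eps_coeff[OF kf0]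
      by (simp add: \<theta>0 D\<theta>)
    also have "\<dots> = curv_term Fup fst C ?K a up_chart ?q0 (?\<gamma>' x) (?\<gamma>' y)"
      unfolding curv_term_def K0 frechet_derivative_cong[OF coeff_K_w] id ..
    finally show ?thesis .
  qed

  define r where "r = (- 2) *\<^sub>R (curv_term F p B ?S c d ?z0 (comp u c) (comp v c) -
      curv_term F p B ?S c d ?z0 (comp v c) (comp u c))"
  have curv_S: "curvature F p B ?S f0 u v = tangent_of_comp F f0 d (0, r)"
    unfolding r_def by (rule curvature_in_chart[OF atlas_F atlas_B cd pts(2) conn_S lin_S sm_S u v])
  let ?u = "tangent_map B C \<gamma> u" and ?v = "tangent_map B C \<gamma> v"
  have t: "?u \<in> tangent_space C k0" "?v \<in> tangent_space C k0"
    using tangent_map_in[OF atlas_B atlas_C s\<gamma>] u v by (simp_all add: k0_def)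
  have ct: "comp ?u a = rep_deriv c a \<gamma> (p f0) (comp u c)" "comp ?v a = rep_deriv c a \<gamma> (p f0) (comp v c)"
    using comp_tangent_map[OF atlas_B atlas_C s\<gamma> _ at(3), of _ a] u v at(1) by (simp_all add: k0_def)
  have "curvature Fup fst C ?K (k0, f0) ?u ?v = tangent_of_comp Fup (k0, f0) up_chart
      (0, (- 2) *\<^sub>R (curv_term Fup fst C ?K a up_chart ?q0 (comp ?u a) (comp ?v a) -
                   curv_term Fup fst C ?K a up_chart ?q0 (comp ?v a) (comp ?u a)))"
    by (rule curvature_in_chart[OF atlas_F_up atlas_C aD kf0 conn_K lin_K sm_K]) (use t in simp_all)
  then have curv_K: "curvature Fup fst C ?K (k0, f0) ?u ?v = tangent_of_comp Fup (k0, f0) up_chart (0, r)"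
    unfolding ct terms[symmetric] r_def .
  let ?W = "tangent_of_comp Fup (k0, f0) up_chart (0, r)"
  have W: "?W \<in> tangent_space Fup (k0, f0)" by (rule tangent_of_comp_in[OF atlas_F_up at(5)])
  have "tangent_of_comp F f0 d (0, r) = tangent_map Fup F snd ?W"
  proof (rule tangent_eqI[OF tangent_of_comp_in[OF atlas_F at(2)] snd_up_in[OF cd ca kf0 W] at(2)])
    show "comp (tangent_of_comp F f0 d (0, r)) d = comp (tangent_map Fup F snd ?W) d"
      unfolding comp_snd_up[OF cd ca kf0 W] comp_tangent_of_comp[OF at(2)] comp_tangent_of_comp[OF at(5)] by simp
  qed
  then show ?thesis
    unfolding curv_S pullback_curvature_def gamma_F_def k0_def[symmetric] curv_K .
qed

end

end

theorem theorem4p1p1: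
  fixes B :: "('b, 'x::coordinate_space) manifold"
    and F :: "('f, 'x \<times> 'y::coordinate_space) manifold"
    and C :: "('c, 'x \<times> 'z::coordinate_space) manifold"
    and p :: "'f \<Rightarrow> 'b" and \<zeta> :: "'c \<Rightarrow> 'b"
    and \<epsilon> :: "'c \<Rightarrow> 'f \<Rightarrow> ('b, 'x) tvec \<Rightarrow> ('f, 'x \<times> 'y) tvec"
  assumes "smooth_fibred_manifold F p B"
    and "smooth_fibred_manifold C \<zeta> B"
    and "smooth_connection_system C \<zeta> F p B \<epsilon>"
  shows
    "(\<forall>U \<gamma>. smooth_local_section C \<zeta> B U \<gamma> \<longrightarrow>
       (\<forall>f\<in>points F. p f \<in> U \<longrightarrow> (\<forall>v\<in>tangent_space B (p f).
          system_connection p \<epsilon> \<gamma> f v =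
          pullback_connection C \<zeta> F p B \<gamma> (eps_up C \<zeta> F p B \<epsilon>) f v))) \<and>
     (\<forall>U \<gamma>. smooth_local_section C \<zeta> B U \<gamma> \<longrightarrow>
       (\<forall>f\<in>points F. p f \<in> U \<longrightarrow>
          (\<forall>u\<in>tangent_space B (p f). \<forall>v\<in>tangent_space B (p f).
             curvature F p B (system_connection p \<epsilon> \<gamma>) f u v =
             pullback_curvature C \<zeta> F p B \<gamma>
               (curvature (F_up C \<zeta> F p B) fst C (eps_up C \<zeta> F p B \<epsilon>)) f u v)))"
proof (intro conjI allI impI ballI)
  fix U \<gamma> f v
  assume sec: "smooth_local_section C \<zeta> B U \<gamma>" and f: "f \<in> points F" "p f \<in> U"
    and v: "v \<in> tangent_space B (p f)"
  have k: "\<gamma> (p f) \<in> points C" "\<zeta> (\<gamma> (p f)) = p f"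
    using sec f(2) unfolding smooth_local_section_def by simp_all
  show "system_connection p \<epsilon> \<gamma> f v = pullback_connection C \<zeta> F p B \<gamma> (eps_up C \<zeta> F p B \<epsilon>) f v"
    unfolding pullback_connection_def gamma_F_def system_connection_def
    by (rule reducing_factor_eps_up[OF assms k(1) f(1) k(2) v, symmetric])
next
  fix U \<gamma> f u v
  assume sec: "smooth_local_section C \<zeta> B U \<gamma>" and f: "f \<in> points F" "p f \<in> U"
    and u: "u \<in> tangent_space B (p f)" and v: "v \<in> tangent_space B (p f)"
  have k: "\<gamma> (p f) \<in> points C" "\<zeta> (\<gamma> (p f)) = p f"
    using sec f(2) unfolding smooth_local_section_def by simp_all
  obtain c d a where ch: "(c, d) \<in> fibred_charts F p B" "(c, a) \<in> fibred_charts C \<zeta> B"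
      "f \<in> dom_of d" "\<gamma> (p f) \<in> dom_of a"
    by (rule ex_fibred_charts_same_base[OF assms k(1) f(1) k(2)])
  show "curvature F p B (system_connection p \<epsilon> \<gamma>) f u v =
      pullback_curvature C \<zeta> F p B \<gamma> (curvature (F_up C \<zeta> F p B) fst C (eps_up C \<zeta> F p B \<epsilon>)) f u v"
    by (rule curvature_pullback[OF assms ch(1,2) sec f ch(3,4) u v])
qed

end
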